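(* For every integer $d\ge 1$ there exists a constant $C_d>0$ depending only on $d$ such that the following holds. Let $\Omega\subseteq\mathbb{R}^{2d}$ be a compact set with $0<\mathcal{H}^{2d-1}(\partial\Omega)<\infty$ and with regular boundary at scale $\eta\in(0,1]$. Let $g\in L^2(\mathbb{R}^d)$ be such that $\|g\|_2=1$ and, for some $s\ge 1$, $$C_g:=\int_{\mathbb{R}^{2d}}(1+|z|)^s|V_gg(z)|^2\,dz<\infty.$$ Let $C'_g=C_d\cdot C_g^{\frac{2d}{2d+s-1}}$ and $$\gamma=C'_g\cdot\left(\kappa_{\partial\Omega,\eta}\cdot\eta^{2d-1}\right)^{-\frac{s-1}{2d+s-1}}\cdot\mathcal{H}^{2d-1}(\partial\Omega).$$ Let $A_\Omega=\lceil|\Omega|\rceil$ and let $\lambda_1\ge\lambda_2\ge\dots$ be the eigenvalues of $L_\Omega$ in decreasing order, counted with multiplicity. Then: (i) For every $k=A_\Omega+\gamma h\in\mathbb{N}$ with $h\ge 1$ real, $$\lambda_k\le e^{\left(\frac{2d+s-1}{2d}\right)^2}\cdot h^{-\frac{2d+s-1}{2d}}\cdot(1+\log(C_gh))^{\frac{s-1}{2d}}.$$ (ii) For every $k=A_\Omega-\gamma h\in\mathbb{N}$ with $h\ge 1$ real, $$\lambda_k\ge 1-e^{\left(\frac{2d+s-1}{2d}\right)^2}\cdot h^{-\frac{2d+s-1}{2d}}\cdot(1+\log(C_gh))^{\frac{s-1}{2d}}.$$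
   Context: Short-time Fourier transform: for $f,g\in L^2(\mathbb{R}^d)$, $V_gf(x,\xi)=\int_{\mathbb{R}^d}f(t)\overline{g(t-x)}e^{-2\pi i\xi t}\,dt$, $(x,\xi)\in\mathbb{R}^d\times\mathbb{R}^d$. If $\|g\|_2=1$, then $V_g:L^2(\mathbb{R}^d)\to L^2(\mathbb{R}^{2d})$ is an isometry. Time-frequency concentration operator: for compact $\Omega\subset\mathbb{R}^{2d}$, $L_\Omega:L^2(\mathbb{R}^d)\to L^2(\mathbb{R}^d)$ is $L_\Omega f=V_g^*[1_\Omega\cdot V_gf]$, i.e. $L_\Omega f(t)=\int_\Omega V_gf(x,\xi)\,g(t-x)e^{2\pi i\xi t}\,dx\,d\xi$. It is compact, positive semi-definite and contractive. Its ordered eigenvalues are, precisely, $\lambda_k=\inf\{\|L_\Omega-S\|:S\text{ bounded operator on }L^2(\mathbb{R}^d),\ \dim(\mathrm{Im}\,S)<k\}$ for $k\ge 1$; apart from the value $0$, this sequence lists the spectrum of $L_\Omega$ with multiplicities. Here $\mathbb{N}=\{1,2,\dots\}$. $|\Omega|$ is Lebesgue measure, $\lceil x\rceil$ is the smallest integer $\ge x$, $\mathcal{H}^{2d-1}$ is $(2d-1)$-dimensional Hausdorff measure, $\partial\Omega$ is the topological boundary, $|z|$ is the Euclidean norm, $B_r(z)$ is the Euclidean ball. Regular boundary: a compact $\Omega\subseteq\mathbb{R}^{2d}$ has regular boundary at scale $\eta>0$ if there is $\kappa>0$ with $\mathcal{H}^{2d-1}(\partial\Omega\cap B_r(z))\ge\kappa\,r^{2d-1}$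 for all $0<r\le\eta$ and $z\in\partial\Omega$. The largest such constant is $\kappa_{\partial\Omega,\eta}=\inf_{0<r\le\eta}\inf_{z\in\partial\Omega}r^{-(2d-1)}\mathcal{H}^{2d-1}(\partial\Omega\cap B_r(z))$. *)

theory Defs
  imports "HOL-Analysis.Analysis"
begin

section \<open>The complex Hilbert space of square-integrable functions\<close>

definition square_integrable :: "('a::euclidean_space \<Rightarrow> complex) \<Rightarrow> bool" where
  "square_integrable f \<longleftrightarrow>
     f \<in> borel_measurable lborel \<and> integrable lborel (\<lambda>x. (cmod (f x))\<^sup>2)"

definition ae_equal :: "('a::euclidean_space \<Rightarrow> complex) \<Rightarrow> ('a \<Rightarrow> complex) \<Rightarrow> bool" where
  "ae_equal f g \<longleftrightarrow>
     square_integrable f \<and> square_integrable g \<and> (AE x in lborel. f x = g x)"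

lemma square_integrable_mult:
  assumes "square_integrable f" "square_integrable g"
  shows "integrable lborel (\<lambda>x. f x * g x)"
proof (rule Bochner_Integration.integrable_bound)
  show "integrable lborel (\<lambda>x. (cmod (f x))\<^sup>2 + (cmod (g x))\<^sup>2)"
    using assms by (auto simp: square_integrable_def)
  show "(\<lambda>x. f x * g x) \<in> borel_measurable lborel"
    using assms by (auto simp: square_integrable_def)
  have "a * b \<le> a\<^sup>2 + b\<^sup>2" if "0 \<le> a" "0 \<le> b" for a b :: real
    using sum_squares_bound[of a b] that mult_nonneg_nonneg[of a b] by linarith
  then show "AE x in lborel. cmod (f x * g x) \<le> norm ((cmod (f x))\<^sup>2 + (cmod (g x))\<^sup>2)"
    by (auto simp: norm_mult)
qed

lemma square_integrable_cnj:
  assumes "square_integrable f"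
  shows "square_integrable (\<lambda>x. cnj (f x))"
proof -
  have [measurable]: "cnj \<in> borel_measurable borel"
    by (intro borel_measurable_continuous_onI continuous_on_cnj continuous_intros)
  show ?thesis using assms by (auto simp: square_integrable_def)
qed

lemma square_integrable_cmult:
  "square_integrable f \<Longrightarrow> square_integrable (\<lambda>x. c * f x)"
  unfolding square_integrable_def by (auto simp: norm_mult power_mult_distrib)

lemma square_integrable_add:
  assumes "square_integrable f" "square_integrable g"
  shows "square_integrable (\<lambda>x. f x + g x)"
proof -
  have "integrable lborel (\<lambda>x. (cmod (f x + g x))\<^sup>2)"
  proof (rule Bochner_Integration.integrable_bound)
    show "integrable lborel (\<lambda>x. 2 * (cmod (f x))\<^sup>2 + 2 * (cmod (g x))\<^sup>2)"
      using assms by (auto simp: square_integrable_def)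
    show "(\<lambda>x. (cmod (f x + g x))\<^sup>2) \<in> borel_measurable lborel"
      using assms by (auto simp: square_integrable_def)
    have "(cmod (a + b))\<^sup>2 \<le> 2 * (cmod a)\<^sup>2 + 2 * (cmod b)\<^sup>2" for a b
    proof -
      have "(cmod (a + b))\<^sup>2 \<le> (cmod a + cmod b)\<^sup>2"
        by (intro power_mono norm_triangle_ineq) auto
      also have "\<dots> \<le> 2 * (cmod a)\<^sup>2 + 2 * (cmod b)\<^sup>2"
        using sum_squares_bound[of "cmod a" "cmod b"] by (simp add: power2_sum)
      finally show ?thesis .
    qed
    then show "AE x in lborel. norm ((cmod (f x + g x))\<^sup>2)
                 \<le> norm (2 * (cmod (f x))\<^sup>2 + 2 * (cmod (g x))\<^sup>2)"
      by auto
  qed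
  then show ?thesis using assms by (auto simp: square_integrable_def)
qed

lemma square_integrable_zero: "square_integrable (\<lambda>x. 0)"
  by (simp add: square_integrable_def)

quotient_type (overloaded) 'a L2 = "'a::euclidean_space \<Rightarrow> complex" / partial: ae_equal
proof (rule part_equivpI)
  show "\<exists>f::'a \<Rightarrow> complex. ae_equal f f"
    using square_integrable_zero by (auto simp: ae_equal_def)
  show "symp (ae_equal :: ('a \<Rightarrow> complex) \<Rightarrow> _)"
    by (auto simp: symp_def ae_equal_def)
  show "transp (ae_equal :: ('a \<Rightarrow> complex) \<Rightarrow> _)"
    by (auto simp: transp_def ae_equal_def)
qed

lift_definition cinner_L2 :: "'a::euclidean_space L2 \<Rightarrow> 'a L2 \<Rightarrow> complex"
  is "\<lambda>f g. LINT x|lborel. f x * cnj (g x)"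
proof -
  fix f f' g g' :: "'a \<Rightarrow> complex"
  assume "ae_equal f f'" "ae_equal g g'"
  then have sq: "square_integrable f" "square_integrable f'" "square_integrable g" "square_integrable g'"
    and ae: "AE x in lborel. f x = f' x" "AE x in lborel. g x = g' x"
    by (auto simp: ae_equal_def)
  show "(LINT x|lborel. f x * cnj (g x)) = (LINT x|lborel. f' x * cnj (g' x))"
  proof (rule integral_cong_AE)
    show "(\<lambda>x. f x * cnj (g x)) \<in> borel_measurable lborel"
      using square_integrable_mult[OF sq(1) square_integrable_cnj[OF sq(3)]] by auto
    show "(\<lambda>x. f' x * cnj (g' x)) \<in> borel_measurable lborel"
      using square_integrable_mult[OF sq(2) square_integrable_cnj[OF sq(4)]] by auto
    show "AE x in lborel. f x * cnj (g x) = f' x * cnj (g' x)"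
      using ae by eventually_elim simp
  qed
qed

lift_definition scaleL2 :: "complex \<Rightarrow> 'a::euclidean_space L2 \<Rightarrow> 'a L2"
  is "\<lambda>c f x. c * f x"
  by (auto simp: ae_equal_def square_integrable_cmult)

instantiation L2 :: (euclidean_space) real_inner
begin

lift_definition zero_L2 :: "'a L2" is "\<lambda>x. 0"
  by (simp add: ae_equal_def square_integrable_zero)

lift_definition plus_L2 :: "'a L2 \<Rightarrow> 'a L2 \<Rightarrow> 'a L2" is "\<lambda>f g x. f x + g x"
  by (auto simp: ae_equal_def square_integrable_add)

definition uminus_L2 :: "'a L2 \<Rightarrow> 'a L2" where "uminus_L2 f = scaleL2 (- 1) f"

definition minus_L2 :: "'a L2 \<Rightarrow> 'a L2 \<Rightarrow> 'a L2" where "minus_L2 f g = f + (- g)"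

definition scaleR_L2 :: "real \<Rightarrow> 'a L2 \<Rightarrow> 'a L2"
  where "scaleR_L2 r f = scaleL2 (complex_of_real r) f"

definition inner_L2 :: "'a L2 \<Rightarrow> 'a L2 \<Rightarrow> real"
  where "inner_L2 f g = Re (cinner_L2 f g)"

definition norm_L2 :: "'a L2 \<Rightarrow> real" where "norm_L2 f = sqrt (inner f f)"

definition sgn_L2 :: "'a L2 \<Rightarrow> 'a L2" where "sgn_L2 f = scaleR (inverse (norm f)) f"

definition dist_L2 :: "'a L2 \<Rightarrow> 'a L2 \<Rightarrow> real" where "dist_L2 f g = norm (f - g)"

definition uniformity_L2 :: "('a L2 \<times> 'a L2) filter"
  where "uniformity_L2 = (INF e\<in>{0<..}. principal {(f, g). dist f g < e})"

definition open_L2 :: "'a L2 set \<Rightarrow> bool"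
  where "open_L2 U = (\<forall>f\<in>U. \<forall>\<^sub>F (f', g) in uniformity. f' = f \<longrightarrow> g \<in> U)"

instance
proof
  fix f g h :: "'a L2" and a b :: real
  show assoc: "f + g + h = f + (g + h)"
    by transfer (auto simp: ae_equal_def square_integrable_add add.assoc)
  show comm: "f + g = g + f"
    by transfer (auto simp: ae_equal_def square_integrable_add add.commute)
  show "0 + f = f"
    by transfer (auto simp: ae_equal_def)
  show "- f + f = 0"
    unfolding uminus_L2_def
    by transfer (auto simp: ae_equal_def square_integrable_zero square_integrable_cmult
        square_integrable_add intro!: square_integrable_add[of "\<lambda>x. - _ x", simplified])
  show "f - g = f + - g" by (rule minus_L2_def)
  show "a *\<^sub>R (f + g) = a *\<^sub>R f + a *\<^sub>R g"
    unfolding scaleR_L2_def by transfer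
      (auto simp: ae_equal_def square_integrable_add square_integrable_cmult ring_distribs)
  show "(a + b) *\<^sub>R f = a *\<^sub>R f + b *\<^sub>R f"
    unfolding scaleR_L2_def by transfer
      (auto simp: ae_equal_def square_integrable_add square_integrable_cmult ring_distribs)
  show "a *\<^sub>R b *\<^sub>R f = (a * b) *\<^sub>R f"
    unfolding scaleR_L2_def by transfer
      (auto simp: ae_equal_def square_integrable_cmult mult.assoc)
  show "1 *\<^sub>R f = f"
    unfolding scaleR_L2_def by transfer (auto simp: ae_equal_def)
  show "sgn f = inverse (norm f) *\<^sub>R f" by (rule sgn_L2_def)
  show "dist f g = norm (f - g)" by (rule dist_L2_def)
  show "uniformity = (INF e\<in>{0<..}. principal {(x, y::'a L2). dist x y < e})"
    by (rule uniformity_L2_def)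
  show "open U = (\<forall>x\<in>U. \<forall>\<^sub>F (x', y) in uniformity. x' = x \<longrightarrow> y \<in> U)" for U :: "'a L2 set"
    by (rule open_L2_def)
  show "inner f g = inner g f"
    unfolding inner_L2_def
  proof transfer
    fix f g :: "'a \<Rightarrow> complex"
    have "(LINT x|lborel. g x * cnj (f x)) = (LINT x|lborel. cnj (f x * cnj (g x)))"
      by (simp add: mult.commute)
    also have "\<dots> = cnj (LINT x|lborel. f x * cnj (g x))"
      by (rule Bochner_Integration.integral_cnj)
    finally show "Re (LINT x|lborel. f x * cnj (g x)) = Re (LINT x|lborel. g x * cnj (f x))"
      by simp
  qed
  show "inner (f + g) h = inner f h + inner g h"
    unfolding inner_L2_def
    by transfer (auto simp: ae_equal_def ring_distribs square_integrable_mult square_integrable_cnj)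
  show "inner (a *\<^sub>R f) g = a * inner f g"
    unfolding inner_L2_def scaleR_L2_def
    by transfer (auto simp: ae_equal_def mult.assoc)
  have sq: "Re (LINT x|lborel. \<phi> x * cnj (\<phi> x)) = (LINT x|lborel. (cmod (\<phi> x))\<^sup>2)"
    for \<phi> :: "'a \<Rightarrow> complex"
    by (simp add: complex_norm_square[symmetric] del: of_real_power)
  show "0 \<le> inner f f"
    unfolding inner_L2_def by transfer (simp add: sq)
  show "inner f f = 0 \<longleftrightarrow> f = 0"
    unfolding inner_L2_def
    by transfer (auto simp: sq ae_equal_def square_integrable_zero square_integrable_def
        integral_nonneg_eq_0_iff_AE)
  show "norm f = sqrt (inner f f)" by (rule norm_L2_def)
qed

end

interpretation L2: vector_space "scaleL2 :: complex \<Rightarrow> 'a::euclidean_space L2 \<Rightarrow> 'a L2"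
proof
  fix a b :: complex and f g :: "'a L2"
  show "scaleL2 a (f + g) = scaleL2 a f + scaleL2 a g"
    by transfer (auto simp: ae_equal_def square_integrable_add square_integrable_cmult ring_distribs)
  show "scaleL2 (a + b) f = scaleL2 a f + scaleL2 b f"
    by transfer (auto simp: ae_equal_def square_integrable_add square_integrable_cmult ring_distribs)
  show "scaleL2 a (scaleL2 b f) = scaleL2 (a * b) f"
    by transfer (auto simp: ae_equal_def square_integrable_cmult mult.assoc)
  show "scaleL2 1 f = f"
    by transfer (auto simp: ae_equal_def)
qed


section \<open>Time-frequency concentration operators\<close>

(* V_g f, as a function on phase space; independent of the representatives chosen *)
definition stft :: "'a::euclidean_space L2 \<Rightarrow> 'a L2 \<Rightarrow> 'a \<times> 'a \<Rightarrow> complex" where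
  "stft g f = (\<lambda>(x, \<xi>).
     LINT t|lborel. rep_L2 f t * cnj (rep_L2 g (t - x)) * cis (- (2 * pi * (\<xi> \<bullet> t))))"

definition conc_fun :: "'a::euclidean_space L2 \<Rightarrow> ('a \<times> 'a) set \<Rightarrow> 'a L2 \<Rightarrow> 'a \<Rightarrow> complex" where
  "conc_fun g \<Omega> f t =
     (LINT z:\<Omega>|lborel. stft g f z * rep_L2 g (t - fst z) * cis (2 * pi * (snd z \<bullet> t)))"

(* conc_fun is square integrable for compact \<Omega>, see square_integrable_conc_fun below *)
definition conc_op :: "'a::euclidean_space L2 \<Rightarrow> ('a \<times> 'a) set \<Rightarrow> 'a L2 \<Rightarrow> 'a L2" where
  "conc_op g \<Omega> f = abs_L2 (conc_fun g \<Omega> f)"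

definition bounded_operator :: "('a::euclidean_space L2 \<Rightarrow> 'a L2) \<Rightarrow> bool" where
  "bounded_operator S \<longleftrightarrow> bounded_linear S \<and> (\<forall>c f. S (scaleL2 c f) = scaleL2 c (S f))"

(* dim (Im S) < k over the complex numbers; in particular Im S is finite-dimensional *)
definition rank_less :: "('a::euclidean_space L2 \<Rightarrow> 'a L2) \<Rightarrow> nat \<Rightarrow> bool" where
  "rank_less S k \<longleftrightarrow>
     (\<exists>B. finite B \<and> card B < k \<and> L2.independent B \<and> L2.span B = range S)"

(* the k-th eigenvalue of the concentration operator, k = 1, 2, ...,
   as its k-th approximation number *)
definition conc_eigenvalue :: "'a::euclidean_space L2 \<Rightarrow> ('a \<times> 'a) set \<Rightarrow> nat \<Rightarrow> real" where
  "conc_eigenvalue g \<Omega> k =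
     Inf {onorm (\<lambda>f. conc_op g \<Omega> f - S f) |S. bounded_operator S \<and> rank_less S k}"

definition weighted_integrable :: "'a::euclidean_space L2 \<Rightarrow> real \<Rightarrow> bool" where
  "weighted_integrable g s \<longleftrightarrow>
     integrable lborel (\<lambda>z::'a \<times> 'a. (1 + norm z) powr s * (cmod (stft g g z))\<^sup>2)"

definition window_const :: "'a::euclidean_space L2 \<Rightarrow> real \<Rightarrow> real" where
  "window_const g s =
     (LINT z|lborel. (1 + norm (z::'a \<times> 'a)) powr s * (cmod (stft g g z))\<^sup>2)"

lemma rep_L2_square_integrable: "square_integrable (rep_L2 f)"
  using Quotient3_rep_reflp[OF Quotient3_L2, of f] by (simp add: ae_equal_def)

lemma rep_L2_measurable [measurable]: "rep_L2 f \<in> borel_measurable borel"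
  using rep_L2_square_integrable[of f] by (simp add: square_integrable_def)

lemma rep_L2_nn_integral_finite: "(\<integral>\<^sup>+x. (ennreal (cmod (rep_L2 f x)))\<^sup>2 \<partial>lborel) < \<infinity>"
proof -
  have "integrable lborel (\<lambda>x. (cmod (rep_L2 f x))\<^sup>2)"
    using rep_L2_square_integrable[of f] by (simp add: square_integrable_def)
  then have "(\<integral>\<^sup>+x. ennreal ((cmod (rep_L2 f x))\<^sup>2) \<partial>lborel) < \<infinity>"
    by (subst (asm) integrable_iff_bounded) simp
  then show ?thesis by (simp add: ennreal_power)
qed

lemma nn_integral_lborel_shift:
  fixes h :: "'a::euclidean_space \<Rightarrow> ennreal"
  assumes [measurable]: "h \<in> borel_measurable borel"
  shows "(\<integral>\<^sup>+t. h (t - x) \<partial>lborel) = (\<integral>\<^sup>+t. h t \<partial>lborel)"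
proof -
  have "(\<integral>\<^sup>+t. h t \<partial>lborel) = (\<integral>\<^sup>+t. h t \<partial>distr lborel borel ((+) (- x)))"
    by (simp add: lborel_distr_plus)
  also have "\<dots> = (\<integral>\<^sup>+t. h (t - x) \<partial>lborel)"
    by (subst nn_integral_distr) auto
  finally show ?thesis by simp
qed

lemma ennreal_norm_integral_le:
  fixes h :: "'b \<Rightarrow> complex"
  shows "ennreal (norm (integral\<^sup>L M h)) \<le> (\<integral>\<^sup>+x. norm (h x) \<partial>M)"
  by (cases "integrable M h") (auto simp: integral_norm_bound_ennreal not_integrable_integral_eq)

lemma stft_measurable [measurable]: "stft g f \<in> borel_measurable borel"
proof -
  have "(\<lambda>z. LINT t|lborel. rep_L2 f t * cnj (rep_L2 g (t - fst z)) * cis (- (2 * pi * (snd z \<bullet> t))))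
          \<in> borel_measurable (borel :: ('a \<times> 'a) measure)"
  proof (rule lborel.borel_measurable_lebesgue_integral)
    have [measurable]: "cnj \<in> borel_measurable borel" "cis \<in> borel_measurable borel"
      by (auto intro!: borel_measurable_continuous_onI continuous_on_cnj continuous_on_cis
          continuous_intros)
    show "(\<lambda>(z, t). rep_L2 f t * cnj (rep_L2 g (t - fst z)) * cis (- (2 * pi * (snd z \<bullet> t))))
            \<in> borel_measurable ((borel :: ('a \<times> 'a) measure) \<Otimes>\<^sub>M lborel)"
      unfolding borel_prod[symmetric] by measurable
  qed
  then show ?thesis by (simp add: stft_def case_prod_unfold)
qed

lemma stft_bounded: "\<exists>M. \<forall>z. cmod (stft g f z) \<le> M"
proof -
  define F where "F = (\<integral>\<^sup>+t. (ennreal (cmod (rep_L2 f t)))\<^sup>2 \<partial>lborel)"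
  define G where "G = (\<integral>\<^sup>+t. (ennreal (cmod (rep_L2 g t)))\<^sup>2 \<partial>lborel)"
  have fin: "F * G < \<infinity>"
    using rep_L2_nn_integral_finite[of f] rep_L2_nn_integral_finite[of g]
    by (auto simp: F_def G_def ennreal_mult_less_top)
  have "(cmod (stft g f z))\<^sup>2 \<le> enn2real (F * G)" for z
  proof -
    obtain x \<xi> where z: "z = (x, \<xi>)" by (cases z)
    have "ennreal (cmod (stft g f z))
            \<le> (\<integral>\<^sup>+t. ennreal (cmod (rep_L2 f t)) * ennreal (cmod (rep_L2 g (t - x))) \<partial>lborel)"
      unfolding stft_def z
      by (simp, rule order_trans[OF ennreal_norm_integral_le]) (simp add: norm_mult ennreal_mult)
    then have "(ennreal (cmod (stft g f z)))\<^sup>2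
            \<le> (\<integral>\<^sup>+t. ennreal (cmod (rep_L2 f t)) * ennreal (cmod (rep_L2 g (t - x))) \<partial>lborel)\<^sup>2"
      by (intro power_mono) auto
    also have "\<dots> \<le> F * (\<integral>\<^sup>+t. (ennreal (cmod (rep_L2 g (t - x))))\<^sup>2 \<partial>lborel)"
      unfolding F_def by (rule Cauchy_Schwarz_nn_integral) auto
    also have "\<dots> = F * G"
      unfolding G_def by (subst nn_integral_lborel_shift) auto
    finally have "ennreal ((cmod (stft g f z))\<^sup>2) \<le> F * G"
      by (simp add: ennreal_power)
    then show ?thesis
      using fin enn2real_mono[of "ennreal ((cmod (stft g f z))\<^sup>2)" "F * G"] by simp
  qed
  then have "cmod (stft g f z) \<le> sqrt (enn2real (F * G))" for z
    by (simp add: real_le_rsqrt)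
  then show ?thesis by blast
qed

lemma square_integrable_conc_fun:
  fixes g f :: "'a::euclidean_space L2"
  assumes "compact \<Omega>"
  shows "square_integrable (conc_fun g \<Omega> f)"
proof -
  have \<Omega> [measurable]: "\<Omega> \<in> sets borel" and fin: "emeasure lborel \<Omega> < \<infinity>"
    using borel_compact[OF assms] emeasure_bounded_finite[OF compact_imp_bounded[OF assms]] by simp_all
  have [measurable]: "cis \<in> borel_measurable borel"
    by (auto intro!: borel_measurable_continuous_onI continuous_on_cis continuous_intros)
  obtain M where M: "\<And>z. cmod (stft g f z) \<le> M" using stft_bounded[of g f] by blast
  have M0: "0 \<le> M" using M[of undefined] norm_ge_zero order_trans by blast
  define G where "G = (\<integral>\<^sup>+t. (ennreal (cmod (rep_L2 g t)))\<^sup>2 \<partial>lborel)"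
  have meas [measurable]: "conc_fun g \<Omega> f \<in> borel_measurable borel"
  proof -
    have "(\<lambda>t. LINT z|lborel. indicator \<Omega> z *\<^sub>R
             (stft g f z * rep_L2 g (t - fst z) * cis (2 * pi * (snd z \<bullet> t))))
            \<in> borel_measurable (borel :: 'a measure)"
    proof (rule lborel.borel_measurable_lebesgue_integral)
      have [measurable]: "\<Omega> \<in> sets (borel \<Otimes>\<^sub>M borel)"
          "stft g f \<in> borel_measurable (borel \<Otimes>\<^sub>M borel)"
        unfolding borel_prod by (rule \<Omega>, rule stft_measurable)
      show "(\<lambda>(t, z). indicator \<Omega> z *\<^sub>R
             (stft g f z * rep_L2 g (t - fst z) * cis (2 * pi * (snd z \<bullet> t))))
            \<in> borel_measurable ((borel :: 'a measure) \<Otimes>\<^sub>M lborel)"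
        unfolding lborel_prod[symmetric] by measurable
    qed
    then show ?thesis by (simp add: conc_fun_def[abs_def] set_lebesgue_integral_def)
  qed
  have pt: "(ennreal (cmod (conc_fun g \<Omega> f t)))\<^sup>2
      \<le> (ennreal M)\<^sup>2 * emeasure lborel \<Omega> *
          (\<integral>\<^sup>+z. indicator \<Omega> z * (ennreal (cmod (rep_L2 g (t - fst z))))\<^sup>2 \<partial>lborel)" for t
  proof -
    have [measurable]: "(\<lambda>z. rep_L2 g (t - fst z)) \<in> borel_measurable (borel :: ('a \<times> 'a) measure)"
      unfolding borel_prod[symmetric] by measurable
    have "ennreal (cmod (conc_fun g \<Omega> f t))
        \<le> (\<integral>\<^sup>+z. ennreal M * indicator \<Omega> z *
               (indicator \<Omega> z * ennreal (cmod (rep_L2 g (t - fst z)))) \<partial>lborel)"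
      unfolding conc_fun_def set_lebesgue_integral_def
      by (rule order_trans[OF ennreal_norm_integral_le], rule nn_integral_mono)
        (auto simp: norm_mult indicator_def M M0 ennreal_mult[symmetric]
           intro!: ennreal_leI mult_right_mono)
    then have "(ennreal (cmod (conc_fun g \<Omega> f t)))\<^sup>2
        \<le> (\<integral>\<^sup>+z. ennreal M * indicator \<Omega> z *
               (indicator \<Omega> z * ennreal (cmod (rep_L2 g (t - fst z)))) \<partial>lborel)\<^sup>2"
      by (intro power_mono) auto
    also have "\<dots> \<le> (\<integral>\<^sup>+z. (ennreal M * indicator \<Omega> z)\<^sup>2 \<partial>lborel) *
       (\<integral>\<^sup>+z. (indicator \<Omega> z * ennreal (cmod (rep_L2 g (t - fst z))))\<^sup>2 \<partial>lborel)"
      by (rule Cauchy_Schwarz_nn_integral) measurable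
    also have "(\<lambda>z. (ennreal M * indicator \<Omega> z)\<^sup>2) = (\<lambda>z. (ennreal M)\<^sup>2 * indicator \<Omega> z)"
      by (auto simp: indicator_def fun_eq_iff)
    also have "(\<lambda>z. (indicator \<Omega> z * ennreal (cmod (rep_L2 g (t - fst z))))\<^sup>2)
             = (\<lambda>z. indicator \<Omega> z * (ennreal (cmod (rep_L2 g (t - fst z))))\<^sup>2)"
      by (auto simp: indicator_def fun_eq_iff)
    finally show ?thesis
      by (simp add: nn_integral_cmult)
  qed
  have swap: "(\<integral>\<^sup>+t. \<integral>\<^sup>+z. indicator \<Omega> z * (ennreal (cmod (rep_L2 g (t - fst z))))\<^sup>2 \<partial>lborel \<partial>lborel)
      = (\<integral>\<^sup>+z. \<integral>\<^sup>+t. indicator \<Omega> z * (ennreal (cmod (rep_L2 g (t - fst z))))\<^sup>2 \<partial>lborel \<partial>lborel)"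
  proof (rule lborel_pair.Fubini')
    have [measurable]: "\<Omega> \<in> sets (borel \<Otimes>\<^sub>M borel)"
      unfolding borel_prod by (rule \<Omega>)
    show "(\<lambda>(z, t). indicator \<Omega> z * (ennreal (cmod (rep_L2 g (t - fst z))))\<^sup>2)
        \<in> borel_measurable ((lborel :: ('a \<times> 'a) measure) \<Otimes>\<^sub>M (lborel :: 'a measure))"
      unfolding lborel_prod[symmetric, where 'a='a and 'b='a] by measurable
  qed
  have "(\<integral>\<^sup>+t. (ennreal (cmod (conc_fun g \<Omega> f t)))\<^sup>2 \<partial>lborel)
      \<le> (\<integral>\<^sup>+t. (ennreal M)\<^sup>2 * emeasure lborel \<Omega> *
          (\<integral>\<^sup>+z. indicator \<Omega> z * (ennreal (cmod (rep_L2 g (t - fst z))))\<^sup>2 \<partial>lborel) \<partial>lborel)"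
    by (intro nn_integral_mono pt)
  also have "\<dots> = (ennreal M)\<^sup>2 * emeasure lborel \<Omega> *
      (\<integral>\<^sup>+t. \<integral>\<^sup>+z. indicator \<Omega> z * (ennreal (cmod (rep_L2 g (t - fst z))))\<^sup>2 \<partial>lborel \<partial>lborel)"
  proof (rule nn_integral_cmult)
    have [measurable]: "\<Omega> \<in> sets (borel \<Otimes>\<^sub>M borel)"
      unfolding borel_prod by (rule \<Omega>)
    have "(\<lambda>t. \<integral>\<^sup>+z. indicator \<Omega> z * (ennreal (cmod (rep_L2 g (t - fst z))))\<^sup>2 \<partial>lborel)
        \<in> borel_measurable (borel :: 'a measure)"
      by (rule lborel.borel_measurable_nn_integral)
        (unfold lborel_prod[symmetric, where 'a='a and 'b='a], measurable)
    then show "(\<lambda>t. \<integral>\<^sup>+z. indicator \<Omega> z * (ennreal (cmod (rep_L2 g (t - fst z))))\<^sup>2 \<partial>lborel)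
        \<in> borel_measurable (lborel :: 'a measure)" by simp
  qed
  also have "\<dots> = (ennreal M)\<^sup>2 * emeasure lborel \<Omega> * (G * emeasure lborel \<Omega>)"
  proof -
    have "(\<integral>\<^sup>+t. indicator \<Omega> z * (ennreal (cmod (rep_L2 g (t - fst z))))\<^sup>2 \<partial>lborel)
        = G * indicator \<Omega> z" for z
      unfolding G_def
      by (subst nn_integral_cmult, measurable)
        (subst nn_integral_lborel_shift[of "\<lambda>t. (ennreal (cmod (rep_L2 g t)))\<^sup>2"], auto simp: mult.commute)
    then show ?thesis
      unfolding swap by (simp only: nn_integral_cmult_indicator[of \<Omega> lborel] sets_lborel \<Omega>)
  qed
  also have "\<dots> < \<infinity>"
    using fin rep_L2_nn_integral_finite[of g]
    by (auto simp: G_def ennreal_mult_less_top power2_eq_square)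
  finally have "(\<integral>\<^sup>+t. (ennreal (cmod (conc_fun g \<Omega> f t)))\<^sup>2 \<partial>lborel) < \<infinity>" .
  then show ?thesis
    by (auto simp: square_integrable_def integrable_iff_bounded ennreal_power)
qed

section \<open>Hausdorff measure and boundary regularity\<close>

(* The factor unit_ball_vol m * (diameter / 2)^m is the usual normalisation, under which
   m-dimensional Hausdorff measure is Lebesgue measure on an m-dimensional subspace.
   The diameter of an unbounded set is unspecified in the library, hence the explicit
   boundedness. Covering sets may be empty (they contribute 0 for m > 0). *)
definition hausdorff_content :: "nat \<Rightarrow> real \<Rightarrow> 'a::metric_space set \<Rightarrow> ennreal" where
  "hausdorff_content m \<delta> A =
     (INF U\<in>{U :: nat \<Rightarrow> 'a set. A \<subseteq> (\<Union>i. U i) \<and> (\<forall>i. bounded (U i) \<and> diameter (U i) \<le> \<delta>)}.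
        \<Sum>i. if U i = {} then 0 else ennreal (unit_ball_vol (real m) * (diameter (U i) / 2) ^ m))"

definition hausdorff :: "nat \<Rightarrow> 'a::metric_space set \<Rightarrow> ennreal" where
  "hausdorff m A = (SUP \<delta>\<in>{0<..}. hausdorff_content m \<delta> A)"

(* In both notions the ambient space has dimension DIM('a), so the boundary
   has dimension DIM('a) - 1 *)
definition regular_boundary :: "'a::euclidean_space set \<Rightarrow> real \<Rightarrow> bool" where
  "regular_boundary \<Omega> \<eta> \<longleftrightarrow>
     (\<exists>\<kappa>>0. \<forall>r z. 0 < r \<and> r \<le> \<eta> \<and> z \<in> frontier \<Omega> \<longrightarrow>
        ennreal (\<kappa> * r ^ (DIM('a) - 1)) \<le> hausdorff (DIM('a) - 1) (frontier \<Omega> \<inter> ball z r))"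

definition boundary_const :: "'a::euclidean_space set \<Rightarrow> real \<Rightarrow> real" where
  "boundary_const \<Omega> \<eta> =
     enn2real (INF r\<in>{0<..\<eta>}. INF z\<in>frontier \<Omega>.
        hausdorff (DIM('a) - 1) (frontier \<Omega> \<inter> ball z r) / ennreal (r ^ (DIM('a) - 1)))"

end

theory Submission
  imports Defs "HOL-Probability.Characteristic_Functions"
begin

text \<open>
  Write \<open>k z\<close> for the time-frequency shift of \<open>g\<close> by \<open>z\<close>, so that \<open>V_g f(z) = \<langle>f, k z\<rangle>\<close>; by Moyal's
  identity the \<open>k z\<close> form a continuous Parseval frame and the trace of a positive operator \<open>T\<close> is the
  integral of \<open>\<langle>T (k z), k z\<rangle>\<close>. For \<open>T = L - L\<^sup>2\<close> the integrand is at most \<open>a (1 - a)\<close> with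
  \<open>a(z) = \<langle>L (k z), k z\<rangle>\<close>, hence at most the mass that \<open>|V_g g|\<^sup>2\<close> transports from \<open>z\<close> across the
  boundary of \<open>\<Omega>\<close>. Concavity of \<open>t \<mapsto> min t \<delta>\<close> bounds the sum of \<open>min (\<lambda> (1 - \<lambda>)) \<delta>\<close> over the
  eigenvalues by \<open>\<delta> |G|\<close> plus the integral of \<open>a (1 - a)\<close> outside \<open>G\<close>, where \<open>G\<close> is the
  \<open>R\<close>-neighbourhood of the boundary. Regularity gives \<open>|G| = O(R\<^sup>2\<^sup>d)\<close>, the moment condition gives
  \<open>O(R\<^sup>1\<^sup>-\<^sup>s)\<close> for the rest, and optimizing \<open>R\<close> yields the rate even without the logarithmic factor.
  No spectral theorem is needed: greedily chosen near-maximizers of \<open>\<langle>L f, f\<rangle>\<close> are approximate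
  eigenvectors, and their Rayleigh quotients approach the approximation numbers of \<open>L\<close>.
\<close>

section \<open>Inner products in the complex space of square-integrable functions\<close>

text \<open>Phase space has infinite measure, so an error of uniform size would integrate to
  infinity. Hence the approximate eigenvectors are kept exactly orthonormal, their number stays
  fixed while the precision tends to 0, and every error enters as the square of a coefficient
  against a short vector, which Parseval turns into a small norm.

  A bound for the number of intermediate eigenvalues does not tell where they sit. Their position
  comes from the trace: what the first \<open>n\<close> eigenvectors miss of |\<Omega>| also counts
  as leakage, with weight \<open>1 - eig n\<close>, so the passage through 1/2 happens within 2 B of
  |\<Omega>|, where B is the boundary term. The factor 4 in \<gamma> then leaves 2 B h further
  indices for counting.

  The cap \<delta> is half of the very eigenvalue being estimated, or of its distance to 1, and R
  varies with it: R balances \<delta> R^(2d), divided by the local boundary area, against C_g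
  R^(1-s). The count is then of order \<delta>^(-q) with q = 2d / (2d + s - 1), whence the exponent
  -1/q of h. The volume estimate needs R \<ge> \<eta>; for R < 1 the neighbourhood is replaced by
  the empty set.\<close>

abbreviation ip :: "'a::euclidean_space L2 \<Rightarrow> 'a L2 \<Rightarrow> complex" where "ip \<equiv> cinner_L2"

abbreviation sqmod :: "complex \<Rightarrow> real" where "sqmod c \<equiv> (cmod c)\<^sup>2"

lemma ip_rep: "ip f g = (LINT x|lborel. rep_L2 f x * cnj (rep_L2 g x))"
  by (simp add: cinner_L2_def)

lemma ip_add_left: "ip (f + g) h = ip f h + ip g h"
  by transfer (auto simp: ae_equal_def ring_distribs square_integrable_mult square_integrable_cnj)

lemma ip_scale_left [simp]: "ip (scaleL2 c f) h = c * ip f h"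
  by transfer (auto simp: ae_equal_def mult.assoc)

lemma ip_commute: "ip f g = cnj (ip g f)"
proof transfer
  fix f g :: "'a \<Rightarrow> complex"
  have "(LINT x|lborel. f x * cnj (g x)) = (LINT x|lborel. cnj (g x * cnj (f x)))"
    by (simp add: mult.commute)
  also have "\<dots> = cnj (LINT x|lborel. g x * cnj (f x))"
    by (rule Bochner_Integration.integral_cnj)
  finally show "(LINT x|lborel. f x * cnj (g x)) = cnj (LINT x|lborel. g x * cnj (f x))" .
qed

lemma ip_add_right: "ip h (f + g) = ip h f + ip h g"
  using ip_add_left[of f g h] by (metis complex_cnj_add ip_commute)

lemma ip_scale_right [simp]: "ip h (scaleL2 c f) = cnj c * ip h f"
  by (metis complex_cnj_mult ip_commute ip_scale_left)

lemma ip_minus_left [simp]: "ip (- f) h = - ip f h"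
  using ip_scale_left[of "- 1" f h] by simp

lemma ip_diff_left: "ip (f - g) h = ip f h - ip g h"
  using ip_add_left[of f "- g" h] by simp

lemma ip_minus_right [simp]: "ip h (- f) = - ip h f"
  using ip_scale_right[of h "- 1" f] by simp

lemma ip_diff_right: "ip h (f - g) = ip h f - ip h g"
  using ip_add_right[of h f "- g"] by simp

lemma ip_zero_left [simp]: "ip 0 h = 0"
  using ip_add_left[of 0 0 h] by simp

lemma ip_zero_right [simp]: "ip h 0 = 0"
  using ip_add_right[of h 0 0] by simp

lemma ip_sum_left: "ip (sum F I) h = (\<Sum>i\<in>I. ip (F i) h)"
  by (induction I rule: infinite_finite_induct) (auto simp: ip_add_left)

lemma ip_sum_right: "ip h (sum F I) = (\<Sum>i\<in>I. ip h (F i))"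
  by (induction I rule: infinite_finite_induct) (auto simp: ip_add_right)

lemma Re_ip_self: "Re (ip f f) = (norm f)\<^sup>2"
  by (simp add: power2_norm_eq_inner inner_L2_def)

lemma ip_self: "ip f f = complex_of_real ((norm f)\<^sup>2)"
proof -
  have "Im (ip f f) = 0"
    using arg_cong[OF ip_commute[of f f], of Im] by simp
  then show ?thesis by (simp add: complex_eq_iff Re_ip_self)
qed

lemma norm_scaleL2 [simp]: "norm (scaleL2 c f) = cmod c * norm f"
proof -
  have "complex_of_real ((norm (scaleL2 c f))\<^sup>2) = complex_of_real ((cmod c * norm f)\<^sup>2)"
  proof -
    have "ip (scaleL2 c f) (scaleL2 c f) = (c * cnj c) * ip f f" by (simp add: mult.assoc)
    then show ?thesis unfolding ip_self by (simp add: power_mult_distrib flip: complex_norm_square)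
  qed
  then have "(norm (scaleL2 c f))\<^sup>2 = (cmod c * norm f)\<^sup>2"
    by (simp only: of_real_eq_iff)
  then show ?thesis
    by (simp add: power2_eq_iff_nonneg)
qed

text \<open>The real inner product sees only \<open>Re (ip f g)\<close>. Multiplying
  \<open>f\<close> by a unimodular \<open>c\<close> makes the complex one real and nonnegative, so
  the real Cauchy-Schwarz inequality loses nothing.\<close>

lemma ip_cauchy_schwarz: "cmod (ip f g) \<le> norm f * norm g"
proof (cases "ip f g = 0")
  case False
  define c where "c = cnj (ip f g) / cmod (ip f g)"
  have "cmod c = 1" using False by (simp add: c_def norm_divide)
  have "c * ip f g = complex_of_real (cmod (ip f g))"
    using False by (simp add: c_def mult.commute[of "cnj _"] complex_norm_square[symmetric] power2_eq_square)
  then have "cmod (ip f g) = inner (scaleL2 c f) g"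
    by (simp add: inner_L2_def)
  also have "\<dots> \<le> norm (scaleL2 c f) * norm g" by (rule norm_cauchy_schwarz)
  finally show ?thesis using \<open>cmod c = 1\<close> by simp
qed simp

lemma ip_eqI:
  assumes "\<And>h. ip f h = ip g h"
  shows "f = g"
proof -
  have "ip (f - g) (f - g) = 0" using assms by (simp add: ip_diff_left)
  then show ?thesis by (simp add: ip_self)
qed

lemma scaleL2_of_real: "scaleL2 (complex_of_real r) f = r *\<^sub>R f"
  by (simp add: scaleR_L2_def)

lemma norm_add_sq: "(norm (f + g))\<^sup>2 = (norm f)\<^sup>2 + 2 * Re (ip f g) + (norm g)\<^sup>2" for f g :: "'a::euclidean_space L2"
proof -
  have "Re (ip g f) = Re (ip f g)" by (subst ip_commute) simp
  then show ?thesis by (simp flip: Re_ip_self add: ip_add_left ip_add_right)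
qed

section \<open>Orthonormal systems\<close>

text \<open>Systems are total functions of which only the first \<open>n\<close> values matter, so
  prefixes and extensions \<open>F(n := f)\<close> need no conversion.\<close>

definition orthonormal :: "nat \<Rightarrow> (nat \<Rightarrow> 'a::euclidean_space L2) \<Rightarrow> bool" where
  "orthonormal n F \<longleftrightarrow> (\<forall>i<n. \<forall>j<n. ip (F i) (F j) = of_bool (i = j))"

definition compl_proj :: "nat \<Rightarrow> (nat \<Rightarrow> 'a::euclidean_space L2) \<Rightarrow> 'a L2 \<Rightarrow> 'a L2" where
  "compl_proj n F h = h - (\<Sum>j<n. scaleL2 (ip h (F j)) (F j))"

lemma orthonormal_norm: "orthonormal n F \<Longrightarrow> j < n \<Longrightarrow> norm (F j) = 1"
proof -
  assume "orthonormal n F" "j < n"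
  then have "(norm (F j))\<^sup>2 = 1" unfolding Re_ip_self[symmetric] by (simp add: orthonormal_def)
  then show ?thesis using norm_ge_zero[of "F j"] by (auto simp: power2_eq_1_iff simp del: norm_ge_zero)
qed

lemma ip_lincomb:
  assumes "orthonormal n F" "j < n"
  shows "ip (\<Sum>i<n. scaleL2 (c i) (F i)) (F j) = c j"
proof -
  have "ip (\<Sum>i<n. scaleL2 (c i) (F i)) (F j) = (\<Sum>i<n. if i = j then c i else 0)"
    using assms by (auto simp: ip_sum_left orthonormal_def intro!: sum.cong)
  then show ?thesis using assms by simp
qed

lemma norm_lincomb:
  assumes "orthonormal n F"
  shows "(norm (\<Sum>i<n. scaleL2 (c i) (F i)))\<^sup>2 = (\<Sum>i<n. sqmod (c i))"
proof -
  have "ip (\<Sum>i<n. scaleL2 (c i) (F i)) (\<Sum>i<n. scaleL2 (c i) (F i)) = (\<Sum>j<n. cnj (c j) * c j)"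
    using assms by (subst ip_sum_right) (auto intro!: sum.cong simp: ip_lincomb)
  then have "complex_of_real ((norm (\<Sum>i<n. scaleL2 (c i) (F i)))\<^sup>2) = complex_of_real (\<Sum>i<n. sqmod (c i))"
    unfolding ip_self by (simp add: complex_norm_square mult.commute flip: of_real_power)
  then show ?thesis by (simp only: of_real_eq_iff)
qed

lemma compl_proj_orth:
  assumes "orthonormal n F" "j < n"
  shows "ip (compl_proj n F h) (F j) = 0" "ip (F j) (compl_proj n F h) = 0"
proof -
  show "ip (compl_proj n F h) (F j) = 0"
    using ip_lincomb[OF assms, of "\<lambda>j. ip h (F j)"] by (simp add: compl_proj_def ip_diff_left)
  then show "ip (F j) (compl_proj n F h) = 0" by (subst ip_commute) simp
qed

lemma compl_proj_decomp: "h = (\<Sum>j<n. scaleL2 (ip h (F j)) (F j)) + compl_proj n F h"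
  by (simp add: compl_proj_def)

lemma ip_compl_proj_orth:
  assumes "\<And>j. j < n \<Longrightarrow> ip y (F j) = 0"
  shows "ip y (compl_proj n F h) = ip y h" "ip (compl_proj n F h) y = ip h y"
proof -
  show "ip y (compl_proj n F h) = ip y h"
    using assms by (simp add: compl_proj_def ip_diff_right ip_sum_right)
  then show "ip (compl_proj n F h) y = ip h y"
    by (metis ip_commute)
qed

lemma compl_proj_sym:
  assumes "orthonormal n F"
  shows "ip (compl_proj n F h) y = ip h (compl_proj n F y)"
  using ip_compl_proj_orth(1)[of n "compl_proj n F h" F y] ip_compl_proj_orth(2)[of n "compl_proj n F y" F h]
    compl_proj_orth(1)[OF assms] by metis

lemma norm_compl_proj:
  assumes "orthonormal n F"
  shows "(norm h)\<^sup>2 = (\<Sum>j<n. sqmod (ip h (F j))) + (norm (compl_proj n F h))\<^sup>2"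
proof -
  let ?P = "\<Sum>j<n. scaleL2 (ip h (F j)) (F j)"
  have "ip ?P (compl_proj n F h) = 0"
    using assms by (simp add: ip_sum_left compl_proj_orth)
  then have "(norm (?P + compl_proj n F h))\<^sup>2 = (norm ?P)\<^sup>2 + (norm (compl_proj n F h))\<^sup>2"
    by (simp add: norm_add_sq)
  then show ?thesis
    by (simp flip: compl_proj_decomp add: norm_lincomb[OF assms])
qed

lemma norm_compl_proj_le: "orthonormal n F \<Longrightarrow> norm (compl_proj n F h) \<le> norm h"
  using norm_compl_proj[of n F h] 
  by (metis le_add_same_cancel2 norm_ge_zero power2_le_imp_le sum_nonneg zero_le_power2)

section \<open>Approximate eigensystems of positive contractions\<close>

abbreviation rayleigh :: "('a::euclidean_space L2 \<Rightarrow> 'a L2) \<Rightarrow> 'a L2 \<Rightarrow> real" where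
  "rayleigh L f \<equiv> Re (ip (L f) f)"

text \<open>Linearity and boundedness are derived: an everywhere defined symmetric map is linear
  because identities can be tested against every vector (\<open>ip_eqI\<close>), and
  \<open>norm_le\<close> follows from the two bounds on the form.\<close>

locale positive_contraction =
  fixes L :: "'a::euclidean_space L2 \<Rightarrow> 'a L2"
  assumes sym: "ip (L f) h = ip f (L h)"
    and nonneg: "0 \<le> rayleigh L f"
    and le: "rayleigh L f \<le> (norm f)\<^sup>2"
begin

lemma add: "L (f + h) = L f + L h"
  by (rule ip_eqI) (simp add: sym ip_add_left)

lemma scale: "L (scaleL2 c f) = scaleL2 c (L f)"
  by (rule ip_eqI) (simp add: sym)

lemma diff: "L (f - h) = L f - L h"
  by (rule ip_eqI) (simp add: sym ip_diff_left)

lemma scaleR: "L (r *\<^sub>R f) = r *\<^sub>R L f"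
  by (simp add: scale scaleR_L2_def)

lemma sum: "L (sum F I) = (\<Sum>i\<in>I. L (F i))"
  by (rule ip_eqI) (simp add: sym ip_sum_left)

text \<open>The Cauchy-Schwarz inequality of the positive form \<open>ip (L f) h\<close>, obtained
  from \<open>nonneg\<close> at \<open>f - t *\<^sub>R y\<close>, where \<open>y\<close> is the
  compressed image of \<open>f\<close>. In operator terms, a positive compression T bounded by \<mu>
  satisfies \<open>T\<^sup>2 \<le> \<mu> T\<close>; for \<open>n = 0\<close> and \<mu> = 1 this is
  \<open>norm_sq_le\<close>.\<close>

lemma compression_bound:
  assumes "orthonormal n F" and f: "\<And>j. j < n \<Longrightarrow> ip f (F j) = 0"
    and \<mu>: "0 \<le> \<mu>" "\<And>h. (\<And>j. j < n \<Longrightarrow> ip h (F j) = 0) \<Longrightarrow> rayleigh L h \<le> \<mu> * (norm h)\<^sup>2"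
  shows "(norm (compl_proj n F (L f)))\<^sup>2 \<le> \<mu> * rayleigh L f"
proof -
  define y where "y = compl_proj n F (L f)"
  have y: "ip y (F j) = 0" if "j < n" for j
    using compl_proj_orth(1)[OF assms(1) that] by (simp add: y_def)
  have fy: "ip (L f) y = (norm y)\<^sup>2" "ip (L y) f = (norm y)\<^sup>2"
  proof -
    show "ip (L y) f = (norm y)\<^sup>2"
      using ip_compl_proj_orth(1)[of n y F "L f"] y by (simp add: sym y_def[symmetric] ip_self)
    then show "ip (L f) y = (norm y)\<^sup>2"
      by (subst ip_commute) (simp flip: sym)
  qed
  have key: "2 * t * (norm y)\<^sup>2 \<le> rayleigh L f + t\<^sup>2 * (\<mu> * (norm y)\<^sup>2)" for t :: real
  proof -
    have "0 \<le> rayleigh L (f - t *\<^sub>R y)" by (rule nonneg)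
    also have "\<dots> = rayleigh L f - 2 * t * (norm y)\<^sup>2 + t\<^sup>2 * rayleigh L y"
      unfolding diff scaleR_L2_def scale ip_diff_left ip_diff_right ip_scale_left ip_scale_right
      by (simp add: fy power2_eq_square algebra_simps)
    also have "rayleigh L y \<le> \<mu> * (norm y)\<^sup>2" using \<mu>(2) y by blast
    finally show ?thesis by (simp add: mult_left_mono)
  qed
  show ?thesis
  \<comment> \<open>The optimal parameter is \<open>t = 1 / \<mu>\<close>; for \<mu> = 0 a large
    \<open>t\<close> forces \<open>y = 0\<close>.\<close>
  proof (cases "\<mu> = 0")
    case True
    have "(norm y)\<^sup>2 = 0"
    proof (rule ccontr)
      assume "\<not> ?thesis"
      then show False
        using key[of "(rayleigh L f + 1) / (2 * (norm y)\<^sup>2)"] True by simp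
    qed
    then show ?thesis using True by (simp add: y_def)
  next
    case False
    then have "\<mu> > 0" using \<mu>(1) by simp
    then have "(norm y)\<^sup>2 / \<mu> \<le> rayleigh L f"
      using key[of "1 / \<mu>"] by (simp add: power2_eq_square field_simps)
    then show ?thesis using \<open>\<mu> > 0\<close> by (simp add: y_def field_simps)
  qed
qed

lemma norm_sq_le: "(norm (L f))\<^sup>2 \<le> rayleigh L f"
  using compression_bound[of 0 undefined f 1] le by (simp add: orthonormal_def compl_proj_def)

lemma norm_le: "norm (L f) \<le> norm f"
  using order_trans[OF norm_sq_le le] by (rule power2_le_imp_le) simp

lemma bounded_linear: "bounded_linear L"
  by (rule bounded_linear_intro[where K = 1]) (auto simp: add scaleR norm_le)

text \<open>Orthonormality is exact, only the eigenvalue equation is approximate. The bound on the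
  complement of the earlier vectors lets \<open>\<mu> j\<close> play the part of the eigenvalue in
  the min-max principle.\<close>

definition approx_eigen :: "nat \<Rightarrow> real \<Rightarrow> (nat \<Rightarrow> 'a L2) \<Rightarrow> (nat \<Rightarrow> real) \<Rightarrow> bool" where
  "approx_eigen n \<epsilon> F \<mu> \<longleftrightarrow> orthonormal n F \<and>
     (\<forall>j<n. norm (L (F j) - \<mu> j *\<^sub>R F j) \<le> \<epsilon> \<and> 0 \<le> \<mu> j \<and> \<mu> j \<le> 1 \<and>
        (\<forall>h. (\<forall>i<j. ip h (F i) = 0) \<longrightarrow> rayleigh L h \<le> \<mu> j * (norm h)\<^sup>2)) \<and>
     (\<forall>i j. i \<le> j \<longrightarrow> j < n \<longrightarrow> \<mu> j \<le> \<mu> i)"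

text \<open>Here \<open>m\<close> is the supremum of the Rayleigh quotients orthogonal to
  \<open>F\<close>; it need not be attained, so \<open>f\<close> only nearly attains it. A
  near-maximizer is nearly an eigenvector of the compression, and \<open>L f\<close> leaks at most
  \<epsilon> into each \<open>F j\<close> because \<open>F j\<close> is nearly an eigenvector
  itself. The last conclusion, minimality of \<open>m\<close>, later gives the monotonicity of the
  values.\<close>

lemma ex_next_eigen:
  assumes F: "orthonormal n F" and e: "\<And>j. j < n \<Longrightarrow> norm (L (F j) - \<mu> j *\<^sub>R F j) \<le> \<epsilon>"
    and ex: "h0 \<noteq> 0" "\<And>j. j < n \<Longrightarrow> ip h0 (F j) = 0" and "\<delta> > 0"
  shows "\<exists>f m. norm f = 1 \<and> (\<forall>j<n. ip f (F j) = 0) \<and> 0 \<le> m \<and> m \<le> 1 \<and>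
    norm (L f - m *\<^sub>R f) \<le> \<delta> + n * \<epsilon> \<and>
    (\<forall>h. (\<forall>j<n. ip h (F j) = 0) \<longrightarrow> rayleigh L h \<le> m * (norm h)\<^sup>2) \<and>
    (\<forall>b. (\<forall>h. norm h = 1 \<longrightarrow> (\<forall>j<n. ip h (F j) = 0) \<longrightarrow> rayleigh L h \<le> b) \<longrightarrow> m \<le> b)"
proof -
  define A where "A = {h. norm h = 1 \<and> (\<forall>j<n. ip h (F j) = 0)}"
  define m where "m = (SUP h\<in>A. rayleigh L h)"
  have bdd: "bdd_above ((\<lambda>h. rayleigh L h) ` A)"
  proof (rule bdd_aboveI2)
    show "rayleigh L h \<le> 1" if "h \<in> A" for h using le[of h] that by (simp add: A_def)
  qed
  have "(1 / norm h0) *\<^sub>R h0 \<in> A"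
    using ex by (auto simp: A_def scaleR_L2_def norm_divide)
  then have ne: "A \<noteq> {}" by auto
  \<comment> \<open>The tolerance is the square of \<delta> because the residual below satisfies
    \<open>(norm q)\<^sup>2 \<le> m * (m - rayleigh L f)\<close>.\<close>
  obtain f where f: "f \<in> A" "m - \<delta>\<^sup>2 < rayleigh L f"
    using less_cSUP_iff[OF ne bdd, of "m - \<delta>\<^sup>2"] \<open>\<delta> > 0\<close> by (auto simp: m_def)
  have up: "rayleigh L h \<le> m * (norm h)\<^sup>2" if "\<forall>j<n. ip h (F j) = 0" for h
  proof (cases "h = 0")
    case False
    have "(1 / norm h) *\<^sub>R h \<in> A"
      using that False by (auto simp: A_def scaleR_L2_def norm_divide)
    then have "rayleigh L ((1 / norm h) *\<^sub>R h) \<le> m"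
      unfolding m_def by (intro cSUP_upper bdd)
    then show ?thesis using False
      by (simp add: scaleR_L2_def scale field_simps power2_eq_square)
  qed (use add[of 0 0] in auto)
  have "0 \<le> m" using order_trans[OF nonneg cSUP_upper[OF f(1) bdd]] by (simp add: m_def)
  moreover have "m \<le> 1"
    unfolding m_def
  proof (rule cSUP_least[OF ne])
    show "rayleigh L h \<le> 1" if "h \<in> A" for h using le[of h] that by (simp add: A_def)
  qed
  ultimately have m: "0 \<le> m" "m \<le> 1" .
  have nf: "norm f = 1" and fo: "\<And>j. j < n \<Longrightarrow> ip f (F j) = 0" using f(1) by (auto simp: A_def)
  define q where "q = compl_proj n F (L f) - m *\<^sub>R f"
  have "(norm q)\<^sup>2 \<le> \<delta>\<^sup>2"
  proof -
    have 1: "(norm (compl_proj n F (L f)))\<^sup>2 \<le> m * rayleigh L f"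
      by (rule compression_bound[OF F fo m(1)]) (use up in auto)
    have "ip (compl_proj n F (L f)) f = ip (L f) f"
      using ip_compl_proj_orth(2)[of n f F] fo by simp
    then have "(norm q)\<^sup>2 = (norm (compl_proj n F (L f)))\<^sup>2 - 2 * m * rayleigh L f + m\<^sup>2"
      using norm_add_sq[of "compl_proj n F (L f)" "- (m *\<^sub>R f)"] nf
      by (simp add: q_def scaleR_L2_def norm_minus_cancel)
    also have "\<dots> \<le> m * (m - rayleigh L f)" using 1 by (simp add: power2_eq_square algebra_simps)
    also have "\<dots> \<le> 1 * \<delta>\<^sup>2" using f(2) up[of f] fo nf m by (intro mult_mono) auto
    finally show ?thesis by simp
  qed
  then have q: "norm q \<le> \<delta>" using \<open>\<delta> > 0\<close> by (simp add: power2_le_iff_abs_le)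
  have "L f - m *\<^sub>R f = q + (\<Sum>j<n. scaleL2 (ip (L f) (F j)) (F j))"
    by (simp add: q_def compl_proj_def)
  also have "norm \<dots> \<le> \<delta> + (\<Sum>j<n. \<epsilon>)"
  proof (intro order_trans[OF norm_triangle_ineq] add_mono q order_trans[OF norm_sum] sum_mono)
    fix j assume "j \<in> {..<n}"
    then have j: "j < n" by simp
    have "ip (L f) (F j) = ip f (L (F j) - \<mu> j *\<^sub>R F j)"
      using fo[OF j] by (simp add: sym ip_diff_right scaleR_L2_def)
    then have "cmod (ip (L f) (F j)) \<le> \<epsilon>"
      using ip_cauchy_schwarz[of f "L (F j) - \<mu> j *\<^sub>R F j"] e[OF j] nf by simp
    then show "norm (scaleL2 (ip (L f) (F j)) (F j)) \<le> \<epsilon>"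
      using orthonormal_norm[OF F j] by simp
  qed
  finally have "norm (L f - m *\<^sub>R f) \<le> \<delta> + n * \<epsilon>" by simp
  moreover have "m \<le> b"
    if "\<forall>h. norm h = 1 \<longrightarrow> (\<forall>j<n. ip h (F j) = 0) \<longrightarrow> rayleigh L h \<le> b" for b
    unfolding m_def using that by (intro cSUP_least ne) (auto simp: A_def)
  ultimately show ?thesis using nf fo m up by blast
qed

lemma ex_approx_eigen:
  assumes inf: "\<And>n (F :: nat \<Rightarrow> 'a L2). orthonormal n F \<Longrightarrow> \<exists>h\<noteq>0. \<forall>j<n. ip h (F j) = 0"
  shows "\<epsilon> > 0 \<Longrightarrow> \<exists>F \<mu>. approx_eigen n \<epsilon> F \<mu>"
proof (induction n arbitrary: \<epsilon>)
  case 0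
  then show ?case by (auto simp: approx_eigen_def orthonormal_def)
next
  case (Suc n)
  \<comment> \<open>The new vector inherits an error from each of the \<open>n\<close> earlier ones;
    this precision keeps \<open>n * \<epsilon>'\<close> below one half of \<epsilon>.\<close>
  define \<epsilon>' where "\<epsilon>' = \<epsilon> / (2 * (n + 1))"
  have \<epsilon>': "0 < \<epsilon>'" "\<epsilon>' \<le> \<epsilon>" "\<epsilon> / 2 + n * \<epsilon>' \<le> \<epsilon>"
    using Suc.prems by (auto simp: \<epsilon>'_def field_simps)
  obtain F \<mu> where ae: "approx_eigen n \<epsilon>' F \<mu>" using Suc.IH[OF \<epsilon>'(1)] by blast
  have F: "orthonormal n F" and e: "\<And>j. j < n \<Longrightarrow> norm (L (F j) - \<mu> j *\<^sub>R F j) \<le> \<epsilon>'"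
    using ae by (auto simp: approx_eigen_def)
  obtain h0 where "h0 \<noteq> 0" "\<And>j. j < n \<Longrightarrow> ip h0 (F j) = 0" using inf[OF F] by blast
  from ex_next_eigen[OF F e this, of "\<epsilon> / 2"] Suc.prems
  obtain f m where f: "norm f = 1" "\<And>j. j < n \<Longrightarrow> ip f (F j) = 0" and m: "0 \<le> m" "m \<le> 1"
    and ef: "norm (L f - m *\<^sub>R f) \<le> \<epsilon> / 2 + n * \<epsilon>'"
    and up: "\<And>h. (\<forall>j<n. ip h (F j) = 0) \<Longrightarrow> rayleigh L h \<le> m * (norm h)\<^sup>2"
    and least: "\<And>b. (\<forall>h. norm h = 1 \<longrightarrow> (\<forall>j<n. ip h (F j) = 0) \<longrightarrow> rayleigh L h \<le> b) \<Longrightarrow> m \<le> b"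
    by auto
  have "m \<le> \<mu> i" if "i < n" for i
  proof (rule least, intro allI impI)
    fix h assume "norm h = 1" "\<forall>j<n. ip h (F j) = 0"
    then show "rayleigh L h \<le> \<mu> i"
      using ae that unfolding approx_eigen_def by (metis (no_types, lifting) less_trans mult_1_right one_power2)
  qed
  moreover have "orthonormal (Suc n) (F(n := f))"
    using F f by (auto simp: orthonormal_def less_Suc_eq ip_self) (metis complex_cnj_zero ip_commute)+
  ultimately have "approx_eigen (Suc n) \<epsilon> (F(n := f)) (\<mu>(n := m))"
    using ae m ef up \<epsilon>' unfolding approx_eigen_def less_Suc_eq by (auto; fastforce)
  then show ?case by blast
qed

text \<open>The competitor \<open>S\<close> is the truncated diagonal operator with values
  \<open>\<mu> i\<close>. On the first \<open>j\<close> directions \<open>L - S\<close> errs by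
  \<epsilon> each; on their complement \<open>L\<close> is bounded by \<open>\<mu> j\<close> up to
  leakage back into these directions, again \<epsilon> each. This explains the 2 n
  \<epsilon>.\<close>

lemma approx_number_le:
  assumes "approx_eigen n \<epsilon> F \<mu>" "j < n"
  shows "\<exists>S. bounded_operator S \<and> rank_less S (Suc j) \<and> onorm (\<lambda>f. L f - S f) \<le> \<mu> j + 2 * real n * \<epsilon>"
proof -
  have on: "orthonormal n F" using assms by (simp add: approx_eigen_def)
  then have onj: "orthonormal j F" using assms(2) by (auto simp: orthonormal_def)
  have e: "norm (L (F i) - \<mu> i *\<^sub>R F i) \<le> \<epsilon>" if "i < n" for i
    using assms(1) that by (simp add: approx_eigen_def)
  have "\<epsilon> \<ge> 0" using order_trans[OF norm_ge_zero e[OF assms(2)]] .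
  have m: "0 \<le> \<mu> j" and up: "\<And>h. (\<And>i. i < j \<Longrightarrow> ip h (F i) = 0) \<Longrightarrow> rayleigh L h \<le> \<mu> j * (norm h)\<^sup>2"
    using assms by (auto simp: approx_eigen_def)
  note add_L = add and scale_L = scale
  define S where "S f = (\<Sum>i<j. scaleL2 (\<mu> i * ip f (F i)) (F i))" for f
  have add: "S (f + h) = S f + S h" for f h
    by (simp add: S_def ip_add_left distrib_left L2.scale_left_distrib sum.distrib)
  have scale: "S (scaleL2 c f) = scaleL2 c (S f)" for c f
    by (simp add: S_def L2.scale_sum_right mult_ac)
  have S_norm: "norm (S f) \<le> norm f * (\<Sum>i<j. \<bar>\<mu> i\<bar>)" for f
    unfolding S_def sum_distrib_left
  proof (rule sum_norm_le)
    fix i assume "i \<in> {..<j}"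
    then have "norm (F i) = 1" using orthonormal_norm[OF onj] by simp
    then show "norm (scaleL2 (\<mu> i * ip f (F i)) (F i)) \<le> norm f * \<bar>\<mu> i\<bar>"
      using ip_cauchy_schwarz[of f "F i"] by (simp add: norm_mult mult.commute[of "norm f"] mult_left_mono)
  qed
  have bl: "bounded_linear S"
    by (rule bounded_linear_intro[OF _ _ S_norm]) (auto simp: add scale scaleR_L2_def)
  have "bounded_operator S" by (simp add: bounded_operator_def bl scale)
  moreover have "rank_less S (Suc j)"
  proof -
    \<comment> \<open>\<open>rank_less\<close> asks for a basis of exactly the range, while the
      vectors \<open>F i\<close> may span more when some \<open>\<mu> i\<close> vanishes.\<close>
    obtain B where B: "B \<subseteq> range S" "L2.independent B" "range S \<subseteq> L2.span B"
      using L2.maximal_independent_subset[of "range S"] by blast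
    have "range S \<subseteq> L2.span (F ` {..<j})"
      unfolding S_def by (rule image_subsetI) (intro L2.span_sum L2.span_scale L2.span_base imageI)
    with B have "finite B \<and> card B \<le> card (F ` {..<j})"
      by (intro L2.independent_span_bound) auto
    moreover have "L2.span B \<subseteq> range S"
    proof (rule L2.span_minimal[OF B(1)])
      show "L2.subspace (range S)"
        unfolding L2.subspace_def using add scale linear_0[OF bounded_linear.linear[OF bl]]
        by (metis (no_types, lifting) rangeE rangeI)
    qed
    ultimately show ?thesis
      unfolding rank_less_def using B card_image_le[of "{..<j}" F] by (intro exI[of _ B]) auto
  qed
  moreover have "onorm (\<lambda>f. L f - S f) \<le> \<mu> j + 2 * real n * \<epsilon>"
  proof (rule onorm_bound)
    show "0 \<le> \<mu> j + 2 * real n * \<epsilon>" using m \<open>\<epsilon> \<ge> 0\<close> by simp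
  next
    fix f
    let ?h = "compl_proj j F f"
    have h: "ip ?h (F i) = 0" if "i < j" for i using compl_proj_orth[OF onj that] by simp
    have "L f = (\<Sum>i<j. scaleL2 (ip f (F i)) (L (F i))) + L ?h"
      by (subst compl_proj_decomp[of f F j]) (simp only: add_L scale_L sum)
    also have "\<dots> = S f + (\<Sum>i<j. scaleL2 (ip f (F i)) (L (F i) - \<mu> i *\<^sub>R F i)) + L ?h"
      unfolding S_def L2.scale_right_diff_distrib sum_subtractf scaleR_L2_def L2.scale_scale
      by (simp add: mult.commute)
    also have "L ?h = compl_proj j F (L ?h) + (\<Sum>i<j. scaleL2 (ip (L ?h) (F i)) (F i))"
      by (simp add: compl_proj_def)
    finally have "L f - S f = (\<Sum>i<j. scaleL2 (ip f (F i)) (L (F i) - \<mu> i *\<^sub>R F i)) + 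
       (compl_proj j F (L ?h) + (\<Sum>i<j. scaleL2 (ip (L ?h) (F i)) (F i)))" by simp
    also have "norm \<dots> \<le> (\<Sum>i<j. norm f * \<epsilon>) + (\<mu> j * norm f + (\<Sum>i<j. norm f * \<epsilon>))"
    proof (intro order_trans[OF norm_triangle_ineq] add_mono order_trans[OF norm_sum] sum_mono)
      fix i assume "i \<in> {..<j}"
      then have i: "i < j" "i < n" using assms by auto
      show "norm (scaleL2 (ip f (F i)) (L (F i) - \<mu> i *\<^sub>R F i)) \<le> norm f * \<epsilon>"
        using ip_cauchy_schwarz[of f "F i"] e[OF i(2)] orthonormal_norm[OF on i(2)]
        by (auto intro!: mult_mono)
      have "ip (L ?h) (F i) = ip ?h (L (F i) - \<mu> i *\<^sub>R F i)"
        using h[OF i(1)] by (simp add: sym ip_diff_right scaleR_L2_def)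
      also have "cmod \<dots> \<le> norm f * \<epsilon>"
        by (intro order_trans[OF ip_cauchy_schwarz] mult_mono norm_compl_proj_le onj e i) auto
      finally show "norm (scaleL2 (ip (L ?h) (F i)) (F i)) \<le> norm f * \<epsilon>"
        using orthonormal_norm[OF on i(2)] by simp
    next
      have "(norm (compl_proj j F (L ?h)))\<^sup>2 \<le> \<mu> j * rayleigh L ?h"
        by (rule compression_bound[OF onj h m up])
      also have "\<dots> \<le> \<mu> j * (\<mu> j * (norm ?h)\<^sup>2)" using up[OF h] m by (intro mult_left_mono) auto
      also have "\<dots> = (\<mu> j * norm ?h)\<^sup>2" by (simp only: power_mult_distrib power2_eq_square[of "\<mu> j"] mult.assoc)
      finally have "norm (compl_proj j F (L ?h)) \<le> \<mu> j * norm ?h"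
        by (rule power2_le_imp_le) (intro mult_nonneg_nonneg m norm_ge_zero)
      also have "\<dots> \<le> \<mu> j * norm f" using m norm_compl_proj_le[OF onj] by (intro mult_left_mono)
      finally show "norm (compl_proj j F (L ?h)) \<le> \<mu> j * norm f" .
    qed
    also have "\<dots> = (\<mu> j + 2 * real j * \<epsilon>) * norm f" by (simp add: algebra_simps)
    also have "\<dots> \<le> (\<mu> j + 2 * real n * \<epsilon>) * norm f"
      using assms \<open>\<epsilon> \<ge> 0\<close> by (intro mult_right_mono add_mono mult_mono) auto
    finally show "norm (L f - S f) \<le> (\<mu> j + 2 * real n * \<epsilon>) * norm f" .
  qed
  ultimately show ?thesis by blast
qed

end

lemma ex_kernel_lincomb:
  assumes "bounded_operator S" "rank_less S n"
  shows "\<exists>c. (\<exists>i<n. c i \<noteq> 0) \<and> S (\<Sum>i<n. scaleL2 (c i) (F i)) = 0"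
proof -
  obtain B where B: "finite B" "card B < n" "L2.span B = range S"
    using assms(2) by (auto simp: rank_less_def)
  have S: "linear S" and sc: "\<And>c f. S (scaleL2 c f) = scaleL2 c (S f)"
    using assms(1) by (auto simp: bounded_operator_def bounded_linear.linear)
  have Ssum: "S (\<Sum>i<n. scaleL2 (c i) (F i)) = (\<Sum>i<n. scaleL2 (c i) (S (F i)))" for c
    by (simp add: linear_sum[OF S] sc)
  define v where "v i = S (F i)" for i
  \<comment> \<open>\<open>L2.dependent\<close> speaks of sets, which forget multiplicities, so two
    equal images are treated separately.\<close>
  show ?thesis
  proof (cases "inj_on v {..<n}")
    case False
    then obtain i j where ij: "i < n" "j < n" "i \<noteq> j" "v i = v j" by (auto simp: inj_on_def)
    define c :: "nat \<Rightarrow> complex" where "c l = (if l = i then 1 else if l = j then -1 else 0)" for l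
    have "(\<Sum>l<n. scaleL2 (c l) (v l)) = (\<Sum>l\<in>{i,j}. scaleL2 (c l) (v l))"
      using ij by (intro sum.mono_neutral_right) (auto simp: c_def)
    also have "\<dots> = 0" using ij by (simp add: c_def)
    finally show ?thesis using ij Ssum[of c] unfolding v_def by (intro exI[of _ c]) (auto simp: c_def)
  next
    case True
    have "L2.dependent (v ` {..<n})"
    proof (rule ccontr)
      assume "L2.independent (v ` {..<n})"
      moreover have "v ` {..<n} \<subseteq> L2.span B" by (auto simp: B v_def)
      ultimately have "card (v ` {..<n}) \<le> card B" using L2.independent_span_bound[OF B(1)] by blast
      then show False using B(2) True by (simp add: card_image)
    qed
    then obtain u where u: "\<exists>x\<in>v ` {..<n}. u x \<noteq> 0" "(\<Sum>x\<in>v ` {..<n}. scaleL2 (u x) x) = 0"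
      by (auto simp: L2.dependent_finite)
    then have "(\<Sum>i<n. scaleL2 (u (v i)) (v i)) = 0" by (simp add: sum.reindex[OF True])
    then show ?thesis using u(1) Ssum[of "\<lambda>i. u (v i)"] unfolding v_def by (intro exI[of _ "\<lambda>i. u (S (F i))"]) auto
  qed
qed

context positive_contraction
begin

text \<open>A map of rank at most \<open>j\<close> kills some nonzero \<open>f\<close> in the span
  of the first \<open>j + 1\<close> vectors, and there \<open>norm (L f)\<close> is at least
  \<open>\<mu> j * norm f\<close> up to the residuals.\<close>

lemma approx_number_ge:
  assumes "approx_eigen n \<epsilon> F \<mu>" "j < n" "bounded_operator S" "rank_less S (Suc j)"
  shows "\<mu> j - n * \<epsilon> \<le> onorm (\<lambda>f. L f - S f)"
proof -
  have "orthonormal n F" using assms by (simp add: approx_eigen_def)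
  then have on: "orthonormal (Suc j) F" using assms(2) by (auto simp: orthonormal_def)
  have e: "norm (L (F i) - \<mu> i *\<^sub>R F i) \<le> \<epsilon>" if "i < n" for i
    using assms(1) that by (simp add: approx_eigen_def)
  have "\<epsilon> \<ge> 0" using order_trans[OF norm_ge_zero e[OF assms(2)]] .
  have m: "0 \<le> \<mu> j" and dec: "\<And>i. i \<le> j \<Longrightarrow> \<mu> j \<le> \<mu> i"
    using assms by (auto simp: approx_eigen_def)
  obtain c i0 where c: "i0 < Suc j" "c i0 \<noteq> 0" and Sz: "S (\<Sum>i<Suc j. scaleL2 (c i) (F i)) = 0"
    using ex_kernel_lincomb[OF assms(3,4), of F] by blast
  define f where "f = (\<Sum>i<Suc j. scaleL2 (c i) (F i))"
  have nf: "(norm f)\<^sup>2 = (\<Sum>i<Suc j. sqmod (c i))"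
    unfolding f_def by (rule norm_lincomb[OF on])
  have ci: "cmod (c i) \<le> norm f" if "i < Suc j" for i
  proof (rule power2_le_imp_le)
    show "sqmod (c i) \<le> (norm f)\<^sup>2"
      unfolding nf by (rule member_le_sum) (use that in auto)
  qed simp
  have "norm f > 0" using ci[OF c(1)] c(2) by (metis less_le_trans zero_less_norm_iff)
  let ?w = "\<Sum>i<Suc j. scaleL2 (\<mu> i * c i) (F i)"
  have "(\<mu> j * norm f)\<^sup>2 = (\<Sum>i<Suc j. (\<mu> j * cmod (c i))\<^sup>2)"
    by (simp only: power_mult_distrib nf sum_distrib_left)
  also have "\<dots> \<le> (\<Sum>i<Suc j. sqmod (\<mu> i * c i))"
  proof (intro sum_mono power_mono)
    fix i assume "i \<in> {..<Suc j}"
    then have "\<mu> j \<le> \<bar>\<mu> i\<bar>" using dec[of i] by simp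
    then show "\<mu> j * cmod (c i) \<le> cmod (\<mu> i * c i)" by (simp add: norm_mult mult_right_mono)
  qed (use m in simp)
  also have "\<dots> = (norm ?w)\<^sup>2" by (rule norm_lincomb[OF on, symmetric])
  finally have w: "\<mu> j * norm f \<le> norm ?w" by (rule power2_le_imp_le) simp
  have "L f - ?w = (\<Sum>i<Suc j. scaleL2 (c i) (L (F i) - \<mu> i *\<^sub>R F i))"
    unfolding f_def sum scale L2.scale_right_diff_distrib sum_subtractf scaleR_L2_def L2.scale_scale
    by (simp only: mult.commute)
  also have "norm \<dots> \<le> (\<Sum>i<Suc j. norm f * \<epsilon>)"
    using ci e assms(2) by (intro order_trans[OF norm_sum] sum_mono) (auto intro!: mult_mono)
  also have "\<dots> \<le> n * (norm f * \<epsilon>)"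
    using assms(2) \<open>\<epsilon> \<ge> 0\<close> by (simp del: sum.lessThan_Suc add: mult_right_mono)
  finally have "\<mu> j * norm f - n * (norm f * \<epsilon>) \<le> norm (L f)"
    using w norm_triangle_sub[of ?w "L f"] by (simp add: norm_minus_commute)
  also have "norm (L f) = norm (L f - S f)" using Sz by (simp add: f_def)
  also have "\<dots> \<le> onorm (\<lambda>f. L f - S f) * norm f"
    using assms(3) by (intro onorm bounded_linear_sub bounded_linear) (simp add: bounded_operator_def)
  finally have "(\<mu> j - n * \<epsilon>) * norm f \<le> onorm (\<lambda>f. L f - S f) * norm f" by (simp add: algebra_simps)
  then show ?thesis using \<open>norm f > 0\<close> by simp
qed

definition approx_number :: "nat \<Rightarrow> real" where
  "approx_number k = Inf {onorm (\<lambda>f. L f - S f) |S. bounded_operator S \<and> rank_less S k}"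

lemma approx_number_bounds:
  assumes "approx_eigen n \<epsilon> F \<mu>" "j < n"
  shows "\<mu> j - n * \<epsilon> \<le> approx_number (Suc j)" "approx_number (Suc j) \<le> \<mu> j + 2 * real n * \<epsilon>"
proof -
  let ?A = "{onorm (\<lambda>f. L f - S f) |S. bounded_operator S \<and> rank_less S (Suc j)}"
  obtain S where S: "bounded_operator S" "rank_less S (Suc j)" "onorm (\<lambda>f. L f - S f) \<le> \<mu> j + 2 * real n * \<epsilon>"
    using approx_number_le[OF assms] by (elim exE conjE) (rule that, simp_all)
  show "\<mu> j - n * \<epsilon> \<le> approx_number (Suc j)"
    unfolding approx_number_def using S approx_number_ge[OF assms] by (intro cInf_greatest) auto
  have "bdd_below ?A" using approx_number_ge[OF assms] by (intro bdd_belowI[of _ "\<mu> j - n * \<epsilon>"]) auto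
  then have "approx_number (Suc j) \<le> onorm (\<lambda>f. L f - S f)"
    unfolding approx_number_def using S by (intro cInf_lower) auto
  then show "approx_number (Suc j) \<le> \<mu> j + 2 * real n * \<epsilon>" using S(3) by simp
qed

end

section \<open>Expansion of the quadratic form of L - \<open>L\<^sup>2\<close> along an approximate
  eigensystem\<close>

context positive_contraction
begin

text \<open>The right-hand side is shaped for integration over a frame: each error is the square of
  a coefficient of \<open>k\<close>, so Parseval replaces it by the squared norm of
  \<open>F j\<close>, \<open>E j\<close> or \<open>R j\<close>, with weights that keep the result of
  order \<epsilon>. The vectors \<open>E j\<close> gather the cross terms caused by the residual of
  \<open>F j\<close>, and \<open>R j\<close> is the part of that residual orthogonal to the
  system.\<close>

lemma eigen_expansion:
  assumes ae: "approx_eigen (Suc n) \<epsilon> F \<mu>" and "\<epsilon> > 0"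
  shows "\<exists>E R. (\<forall>j<n. norm (E j) \<le> 4 * \<epsilon> \<and> norm (R j) \<le> \<epsilon>) \<and>
    (\<forall>k. (\<Sum>j<n. \<mu> j * (1 - \<mu> j) * sqmod (ip k (F j)))
          + (1 - \<mu> n) * rayleigh L (compl_proj n F k)
        \<le> rayleigh L k - (norm (L k))\<^sup>2
          + (\<Sum>j<n. \<epsilon> * sqmod (ip k (F j)) + sqmod (ip k (E j)) / (4 * \<epsilon>) + sqmod (ip k (R j))))"
    (is "\<exists>E R. _ E R \<and> (\<forall>k. ?expansion E R k)")
proof -
  have on: "orthonormal n F" using ae by (auto simp: approx_eigen_def orthonormal_def)
  have e: "norm (L (F j) - \<mu> j *\<^sub>R F j) \<le> \<epsilon>" and \<mu>: "0 \<le> \<mu> j" "\<mu> j \<le> 1" if "j < Suc n" for j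
    using ae that by (auto simp: approx_eigen_def)
  have up: "rayleigh L h \<le> \<mu> n * (norm h)\<^sup>2" if "\<And>i. i < n \<Longrightarrow> ip h (F i) = 0" for h
    using ae that by (auto simp: approx_eigen_def)
  define Q where "Q = compl_proj n F"
  define r where "r j = L (F j) - \<mu> j *\<^sub>R F j" for j
  define e' where "e' j = (1 - \<mu> j) *\<^sub>R r j - L (r j)" for j
  define E where "E j = e' j + Q (e' j)" for j
  define R where "R j = Q (r j)" for j
  define T where "T f = L f - L (L f)" for f
  have r: "norm (r j) \<le> \<epsilon>" if "j < n" for j using e[of j] that by (simp add: r_def)
  have R: "norm (R j) \<le> \<epsilon>" if "j < n" for j
    using norm_compl_proj_le[OF on, of "r j"] r[OF that] by (simp add: R_def Q_def)
  have e': "norm (e' j) \<le> 2 * \<epsilon>" if "j < n" for j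
  proof -
    have "norm (e' j) \<le> norm ((1 - \<mu> j) *\<^sub>R r j) + norm (L (r j))"
      unfolding e'_def by (rule norm_triangle_ineq4)
    also have "norm ((1 - \<mu> j) *\<^sub>R r j) \<le> 1 * \<epsilon>"
      unfolding norm_scaleR using \<mu>[of j] that r[OF that] by (intro mult_mono) auto
    also have "norm (L (r j)) \<le> \<epsilon>" using norm_le[of "r j"] r[OF that] by simp
    finally show ?thesis by simp
  qed
  have E: "norm (E j) \<le> 4 * \<epsilon>" if "j < n" for j
    using norm_triangle_ineq[of "e' j" "Q (e' j)"] norm_compl_proj_le[OF on, of "e' j"] e'[OF that]
    by (simp add: E_def Q_def)
  have LF: "L (F j) = \<mu> j *\<^sub>R F j + r j" for j by (simp add: r_def)
  have TF: "T (F j) = scaleL2 (complex_of_real (\<mu> j * (1 - \<mu> j))) (F j) + e' j" for j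
  proof -
    have "T (F j) = (\<mu> j - \<mu> j * \<mu> j) *\<^sub>R F j + (r j - \<mu> j *\<^sub>R r j - L (r j))"
      unfolding T_def LF add scaleR scaleR_add_right scaleR_scaleR scaleR_diff_left by simp
    then show ?thesis unfolding e'_def scaleL2_of_real by (simp add: scaleR_diff_left right_diff_distrib)
  qed
  have Tsym: "ip (T f) h = ip f (T h)" for f h
    by (simp add: T_def ip_diff_left ip_diff_right sym)
  have TT: "Re (ip (T f) f) = rayleigh L f - (norm (L f))\<^sup>2" for f
    by (simp add: T_def ip_diff_left sym[of "L f" f] Re_ip_self)
  show ?thesis
  proof (rule exI[of _ E], rule exI[of _ R], intro conjI)
    show "\<forall>j<n. norm (E j) \<le> 4 * \<epsilon> \<and> norm (R j) \<le> \<epsilon>" using E R by blast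
    show "\<forall>k. ?expansion E R k"
    proof
    fix k
    define c where "c j = ip k (F j)" for j
    define w where "w = (\<Sum>j<n. scaleL2 (c j) (F j))"
    define h where "h = Q k"
    have k: "k = w + h" unfolding w_def h_def Q_def c_def by (rule compl_proj_decomp)
    have h: "ip h (F j) = 0" if "j < n" for j
      using compl_proj_orth[OF on that] by (simp add: h_def Q_def)
    have Tw: "T w = (\<Sum>j<n. scaleL2 (c j) (T (F j)))"
      by (simp add: T_def w_def sum scale L2.scale_right_diff_distrib sum_subtractf)
    have Fk: "ip (F j) k = cnj (c j)" for j by (subst ip_commute) (simp add: c_def)
    have 1: "ip (T w) k = (\<Sum>j<n. \<mu> j * (1 - \<mu> j) * sqmod (c j)) + (\<Sum>j<n. c j * ip (e' j) k)"
      unfolding Tw ip_sum_left of_real_sum sum.distrib[symmetric]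
    proof (intro sum.cong refl)
      fix j
      have "ip (scaleL2 (c j) (T (F j))) k = complex_of_real (\<mu> j * (1 - \<mu> j)) * (c j * cnj (c j)) + c j * ip (e' j) k"
        unfolding TF ip_scale_left ip_add_left Fk by (simp add: algebra_simps)
      then show "ip (scaleL2 (c j) (T (F j))) k = complex_of_real (\<mu> j * (1 - \<mu> j) * sqmod (c j)) + c j * ip (e' j) k"
        unfolding complex_norm_square[symmetric] by simp
    qed
    have "ip (T h) w = (\<Sum>j<n. cnj (c j) * ip h (e' j))"
      unfolding Tsym Tw ip_sum_right by (intro sum.cong refl) (simp add: TF ip_add_right h)
    also have "\<dots> = cnj (\<Sum>j<n. c j * ip (Q (e' j)) k)"
      unfolding cnj_sum complex_cnj_mult h_def Q_def compl_proj_sym[OF on, of k] ip_commute[of "compl_proj n F _" k]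
      by simp
    finally have 2: "Re (ip (T h) w) = Re (\<Sum>j<n. c j * ip (Q (e' j)) k)" by simp
    have "Re (ip (T k) k) = Re (ip (T w) k) + Re (ip (T h) w) + Re (ip (T h) h)"
    proof -
      have "T k = T w + T h" by (simp add: T_def k add)
      then show ?thesis by (simp add: ip_add_left) (simp add: k ip_add_right)
    qed
    also have "Re (ip (T w) k) + Re (ip (T h) w) = (\<Sum>j<n. \<mu> j * (1 - \<mu> j) * sqmod (c j)) + (\<Sum>j<n. Re (c j * ip (E j) k))"
      unfolding 1 2 by (simp add: E_def ip_add_left distrib_left sum.distrib)
    finally have main: "Re (ip (T k) k) = (\<Sum>j<n. \<mu> j * (1 - \<mu> j) * sqmod (c j)) + (\<Sum>j<n. Re (c j * ip (E j) k)) + Re (ip (T h) h)" .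
    have 3: "- Re (c j * ip (E j) k) \<le> \<epsilon> * sqmod (c j) + sqmod (ip k (E j)) / (4 * \<epsilon>)" for j
    proof -
      have "- Re (c j * ip (E j) k) \<le> cmod (c j) * cmod (ip k (E j))"
        using complex_Re_le_cmod[of "- (c j * ip (E j) k)"] by (simp add: norm_mult) (metis complex_mod_cnj ip_commute)
      \<comment> \<open>Young's inequality with weights matched to
        \<open>norm (E j) \<le> 4 * \<epsilon>\<close>: after integration both terms are of order
        \<epsilon>.\<close>
      also have "\<dots> \<le> \<epsilon> * sqmod (c j) + sqmod (ip k (E j)) / (4 * \<epsilon>)"
      proof -
        have "0 \<le> (2 * \<epsilon> * cmod (c j) - cmod (ip k (E j)))\<^sup>2 / (4 * \<epsilon>)" using \<open>\<epsilon> > 0\<close> by simp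
        also have "\<dots> = \<epsilon> * sqmod (c j) + sqmod (ip k (E j)) / (4 * \<epsilon>) - cmod (c j) * cmod (ip k (E j))"
          using \<open>\<epsilon> > 0\<close> by (simp add: field_simps power2_eq_square)
        finally show ?thesis by simp
      qed
      finally show ?thesis .
    qed
    have 4: "- (\<Sum>j<n. Re (c j * ip (E j) k)) \<le> (\<Sum>j<n. \<epsilon> * sqmod (c j) + sqmod (ip k (E j)) / (4 * \<epsilon>))"
      unfolding sum_negf[symmetric] by (intro sum_mono 3)
    \<comment> \<open>Along the system \<open>L h\<close> has only residual coefficients;
      orthogonally to it \<open>compression_bound\<close> leaves
      \<open>\<mu> n * rayleigh L h\<close>. Subtracting from \<open>rayleigh L h\<close> produces
      the tail with weight \<open>1 - \<mu> n\<close>.\<close>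
    have "(norm (L h))\<^sup>2 = (\<Sum>j<n. sqmod (ip (L h) (F j))) + (norm (Q (L h)))\<^sup>2"
      unfolding Q_def by (rule norm_compl_proj[OF on])
    also have "(\<Sum>j<n. sqmod (ip (L h) (F j))) = (\<Sum>j<n. sqmod (ip k (R j)))"
    proof (intro sum.cong refl)
      fix j assume "j \<in> {..<n}"
      then have "ip (L h) (F j) = ip h (r j)"
        using h[of j] by (simp add: sym r_def ip_diff_right scaleR_L2_def)
      also have "\<dots> = ip k (R j)" by (simp add: h_def R_def Q_def compl_proj_sym[OF on])
      finally show "sqmod (ip (L h) (F j)) = sqmod (ip k (R j))" by simp
    qed
    also have "(norm (Q (L h)))\<^sup>2 \<le> \<mu> n * rayleigh L h"
      unfolding Q_def by (rule compression_bound[OF on h \<mu>(1) up]) auto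
    finally have 5: "(1 - \<mu> n) * rayleigh L h \<le> Re (ip (T h) h) + (\<Sum>j<n. sqmod (ip k (R j)))"
      by (simp add: TT algebra_simps)
    show "?expansion E R k"
      using main 4 5 unfolding TT[symmetric] sum.distrib c_def[symmetric] Q_def[symmetric] h_def[symmetric] by linarith
    qed
  qed
qed

end

section \<open>Localization operators of continuous Parseval frames\<close>

text \<open>An abstract continuous Parseval frame of unit vectors, with \<open>L\<close> given
  through its sesquilinear form. Infinite total measure makes the Hilbert space infinite-dimensional
  (\<open>ex_orthogonal\<close>); joint measurability serves the exchange of integrals in
  \<open>trace_compl\<close>.\<close>

locale localization = sigma_finite_measure M for M :: "'b measure" +
  fixes k :: "'b \<Rightarrow> 'a::euclidean_space L2" and \<Omega> :: "'b set" and L :: "'a L2 \<Rightarrow> 'a L2"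
  assumes norm_k: "norm (k z) = 1"
    and meas_ip_k [measurable]: "(\<lambda>z. ip f (k z)) \<in> borel_measurable M"
    and meas_ip_k_k [measurable]: "(\<lambda>(z, w). ip (k z) (k w)) \<in> borel_measurable (M \<Otimes>\<^sub>M M)"
    and parseval: "(\<integral>\<^sup>+z. ennreal (sqmod (ip f (k z))) \<partial>M) = ennreal ((norm f)\<^sup>2)"
    and infinite: "emeasure M (space M) = \<infinity>"
    and \<Omega> [measurable]: "\<Omega> \<in> sets M" and \<Omega>_fin: "emeasure M \<Omega> < \<infinity>"
    and weak: "ip (L f) h = (LINT z|M. indicator \<Omega> z * (ip f (k z) * ip (k z) h))"
begin

lemma cmod_ip_sym: "cmod (ip f h) = cmod (ip h f)"
  by (subst ip_commute) simp

lemma meas_k_ip [measurable]: "(\<lambda>z. ip (k z) f) \<in> borel_measurable M"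
proof -
  have [measurable]: "cnj \<in> borel_measurable borel"
    by (intro borel_measurable_continuous_onI continuous_on_cnj continuous_intros)
  have "(\<lambda>z. cnj (ip f (k z))) \<in> borel_measurable M" by measurable
  then show ?thesis by (simp flip: ip_commute)
qed

lemma coeff_has_integral:
  "has_bochner_integral M (\<lambda>z. sqmod (ip f (k z))) ((norm f)\<^sup>2)"
  by (rule has_bochner_integral_nn_integral) (use parseval in auto)

lemma coeff_has_integral':
  "has_bochner_integral M (\<lambda>z. sqmod (ip (k z) f)) ((norm f)\<^sup>2)"
  using coeff_has_integral[of f] by (simp add: cmod_ip_sym)

lemmas coeff_integrable = coeff_has_integral[THEN integrable.intros] coeff_has_integral'[THEN integrable.intros]
lemmas coeff_integral = coeff_has_integral[THEN has_bochner_integral_integral_eq] coeff_has_integral'[THEN has_bochner_integral_integral_eq]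

lemma form_eq: "rayleigh L f = (LINT z|M. indicator \<Omega> z * sqmod (ip f (k z)))"
proof -
  have "ip (L f) f = (LINT z|M. complex_of_real (indicator \<Omega> z * sqmod (ip f (k z))))"
    unfolding weak
  proof (intro Bochner_Integration.integral_cong refl)
    fix z
    have "ip f (k z) * ip (k z) f = complex_of_real (sqmod (ip f (k z)))"
      unfolding complex_norm_square by (simp flip: ip_commute)
    then show "indicator \<Omega> z * (ip f (k z) * ip (k z) f) = complex_of_real (indicator \<Omega> z * sqmod (ip f (k z)))"
      by (simp add: indicator_def)
  qed
  then have "ip (L f) f = complex_of_real (LINT z|M. indicator \<Omega> z * sqmod (ip f (k z)))"
    by (simp only: integral_complex_of_real)
  then show ?thesis by simp
qed

sublocale positive_contraction L
proof
  fix f h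
  have "ip f (L h) = cnj (LINT z|M. indicator \<Omega> z * (ip h (k z) * ip (k z) f))"
    by (subst ip_commute) (simp only: weak)
  also have "\<dots> = (LINT z|M. cnj (indicator \<Omega> z * (ip h (k z) * ip (k z) f)))"
    by (rule Bochner_Integration.integral_cnj[symmetric])
  also have "\<dots> = ip (L f) h"
    unfolding weak by (intro Bochner_Integration.integral_cong refl)
      (simp add: indicator_def ip_commute[of f] ip_commute[of _ h])
  finally show "ip (L f) h = ip f (L h)" by simp
  show "0 \<le> rayleigh L f"
    unfolding form_eq by (intro integral_nonneg_AE AE_I2) auto
  have "rayleigh L f \<le> (LINT z|M. sqmod (ip f (k z)))"
    unfolding form_eq
    by (intro integral_mono Bochner_Integration.integrable_bound[OF coeff_integrable(1)[of f]] coeff_integrable(1))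
       (auto simp: indicator_def)
  then show "rayleigh L f \<le> (norm f)\<^sup>2" by (simp add: coeff_integral)
qed

text \<open>Were the system complete, the squared coefficients of every unit vector
  \<open>k z\<close> would add up to 1, and this finite sum of integrable functions would make 1
  integrable over a space of infinite measure.\<close>

lemma ex_orthogonal:
  fixes F :: "nat \<Rightarrow> 'a L2"
  assumes "orthonormal n F"
  shows "\<exists>h\<noteq>0. \<forall>j<n. ip h (F j) = 0"
proof (rule ccontr)
  assume *: "\<not> ?thesis"
  have "(\<Sum>j<n. sqmod (ip (k z) (F j))) = 1" for z
  proof -
    have "compl_proj n F (k z) = 0" using * compl_proj_orth(1)[OF assms] by blast
    then show ?thesis using norm_compl_proj[OF assms, of "k z"] by (simp add: norm_k)
  qed
  moreover have "integrable M (\<lambda>z. \<Sum>j<n. sqmod (ip (k z) (F j)))"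
    by (intro Bochner_Integration.integrable_sum coeff_integrable)
  ultimately have "integrable M (\<lambda>z. 1 :: real)" by simp
  then have "(\<integral>\<^sup>+z. ennreal (norm (1 :: real)) \<partial>M) < \<infinity>"
    unfolding integrable_iff_bounded by blast
  then show False using infinite by simp
qed

text \<open>The trace of the compression, computed in the frame. The projection is symmetric, so
  Tonelli lets it move to \<open>k w\<close> and the integral over \<open>z\<close> be done first;
  \<open>parseval\<close> turns that into the squared norm of the projected \<open>k w\<close>,
  which is 1 minus the squared coefficients, and integration over \<Omega> restores the Rayleigh
  quotients.\<close>

lemma trace_compl:
  fixes F :: "nat \<Rightarrow> 'a L2"
  assumes on: "orthonormal n F"
  shows "has_bochner_integral M (\<lambda>z. rayleigh L (compl_proj n F (k z)))
    (measure M \<Omega> - (\<Sum>j<n. rayleigh L (F j)))"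
    and "(\<Sum>j<n. rayleigh L (F j)) \<le> measure M \<Omega>"
proof -
  interpret P: pair_sigma_finite M M ..
  define Q where "Q z = compl_proj n F (k z)" for z
  have ipQ: "ip (Q z) (k w) = ip (k z) (k w) - (\<Sum>j<n. ip (k z) (F j) * ip (F j) (k w))" for z w
    by (simp add: Q_def compl_proj_def ip_diff_left ip_sum_left)
  have [measurable]: "(\<lambda>(z, w). ip (Q z) (k w)) \<in> borel_measurable (M \<Otimes>\<^sub>M M)"
    unfolding ipQ split_beta'
    by (intro borel_measurable_diff borel_measurable_sum borel_measurable_times)
       (use meas_ip_k_k in \<open>simp add: split_beta'\<close>, measurable)
  let ?s = "\<lambda>w. indicator \<Omega> w * (norm (Q w))\<^sup>2"
  have Qn: "(norm (Q w))\<^sup>2 = 1 - (\<Sum>j<n. sqmod (ip (k w) (F j)))" for w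
    using norm_compl_proj[OF on, of "k w"] by (simp add: Q_def norm_k)
  have ind: "integrable M (indicat_real \<Omega>)" using \<Omega>_fin by simp
  have s_eq: "?s = (\<lambda>w. indicator \<Omega> w - (\<Sum>j<n. indicator \<Omega> w * sqmod (ip (F j) (k w))))"
    by (simp add: Qn fun_eq_iff right_diff_distrib sum_distrib_left cmod_ip_sym[of "k _"])
  have term_int: "integrable M (\<lambda>w. indicator \<Omega> w * sqmod (ip (F j) (k w)))" for j
    by (rule Bochner_Integration.integrable_bound[OF coeff_integrable(1)[of "F j"]]) (auto simp: indicator_def)
  have s_int: "integrable M ?s"
    unfolding s_eq by (intro Bochner_Integration.integrable_diff Bochner_Integration.integrable_sum ind term_int)
  have s_val: "(LINT w|M. ?s w) = measure M \<Omega> - (\<Sum>j<n. rayleigh L (F j))"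
  proof -
    have "(LINT w|M. ?s w) = (LINT w|M. indicator \<Omega> w) - (LINT w|M. (\<Sum>j<n. indicator \<Omega> w * sqmod (ip (F j) (k w))))"
      unfolding s_eq by (intro Bochner_Integration.integral_diff Bochner_Integration.integrable_sum ind term_int)
    also have "(LINT w|M. (\<Sum>j<n. indicator \<Omega> w * sqmod (ip (F j) (k w)))) = (\<Sum>j<n. rayleigh L (F j))"
      unfolding form_eq by (intro Bochner_Integration.integral_sum term_int)
    finally show ?thesis by simp
  qed
  have nn_form: "ennreal (rayleigh L (Q z)) = (\<integral>\<^sup>+w. indicator \<Omega> w * ennreal (sqmod (ip (Q z) (k w))) \<partial>M)" for z
  proof -
    have "(\<integral>\<^sup>+w. ennreal (indicator \<Omega> w * sqmod (ip (Q z) (k w))) \<partial>M) = ennreal (rayleigh L (Q z))"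
      unfolding form_eq
      by (intro nn_integral_eq_integral Bochner_Integration.integrable_bound[OF coeff_integrable(1)[of "Q z"]])
         (auto simp: indicator_def)
    moreover have "ennreal (indicator \<Omega> w * sqmod (ip (Q z) (k w))) = indicator \<Omega> w * ennreal (sqmod (ip (Q z) (k w)))" for w
      by (simp add: indicator_def)
    ultimately show ?thesis by simp
  qed
  have "(\<integral>\<^sup>+z. ennreal (rayleigh L (Q z)) \<partial>M)
      = (\<integral>\<^sup>+w. (\<integral>\<^sup>+z. indicator \<Omega> w * ennreal (sqmod (ip (Q z) (k w))) \<partial>M) \<partial>M)"
    unfolding nn_form by (rule P.Fubini'[symmetric]) measurable
  also have "\<dots> = (\<integral>\<^sup>+w. ennreal (?s w) \<partial>M)"
  proof (intro nn_integral_cong)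
    fix w
    have "cmod (ip (Q z) (k w)) = cmod (ip (Q w) (k z))" for z
      unfolding Q_def compl_proj_sym[OF on, of "k z"] by (rule cmod_ip_sym)
    then show "(\<integral>\<^sup>+z. indicator \<Omega> w * ennreal (sqmod (ip (Q z) (k w))) \<partial>M) = ennreal (?s w)"
      by (simp add: nn_integral_cmult parseval) (simp add: indicator_def)
  qed
  also have "\<dots> = ennreal (LINT w|M. ?s w)"
    by (intro nn_integral_eq_integral s_int) auto
  finally have nn: "(\<integral>\<^sup>+z. ennreal (rayleigh L (Q z)) \<partial>M) = ennreal (LINT w|M. ?s w)" .
  have "(\<lambda>z. enn2real (\<integral>\<^sup>+w. indicator \<Omega> w * ennreal (sqmod (ip (Q z) (k w))) \<partial>M)) \<in> borel_measurable M"
    by measurable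
  then have "(\<lambda>z. rayleigh L (Q z)) \<in> borel_measurable M"
    by (simp add: nn_form[symmetric] nonneg)
  then have "has_bochner_integral M (\<lambda>z. rayleigh L (Q z)) (LINT w|M. ?s w)"
    by (intro has_bochner_integral_nn_integral nn) (auto simp: nonneg intro!: integral_nonneg_AE)
  then show "has_bochner_integral M (\<lambda>z. rayleigh L (compl_proj n F (k z)))
    (measure M \<Omega> - (\<Sum>j<n. rayleigh L (F j)))"
    unfolding s_val unfolding Q_def .
  have "0 \<le> (LINT w|M. ?s w)" by (intro integral_nonneg_AE AE_I2) auto
  then show "(\<Sum>j<n. rayleigh L (F j)) \<le> measure M \<Omega>" unfolding s_val by simp
qed

text \<open>The Berezin symbol of \<open>L\<close>: the share of the frame coefficients of
  \<open>k z\<close> that falls into \<Omega>.\<close>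

definition local_mass :: "'b \<Rightarrow> real" where
  "local_mass z = rayleigh L (k z)"

definition leakage :: "'b \<Rightarrow> real" where
  "leakage z = local_mass z * (1 - local_mass z)"

lemma local_mass_bounds: "0 \<le> local_mass z" "local_mass z \<le> 1"
  using nonneg[of "k z"] le[of "k z"] by (auto simp: local_mass_def norm_k)

lemma local_mass_has_integral: "has_bochner_integral M local_mass (measure M \<Omega>)"
  using trace_compl(1)[of 0] by (simp add: orthonormal_def compl_proj_def local_mass_def[abs_def])

lemma leakage_nonneg: "0 \<le> leakage z" and leakage_le: "leakage z \<le> local_mass z"
  using local_mass_bounds[of z] by (auto simp: leakage_def mult_left_le)

text \<open>Cauchy-Schwarz against the unit vector \<open>k z\<close> gives
  \<open>local_mass z \<le> norm (L (k z))\<close>, so the form of L - \<open>L\<^sup>2\<close> is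
  controlled by the symbol alone.\<close>

lemma leakage_ge: "rayleigh L (k z) - (norm (L (k z)))\<^sup>2 \<le> leakage z"
proof -
  have "local_mass z \<le> norm (L (k z))"
    using complex_Re_le_cmod[of "ip (L (k z)) (k z)"] ip_cauchy_schwarz[of "L (k z)" "k z"]
    by (simp add: norm_k local_mass_def)
  then have "(local_mass z)\<^sup>2 \<le> (norm (L (k z)))\<^sup>2"
    by (intro power_mono local_mass_bounds)
  then show ?thesis by (simp add: leakage_def local_mass_def power2_eq_square algebra_simps)
qed

lemma leakage_integrable: "integrable M leakage"
proof (rule Bochner_Integration.integrable_bound)
  show lm: "integrable M local_mass" using local_mass_has_integral by (rule integrable.intros)
  show "leakage \<in> borel_measurable M" unfolding leakage_def[abs_def] using lm by measurable
  show "AE z in M. norm (leakage z) \<le> norm (local_mass z)"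
    using leakage_nonneg leakage_le by (auto intro!: AE_I2 order_trans[OF _ abs_ge_self])
qed

lemma integrable_indicator_times:
  fixes f :: "'b \<Rightarrow> real"
  assumes "S \<in> sets M" "integrable M f"
  shows "integrable M (\<lambda>z. indicator S z * f z)"
  using integrable_mult_indicator[OF assms] by simp

text \<open>This is \<open>eigen_expansion\<close> at the frame vectors, integrated over
  \<open>S\<close>. The nonnegative errors are integrated over the whole space, where Parseval
  allots to each \<open>j\<close> at most \<epsilon> + 4 \<epsilon> +
  \<open>\<epsilon>\<^sup>2\<close>.\<close>

lemma approx_eigen_leakage:
  assumes ae: "approx_eigen (Suc n) \<epsilon> F \<mu>" and "\<epsilon> > 0" and S: "S \<in> sets M"
  shows "(\<Sum>j<n. \<mu> j * (1 - \<mu> j) * (LINT z|M. indicator S z * sqmod (ip (F j) (k z))))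
      + (1 - \<mu> n) * (LINT z|M. indicator S z * rayleigh L (compl_proj n F (k z)))
    \<le> (LINT z|M. indicator S z * leakage z) + n * (5 * \<epsilon> + \<epsilon>\<^sup>2)"
proof -
  obtain E R where ER: "\<And>j. j < n \<Longrightarrow> norm (E j) \<le> 4 * \<epsilon>" "\<And>j. j < n \<Longrightarrow> norm (R j) \<le> \<epsilon>"
    and ineq: "\<And>h. (\<Sum>j<n. \<mu> j * (1 - \<mu> j) * sqmod (ip h (F j)))
          + (1 - \<mu> n) * rayleigh L (compl_proj n F h)
        \<le> rayleigh L h - (norm (L h))\<^sup>2
          + (\<Sum>j<n. \<epsilon> * sqmod (ip h (F j)) + sqmod (ip h (E j)) / (4 * \<epsilon>) + sqmod (ip h (R j)))"
    using eigen_expansion[OF ae \<open>\<epsilon> > 0\<close>] by blast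
  have on: "orthonormal n F" using ae by (auto simp: approx_eigen_def orthonormal_def)
  have nF: "norm (F j) = 1" if "j < n" for j using orthonormal_norm[OF on that] .
  let ?q = "\<lambda>z. rayleigh L (compl_proj n F (k z))"
  let ?err = "\<lambda>z. \<Sum>j<n. \<epsilon> * sqmod (ip (k z) (F j)) + sqmod (ip (k z) (E j)) / (4 * \<epsilon>) + sqmod (ip (k z) (R j))"
  let ?lhs = "\<lambda>z. (\<Sum>j<n. \<mu> j * (1 - \<mu> j) * (indicator S z * sqmod (ip (F j) (k z)))) + (1 - \<mu> n) * (indicator S z * ?q z)"
  have q: "integrable M ?q" using trace_compl(1)[OF on] by (rule integrable.intros)
  have i1: "integrable M (\<lambda>z. indicator S z * sqmod (ip (F j) (k z)))" for j
    by (intro integrable_indicator_times S coeff_integrable)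
  have i2: "integrable M (\<lambda>z. indicator S z * ?q z)"
    by (intro integrable_indicator_times S q)
  have i3: "integrable M ?err"
    by (intro Bochner_Integration.integrable_sum Bochner_Integration.integrable_add integrable_mult_right integrable_divide coeff_integrable)
  have i4: "integrable M (\<lambda>z. indicator S z * leakage z)"
    by (intro integrable_indicator_times S leakage_integrable)
  have "(LINT z|M. ?lhs z) \<le> (LINT z|M. indicator S z * leakage z + ?err z)"
  proof (intro integral_mono Bochner_Integration.integrable_add Bochner_Integration.integrable_sum integrable_mult_right
      integrable_divide coeff_integrable i1 i2 i4)
    fix z
    have "0 \<le> ?err z" using \<open>\<epsilon> > 0\<close> by (intro sum_nonneg) auto
    then show "?lhs z \<le> indicator S z * leakage z + ?err z"
      using ineq[of "k z"] leakage_ge[of z] by (auto simp: indicator_def cmod_ip_sym[of "F _"])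
  qed
  also have "(LINT z|M. indicator S z * leakage z + ?err z) = (LINT z|M. indicator S z * leakage z) + (LINT z|M. ?err z)"
    by (intro Bochner_Integration.integral_add i3 i4)
  also have "(LINT z|M. ?err z) = (\<Sum>j<n. \<epsilon> * (norm (F j))\<^sup>2 + (norm (E j))\<^sup>2 / (4 * \<epsilon>) + (norm (R j))\<^sup>2)"
    by (simp add: Bochner_Integration.integral_sum coeff_integrable coeff_integral)
  also have "\<dots> \<le> (\<Sum>j<n. 5 * \<epsilon> + \<epsilon>\<^sup>2)"
  proof (intro sum_mono)
    fix j assume j: "j \<in> {..<n}"
    then have "(norm (E j))\<^sup>2 \<le> (4 * \<epsilon>)\<^sup>2" "(norm (R j))\<^sup>2 \<le> \<epsilon>\<^sup>2"
      using ER[of j] by (intro power_mono; simp)+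
    moreover have "(norm (E j))\<^sup>2 / (4 * \<epsilon>) \<le> 4 * \<epsilon>"
      using calculation(1) \<open>\<epsilon> > 0\<close> by (simp add: field_simps power2_eq_square)
    ultimately show "\<epsilon> * (norm (F j))\<^sup>2 + (norm (E j))\<^sup>2 / (4 * \<epsilon>) + (norm (R j))\<^sup>2 \<le> 5 * \<epsilon> + \<epsilon>\<^sup>2"
      using nF j by simp
  qed
  also have "(LINT z|M. ?lhs z) = (\<Sum>j<n. \<mu> j * (1 - \<mu> j) * (LINT z|M. indicator S z * sqmod (ip (F j) (k z))))
      + (1 - \<mu> n) * (LINT z|M. indicator S z * ?q z)"
    by (simp add: Bochner_Integration.integral_sum i1 i2)
  finally show ?thesis by simp
qed

section \<open>Passage from approximate eigensystems to approximation numbers\<close>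

abbreviation eig :: "nat \<Rightarrow> real" where
  "eig j \<equiv> approx_number (Suc j)"

text \<open>All approximate eigensystems of precision \<open>1 / i\<close> approach the approximation numbers, so
  inequalities between the \<open>\<mu> j\<close> pass to the limit.\<close>

lemma approx_number_limit:
  "\<exists>F \<mu>. (\<forall>i. approx_eigen n (inverse (real (Suc i))) (F i) (\<mu> i)) \<and>
     (\<forall>j<n. (\<lambda>i. \<mu> i j) \<longlonglongrightarrow> eig j)"
proof -
  have "\<exists>F \<mu>. approx_eigen n (inverse (real (Suc i))) F \<mu>" for i
    by (rule ex_approx_eigen[OF ex_orthogonal]) simp_all
  then obtain F \<mu> where ae: "\<And>i. approx_eigen n (inverse (real (Suc i))) (F i) (\<mu> i)" by metis
  have "(\<lambda>i. \<mu> i j) \<longlonglongrightarrow> eig j" if "j < n" for j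
  proof (rule LIM_zero_cancel, rule Lim_null_comparison)
    show "(\<lambda>i. 2 * real n * inverse (real (Suc i))) \<longlonglongrightarrow> 0"
      by (intro tendsto_mult_right_zero LIMSEQ_inverse_real_of_nat)
    show "\<forall>\<^sub>F i in sequentially. norm (\<mu> i j - eig j) \<le> 2 * real n * inverse (real (Suc i))"
    proof (intro always_eventually allI)
      fix i
      have "0 \<le> real n * inverse (real (Suc i))" by simp
      then show "norm (\<mu> i j - eig j) \<le> 2 * real n * inverse (real (Suc i))"
        using approx_number_bounds[OF ae[of i] that] unfolding real_norm_def by linarith
    qed
  qed
  with ae show ?thesis by blast
qed

lemma approx_number_bounds01: "0 \<le> eig j" "eig j \<le> 1"
  and approx_number_antimono: "i \<le> j \<Longrightarrow> eig j \<le> eig i"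
proof -
  obtain F \<mu> where ae: "\<And>i. approx_eigen (Suc j) (inverse (real (Suc i))) (F i) (\<mu> i)"
    and lim: "\<And>i. i < Suc j \<Longrightarrow> (\<lambda>l. \<mu> l i) \<longlonglongrightarrow> eig i"
    using approx_number_limit[of "Suc j"] by blast
  show "0 \<le> eig j"
    by (rule LIMSEQ_le_const[OF lim]) (use ae in \<open>auto simp: approx_eigen_def\<close>)
  show "eig j \<le> 1"
    by (rule LIMSEQ_le_const2[OF lim]) (use ae in \<open>auto simp: approx_eigen_def\<close>)
  show "eig j \<le> eig i" if "i \<le> j"
    by (rule LIMSEQ_le[OF lim lim]) (use ae that in \<open>auto simp: approx_eigen_def\<close>)
qed

text \<open>All three are limits of inequalities for systems of fixed length. For
  \<open>trace_deficit_le\<close>: the trace that the first \<open>n\<close> vectors do not capture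
  lives where \<open>L\<close> is at most \<open>eig n\<close>, and there L -
  \<open>L\<^sup>2\<close> is at least \<open>(1 - eig n)\<close> times \<open>L\<close>. For
  \<open>sum_min_le\<close>: the unit mass of each vector is split between \<open>G\<close> and its
  complement.\<close>

lemma sum_approx_number_le: "(\<Sum>j<n. eig j) \<le> measure M \<Omega>"
  and sum_min_le: "G \<in> sets M \<Longrightarrow> emeasure M G < \<infinity> \<Longrightarrow> 0 \<le> \<delta> \<Longrightarrow>
    (\<Sum>j<n. min (eig j * (1 - eig j)) \<delta>)
      \<le> \<delta> * measure M G + (LINT z|M. indicator (space M - G) z * leakage z)"
  and trace_deficit_le: "(\<Sum>j<n. eig j * (1 - eig j))
      + (1 - eig n) * (measure M \<Omega> - (\<Sum>j<n. eig j))
    \<le> (LINT z|M. leakage z)"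
proof -
  obtain F \<mu> where ae: "\<And>i. approx_eigen (Suc n) (inverse (real (Suc i))) (F i) (\<mu> i)"
    and lim: "\<And>j. j < Suc n \<Longrightarrow> (\<lambda>i. \<mu> i j) \<longlonglongrightarrow> eig j"
    using approx_number_limit[of "Suc n"] by blast
  define e where "e i = inverse (real (Suc i))" for i
  have e: "e i > 0" for i by (simp add: e_def)
  note ae = ae[folded e_def]
  have e0: "e \<longlonglongrightarrow> 0" unfolding e_def by (rule LIMSEQ_inverse_real_of_nat)
  have on: "orthonormal n (F i)" for i using ae[of i] by (auto simp: approx_eigen_def orthonormal_def)
  have \<mu>: "0 \<le> \<mu> i j" "\<mu> i j \<le> 1" "norm (L (F i j) - \<mu> i j *\<^sub>R F i j) \<le> e i" if "j < Suc n" for i j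
    using ae[of i] that by (auto simp: approx_eigen_def)
  have lim': "(\<lambda>i. \<mu> i j) \<longlonglongrightarrow> eig j" if "j \<in> {..<n}" for j
    using lim[of j] that by simp
  have form: "\<bar>rayleigh L (F i j) - \<mu> i j\<bar> \<le> e i" if "j < n" for i j
  proof -
    have "ip (L (F i j)) (F i j) - \<mu> i j = ip (L (F i j) - \<mu> i j *\<^sub>R F i j) (F i j)"
      using orthonormal_norm[OF on that, of i] by (simp add: ip_diff_left scaleR_L2_def ip_self)
    then have "cmod (ip (L (F i j)) (F i j) - \<mu> i j) \<le> e i"
      using ip_cauchy_schwarz[of "L (F i j) - \<mu> i j *\<^sub>R F i j" "F i j"] orthonormal_norm[OF on that, of i] \<mu>(3)[of j i] that
      by simp
    then show ?thesis using abs_Re_le_cmod[of "ip (L (F i j)) (F i j) - \<mu> i j"] by simp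
  qed
  have sumform: "\<bar>(\<Sum>j<n. rayleigh L (F i j)) - (\<Sum>j<n. \<mu> i j)\<bar> \<le> n * e i" for i
  proof -
    have "\<bar>\<Sum>j<n. rayleigh L (F i j) - \<mu> i j\<bar> \<le> (\<Sum>j<n. e i)"
      by (rule order_trans[OF sum_abs]) (intro sum_mono form, simp)
    then show ?thesis by (simp add: sum_subtractf)
  qed
  show "(\<Sum>j<n. eig j) \<le> measure M \<Omega>"
  proof (rule LIMSEQ_le)
    show "(\<lambda>i. \<Sum>j<n. \<mu> i j) \<longlonglongrightarrow> (\<Sum>j<n. eig j)" by (intro tendsto_sum lim')
    have "(\<lambda>i. measure M \<Omega> + n * e i) \<longlonglongrightarrow> measure M \<Omega> + real n * 0" by (intro tendsto_intros e0)
    then show "(\<lambda>i. measure M \<Omega> + n * e i) \<longlonglongrightarrow> measure M \<Omega>" by simp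
    have "(\<Sum>j<n. \<mu> i j) \<le> measure M \<Omega> + n * e i" for i
      using sumform[of i] trace_compl(2)[OF on[of i]] by linarith
    then show "\<exists>N. \<forall>i\<ge>N. (\<Sum>j<n. \<mu> i j) \<le> measure M \<Omega> + n * e i" by blast
  qed
  show "(\<Sum>j<n. eig j * (1 - eig j))
      + (1 - eig n) * (measure M \<Omega> - (\<Sum>j<n. eig j))
    \<le> (LINT z|M. leakage z)"
  proof (rule LIMSEQ_le)
    show "(\<lambda>i. (\<Sum>j<n. \<mu> i j * (1 - \<mu> i j)) + (1 - \<mu> i n) * (measure M \<Omega> - (\<Sum>j<n. \<mu> i j)))
      \<longlonglongrightarrow> (\<Sum>j<n. eig j * (1 - eig j))
      + (1 - eig n) * (measure M \<Omega> - (\<Sum>j<n. eig j))"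
      by (intro tendsto_intros lim' lim) auto
    have "(\<lambda>i. (LINT z|M. leakage z) + n * (5 * e i + (e i)\<^sup>2) + n * e i) \<longlonglongrightarrow> (LINT z|M. leakage z) + real n * (5 * 0 + 0\<^sup>2) + real n * 0"
      by (intro tendsto_intros e0)
    then show "(\<lambda>i. (LINT z|M. leakage z) + n * (5 * e i + (e i)\<^sup>2) + n * e i) \<longlonglongrightarrow> (LINT z|M. leakage z)"
      by simp
    show "\<exists>N. \<forall>i\<ge>N. (\<Sum>j<n. \<mu> i j * (1 - \<mu> i j)) + (1 - \<mu> i n) * (measure M \<Omega> - (\<Sum>j<n. \<mu> i j))
        \<le> (LINT z|M. leakage z) + n * (5 * e i + (e i)\<^sup>2) + n * e i"
    proof (intro exI[of _ 0] allI impI)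
      fix i
      let ?S = "\<Sum>j<n. rayleigh L (F i j)"
      have one: "(LINT z|M. indicator (space M) z * sqmod (ip (F i j) (k z))) = 1" if "j < n" for j
      proof -
        have "(LINT z|M. indicator (space M) z * sqmod (ip (F i j) (k z))) = (LINT z|M. sqmod (ip (F i j) (k z)))"
          by (intro Bochner_Integration.integral_cong) auto
        then show ?thesis using orthonormal_norm[OF on that, of i] by (simp add: coeff_integral)
      qed
      have two: "(LINT z|M. indicator (space M) z * f z) = (LINT z|M. f z)" for f :: "'b \<Rightarrow> real"
        by (intro Bochner_Integration.integral_cong) auto
      have "(\<Sum>j<n. \<mu> i j * (1 - \<mu> i j)) + (1 - \<mu> i n) * (measure M \<Omega> - ?S) \<le> (LINT z|M. leakage z) + n * (5 * e i + (e i)\<^sup>2)"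
        using approx_eigen_leakage[OF ae[of i] e sets.top] has_bochner_integral_integral_eq[OF trace_compl(1)[OF on[of i]]]
        unfolding two by (simp add: coeff_integral orthonormal_norm[OF on])
      moreover have "(1 - \<mu> i n) * (?S - (\<Sum>j<n. \<mu> i j)) \<le> 1 * (n * e i)"
        by (rule order_trans[OF abs_ge_self]) (unfold abs_mult, intro mult_mono sumform, use \<mu>[of n i] in auto)
      ultimately show "(\<Sum>j<n. \<mu> i j * (1 - \<mu> i j)) + (1 - \<mu> i n) * (measure M \<Omega> - (\<Sum>j<n. \<mu> i j))
        \<le> (LINT z|M. leakage z) + n * (5 * e i + (e i)\<^sup>2) + n * e i"
        by (simp add: algebra_simps)
    qed
  qed
  assume G: "G \<in> sets M" "emeasure M G < \<infinity>" and \<delta>: "0 \<le> \<delta>"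
  show "(\<Sum>j<n. min (eig j * (1 - eig j)) \<delta>)
      \<le> \<delta> * measure M G + (LINT z|M. indicator (space M - G) z * leakage z)" (is "_ \<le> _ + ?D")
  proof (rule LIMSEQ_le)
    show "(\<lambda>i. \<Sum>j<n. min (\<mu> i j * (1 - \<mu> i j)) \<delta>) \<longlonglongrightarrow> (\<Sum>j<n. min (eig j * (1 - eig j)) \<delta>)"
      by (intro tendsto_intros lim')
    have "(\<lambda>i. \<delta> * measure M G + ?D + n * (5 * e i + (e i)\<^sup>2)) \<longlonglongrightarrow> \<delta> * measure M G + ?D + real n * (5 * 0 + 0\<^sup>2)"
      by (intro tendsto_intros e0)
    then show "(\<lambda>i. \<delta> * measure M G + ?D + n * (5 * e i + (e i)\<^sup>2)) \<longlonglongrightarrow> \<delta> * measure M G + ?D"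
      by simp
    show "\<exists>N. \<forall>i\<ge>N. (\<Sum>j<n. min (\<mu> i j * (1 - \<mu> i j)) \<delta>) \<le> \<delta> * measure M G + ?D + n * (5 * e i + (e i)\<^sup>2)"
    proof (intro exI[of _ 0] allI impI)
      fix i
      let ?c = "\<lambda>j z. sqmod (ip (F i j) (k z))"
      let ?S = "space M - G"
      have S: "?S \<in> sets M" using G by auto
      have ci: "integrable M (\<lambda>z. indicator A z * ?c j z)" if "A \<in> sets M" for A j
        by (intro integrable_indicator_times that coeff_integrable)
      have split: "(LINT z|M. indicator G z * ?c j z) + (LINT z|M. indicator ?S z * ?c j z) = 1" if "j < n" for j
      proof -
        have "(LINT z|M. indicator G z * ?c j z) + (LINT z|M. indicator ?S z * ?c j z) = (LINT z|M. indicator G z * ?c j z + indicator ?S z * ?c j z)"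
          by (intro Bochner_Integration.integral_add[symmetric] ci G S)
        also have "\<dots> = (LINT z|M. ?c j z)"
          by (intro Bochner_Integration.integral_cong refl) (auto simp: indicator_def)
        finally show ?thesis using orthonormal_norm[OF on that, of i] by (simp add: coeff_integral)
      qed
      have c0: "0 \<le> (LINT z|M. indicator A z * ?c j z)" for A j
        by (intro integral_nonneg_AE AE_I2) auto
      \<comment> \<open>Bessel's inequality at each unit vector \<open>k z\<close>: orthonormal
        vectors together place at most \<open>measure M G\<close> of their mass on
        \<open>G\<close>.\<close>
      have "(\<Sum>j<n. LINT z|M. indicator G z * ?c j z) = (LINT z|M. (\<Sum>j<n. indicator G z * ?c j z))"
        by (intro Bochner_Integration.integral_sum[symmetric] ci G)
      also have "\<dots> \<le> (LINT z|M. indicator G z)"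
      proof (intro integral_mono Bochner_Integration.integrable_sum ci G)
        show "integrable M (indicat_real G)" using G by simp
        fix z
        have "(\<Sum>j<n. ?c j z) \<le> 1"
          using norm_compl_proj[OF on, of "k z" i] zero_le_power2[of "norm (compl_proj n (F i) (k z))"]
          unfolding norm_k cmod_ip_sym[of "k z"] one_power2 by linarith
        then show "(\<Sum>j<n. indicator G z * ?c j z) \<le> indicator G z"
          by (simp add: indicator_def)
      qed
      finally have bessel: "(\<Sum>j<n. LINT z|M. indicator G z * ?c j z) \<le> measure M G"
        using G by simp
      have "(\<Sum>j<n. min (\<mu> i j * (1 - \<mu> i j)) \<delta>) \<le> (\<Sum>j<n. \<delta> * (LINT z|M. indicator G z * ?c j z) + \<mu> i j * (1 - \<mu> i j) * (LINT z|M. indicator ?S z * ?c j z))"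
      proof (intro sum_mono)
        fix j assume "j \<in> {..<n}"
        then have j: "j < n" by simp
        let ?m = "min (\<mu> i j * (1 - \<mu> i j)) \<delta>"
        \<comment> \<open>On \<open>G\<close> the minimum is bounded by its cap \<delta>, off
          \<open>G\<close> by its other entry.\<close>
        have "?m = ?m * (LINT z|M. indicator G z * ?c j z) + ?m * (LINT z|M. indicator ?S z * ?c j z)"
          unfolding distrib_left[symmetric] split[OF j] by simp
        also have "\<dots> \<le> \<delta> * (LINT z|M. indicator G z * ?c j z) + \<mu> i j * (1 - \<mu> i j) * (LINT z|M. indicator ?S z * ?c j z)"
          by (intro add_mono mult_right_mono c0) auto
        finally show "?m \<le> \<delta> * (LINT z|M. indicator G z * ?c j z) + \<mu> i j * (1 - \<mu> i j) * (LINT z|M. indicator ?S z * ?c j z)" .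
      qed
      also have "\<dots> = \<delta> * (\<Sum>j<n. LINT z|M. indicator G z * ?c j z) + (\<Sum>j<n. \<mu> i j * (1 - \<mu> i j) * (LINT z|M. indicator ?S z * ?c j z))"
        by (simp add: sum.distrib sum_distrib_left)
      also have "\<dots> \<le> \<delta> * measure M G + (?D + n * (5 * e i + (e i)\<^sup>2))"
      proof (intro add_mono mult_left_mono bessel \<delta>)
        have "0 \<le> (LINT z|M. indicator ?S z * rayleigh L (compl_proj n (F i) (k z)))"
          by (intro integral_nonneg_AE AE_I2) (auto simp: nonneg)
        then have "0 \<le> (1 - \<mu> i n) * (LINT z|M. indicator ?S z * rayleigh L (compl_proj n (F i) (k z)))"
          using \<mu>[of n i] by simp
        then show "(\<Sum>j<n. \<mu> i j * (1 - \<mu> i j) * (LINT z|M. indicator ?S z * ?c j z)) \<le> ?D + n * (5 * e i + (e i)\<^sup>2)"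
          using approx_eigen_leakage[OF ae[of i] e S] by linarith
      qed
      finally show "(\<Sum>j<n. min (\<mu> i j * (1 - \<mu> i j)) \<delta>) \<le> \<delta> * measure M G + ?D + n * (5 * e i + (e i)\<^sup>2)"
        by simp
    qed
  qed
qed

end

section \<open>Gaussian integrals\<close>

abbreviation wave :: "'a::euclidean_space \<Rightarrow> 'a \<Rightarrow> complex" where
  "wave \<xi> t \<equiv> cis (2 * pi * (\<xi> \<bullet> t))"

abbreviation cowave :: "'a::euclidean_space \<Rightarrow> 'a \<Rightarrow> complex" where
  "cowave \<xi> t \<equiv> cis (- (2 * pi * (\<xi> \<bullet> t)))"

lemma borel_measurable_cis [measurable]: "cis \<in> borel_measurable borel"
  by (intro borel_measurable_continuous_onI continuous_on_cis continuous_intros)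

lemma borel_measurable_cnj [measurable]: "cnj \<in> borel_measurable borel"
  by (intro borel_measurable_continuous_onI continuous_on_cnj continuous_intros)

text \<open>A rescaled characteristic function of the standard normal law: \<open>c\<close> makes
  the normal density at \<open>c * y\<close> a multiple of the Gaussian, and \<open>t\<close> makes
  \<open>t * (c * y)\<close> the required phase.\<close>

lemma gaussian_fourier_real:
  fixes u \<epsilon> :: real
  assumes "\<epsilon> > 0"
  shows "integrable lborel (\<lambda>y. complex_of_real (exp (- pi * \<epsilon>\<^sup>2 * y\<^sup>2)) * cis (2 * pi * u * y))" (is "integrable _ ?f")
    and "(LINT y|lborel. complex_of_real (exp (- pi * \<epsilon>\<^sup>2 * y\<^sup>2)) * cis (2 * pi * u * y))
           = complex_of_real (exp (- pi * u\<^sup>2 / \<epsilon>\<^sup>2) / \<epsilon>)"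
proof -
  define c where "c = sqrt (2 * pi) * \<epsilon>"
  define t where "t = 2 * pi * u / c"
  have c: "c > 0" "c\<^sup>2 = 2 * pi * \<epsilon>\<^sup>2" using assms by (simp_all add: c_def power_mult_distrib)
  have tc: "t * (c * y) = 2 * pi * u * y" for y using c by (simp add: t_def)
  have e: "std_normal_density (c * y) = exp (- pi * \<epsilon>\<^sup>2 * y\<^sup>2) / sqrt (2 * pi)" for y
    by (simp add: std_normal_density_def power_mult_distrib c)
  let ?h = "\<lambda>x. std_normal_density x *\<^sub>R cis (t * x)"
  have "integrable lborel ?h"
    by (rule Bochner_Integration.integrable_bound[OF integrable_std_normal_moment[of 0]]) auto
  then have i: "integrable lborel (\<lambda>y. ?h (0 + c * y))"
    using c by (subst lborel_integrable_real_affine_iff) auto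
  have eq: "?h (0 + c * y) = (1 / sqrt (2 * pi)) *\<^sub>R ?f y" for y
    by (simp add: e tc scaleR_conv_of_real)
  from integrable_scaleR_right[OF i, of "sqrt (2 * pi)"] show "integrable lborel ?f"
    unfolding eq by simp
  have "exp (- (t\<^sup>2) / 2) = (LINT x|lborel. ?h x)"
    unfolding fun_cong[OF char_std_normal_distribution, symmetric] char_def
    by (subst integral_density) (auto simp: cis_conv_exp mult_ac)
  also have "\<dots> = c *\<^sub>R (LINT y|lborel. ?h (0 + c * y))"
    using lborel_integral_real_affine[of c ?h 0] c by simp
  also have "\<dots> = (c / sqrt (2 * pi)) *\<^sub>R (LINT y|lborel. ?f y)"
    unfolding eq by simp
  also have "c / sqrt (2 * pi) = \<epsilon>" by (simp add: c_def)
  finally have "\<epsilon> *\<^sub>R (LINT y|lborel. ?f y) = complex_of_real (exp (- (t\<^sup>2) / 2))" by simp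
  moreover have "t\<^sup>2 / 2 = pi * u\<^sup>2 / \<epsilon>\<^sup>2"
    using assms by (simp add: t_def power_divide c power_mult_distrib field_simps power2_eq_square[of pi])
  ultimately show "(LINT y|lborel. ?f y) = complex_of_real (exp (- pi * u\<^sup>2 / \<epsilon>\<^sup>2) / \<epsilon>)"
    using assms by (simp add: scaleR_conv_of_real field_simps)
qed

lemma lborel_integral_prod_Basis:
  fixes h :: "'a::euclidean_space \<Rightarrow> real \<Rightarrow> complex"
  assumes "\<And>b. b \<in> Basis \<Longrightarrow> integrable lborel (h b)"
  shows "integrable lborel (\<lambda>x. \<Prod>b\<in>Basis. h b (x \<bullet> b))"
    and "(LINT x|lborel. (\<Prod>b\<in>Basis. h b (x \<bullet> b))) = (\<Prod>b\<in>Basis. (LINT y|lborel. h b y))"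
proof -
  interpret product_sigma_finite "\<lambda>_::'a. lborel :: real measure" ..
  have [measurable]: "(\<lambda>f. \<Sum>b\<in>Basis. f b *\<^sub>R b) \<in> (\<Pi>\<^sub>M b\<in>(Basis::'a set). (lborel :: real measure)) \<rightarrow>\<^sub>M (borel :: 'a measure)"
    by measurable
  have [measurable]: "(\<lambda>x. \<Prod>b\<in>Basis. h b (x \<bullet> b)) \<in> borel_measurable (borel :: 'a measure)"
    using assms[THEN borel_measurable_integrable] by (intro borel_measurable_prod) simp
  have eq: "(\<Prod>b\<in>Basis. h b ((\<Sum>b\<in>Basis. f b *\<^sub>R b) \<bullet> b)) = (\<Prod>b\<in>Basis. h b (f b))" for f :: "'a \<Rightarrow> real"
    by (intro prod.cong refl) (simp add: inner_sum_left inner_Basis if_distrib sum.delta cong: if_cong)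
  show "integrable lborel (\<lambda>x. \<Prod>b\<in>Basis. h b (x \<bullet> b))"
    by (subst lborel_eq, subst integrable_distr_eq) (auto simp: eq intro!: product_integrable_prod assms)
  show "(LINT x|lborel. (\<Prod>b\<in>Basis. h b (x \<bullet> b))) = (\<Prod>b\<in>Basis. (LINT y|lborel. h b y))"
    by (subst lborel_eq, subst integral_distr) (auto simp: eq intro!: product_integral_prod assms)
qed

lemma gaussian_fourier:
  fixes u :: "'a::euclidean_space"
  assumes "\<epsilon> > 0"
  shows "integrable lborel (\<lambda>\<xi>. complex_of_real (exp (- pi * \<epsilon>\<^sup>2 * (norm \<xi>)\<^sup>2)) * wave \<xi> u)" (is "integrable _ ?f")
    and "(LINT \<xi>|lborel. complex_of_real (exp (- pi * \<epsilon>\<^sup>2 * (norm \<xi>)\<^sup>2)) * wave \<xi> u)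
           = complex_of_real (exp (- pi * (norm u)\<^sup>2 / \<epsilon>\<^sup>2) / \<epsilon> ^ DIM('a))"
proof -
  let ?h = "\<lambda>b y. complex_of_real (exp (- pi * \<epsilon>\<^sup>2 * y\<^sup>2)) * cis (2 * pi * (u \<bullet> b) * y)"
  have n: "(norm \<xi>)\<^sup>2 = (\<Sum>b\<in>Basis. (\<xi> \<bullet> b)\<^sup>2)" for \<xi> :: 'a
    unfolding power2_norm_eq_inner by (subst euclidean_inner) (simp add: power2_eq_square)
  have cis_sum: "cis (sum g I) = (\<Prod>i\<in>I. cis (g i))" for g :: "'a \<Rightarrow> real" and I
    by (induction I rule: infinite_finite_induct) (auto simp flip: cis_mult)
  have eq: "?f = (\<lambda>\<xi>. \<Prod>b\<in>Basis. ?h b (\<xi> \<bullet> b))"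
    by (rule ext) (simp add: n sum_distrib_left exp_sum prod.distrib of_real_prod euclidean_inner[of _ u] cis_sum
        sum_negf[symmetric] mult_ac del: of_real_exp)
  show "integrable lborel ?f"
    unfolding eq by (intro lborel_integral_prod_Basis gaussian_fourier_real assms)
  have "(LINT \<xi>|lborel. ?f \<xi>) = (\<Prod>b\<in>Basis. complex_of_real (exp (- pi * (u \<bullet> b)\<^sup>2 / \<epsilon>\<^sup>2) / \<epsilon>))"
    unfolding eq lborel_integral_prod_Basis(2)[of ?h, OF gaussian_fourier_real(1)[OF assms]] gaussian_fourier_real(2)[OF assms] ..
  also have "\<dots> = complex_of_real (exp (- pi * (norm u)\<^sup>2 / \<epsilon>\<^sup>2) / \<epsilon> ^ DIM('a))"
    by (simp add: n sum_distrib_left sum_divide_distrib exp_sum prod_dividef sum_negf[symmetric] flip: of_real_prod of_real_exp)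
  finally show "(LINT \<xi>|lborel. ?f \<xi>) = complex_of_real (exp (- pi * (norm u)\<^sup>2 / \<epsilon>\<^sup>2) / \<epsilon> ^ DIM('a))" .
qed

section \<open>Time-frequency shifts\<close>

lemma ae_equal_rep_abs: "square_integrable h \<Longrightarrow> ae_equal (rep_L2 (abs_L2 h)) h"
  using Quotient3_rep_abs[OF Quotient3_L2, of h] by (simp add: ae_equal_def)

lemma rep_abs_L2: "square_integrable h \<Longrightarrow> AE t in lborel. rep_L2 (abs_L2 h) t = h t"
  using ae_equal_rep_abs[of h] by (simp add: ae_equal_def)

lemma square_integrable_measurable: "square_integrable h \<Longrightarrow> h \<in> borel_measurable borel"
  by (simp add: square_integrable_def)

lemma ip_abs_left:
  assumes "square_integrable h"
  shows "ip (abs_L2 h) f = (LINT t|lborel. h t * cnj (rep_L2 f t))"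
  unfolding ip_rep
proof (rule integral_cong_AE)
  note [measurable] = square_integrable_measurable[OF assms]
  show "(\<lambda>x. rep_L2 (abs_L2 h) x * cnj (rep_L2 f x)) \<in> borel_measurable lborel" by measurable
  show "(\<lambda>x. h x * cnj (rep_L2 f x)) \<in> borel_measurable lborel" by measurable
  show "AE x in lborel. rep_L2 (abs_L2 h) x * cnj (rep_L2 f x) = h x * cnj (rep_L2 f x)"
    using rep_abs_L2[OF assms] by eventually_elim simp
qed

lemma ip_abs_right:
  assumes "square_integrable h"
  shows "ip f (abs_L2 h) = (LINT t|lborel. rep_L2 f t * cnj (h t))"
  unfolding ip_rep
proof (rule integral_cong_AE)
  note [measurable] = square_integrable_measurable[OF assms]
  show "(\<lambda>x. rep_L2 f x * cnj (rep_L2 (abs_L2 h) x)) \<in> borel_measurable lborel" by measurable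
  show "(\<lambda>x. rep_L2 f x * cnj (h x)) \<in> borel_measurable lborel" by measurable
  show "AE x in lborel. rep_L2 f x * cnj (rep_L2 (abs_L2 h) x) = rep_L2 f x * cnj (h x)"
    using rep_abs_L2[OF assms] by eventually_elim simp
qed

lemma ip_abs:
  assumes "square_integrable h" "square_integrable k"
  shows "ip (abs_L2 h) (abs_L2 k) = (LINT t|lborel. h t * cnj (k t))"
  unfolding ip_abs_left[OF assms(1)]
proof (rule integral_cong_AE)
  note [measurable] = assms[THEN square_integrable_measurable]
  show "(\<lambda>x. h x * cnj (rep_L2 (abs_L2 k) x)) \<in> borel_measurable lborel" by measurable
  show "(\<lambda>x. h x * cnj (k x)) \<in> borel_measurable lborel" by measurable
  show "AE x in lborel. h x * cnj (rep_L2 (abs_L2 k) x) = h x * cnj (k x)"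
    using rep_abs_L2[OF assms(2)] by eventually_elim simp
qed

lemma norm_L2_sq: "(norm f)\<^sup>2 = (LINT t|lborel. sqmod (rep_L2 f t))"
proof -
  have "complex_of_real ((norm f)\<^sup>2) = (LINT t|lborel. complex_of_real (sqmod (rep_L2 f t)))"
    unfolding ip_self[symmetric] ip_rep by (simp only: complex_norm_square)
  then show ?thesis by (simp only: integral_complex_of_real of_real_eq_iff)
qed

lemma norm_L2_sq_nn: "ennreal ((norm f)\<^sup>2) = (\<integral>\<^sup>+t. ennreal (sqmod (rep_L2 f t)) \<partial>lborel)"
  unfolding norm_L2_sq using rep_L2_square_integrable[of f]
  by (intro nn_integral_eq_integral[symmetric]) (auto simp: square_integrable_def)

lemma norm_abs_L2_sq: 
  assumes "square_integrable h"
  shows "ennreal ((norm (abs_L2 h))\<^sup>2) = (\<integral>\<^sup>+t. ennreal (sqmod (h t)) \<partial>lborel)"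
proof -
  have "AE t in lborel. ennreal (sqmod (rep_L2 (abs_L2 h) t)) = ennreal (sqmod (h t))"
    using rep_abs_L2[OF assms] by eventually_elim simp
  then show ?thesis unfolding norm_L2_sq_nn by (rule nn_integral_cong_AE)
qed

lemma lborel_distr_shift: "distr lborel borel (\<lambda>t. t - x) = (lborel :: 'a::euclidean_space measure)"
proof -
  have "(\<lambda>t. t - x) = (+) (- x)" by (auto simp: fun_eq_iff)
  then show ?thesis by (simp add: lborel_distr_plus)
qed

lemma lborel_integral_shift:
  fixes h :: "'a::euclidean_space \<Rightarrow> complex"
  assumes [measurable]: "h \<in> borel_measurable borel"
  shows "(LINT t|lborel. h (t - x)) = (LINT t|lborel. h t)"
  by (subst (2) lborel_distr_shift[of x, symmetric], subst integral_distr) auto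

lemma lborel_integrable_shift:
  fixes h :: "'a::euclidean_space \<Rightarrow> 'b::{banach,second_countable_topology}"
  assumes "integrable lborel h"
  shows "integrable lborel (\<lambda>t. h (t - x))"
  by (rule integrable_distr[of "\<lambda>t. t - x" lborel borel]) (use assms in \<open>auto simp: lborel_distr_shift\<close>)

text \<open>Translation comes first and modulation second; in this order
  \<open>ip f (tf_shift z g)\<close> is \<open>stft g f z\<close> without a phase factor.\<close>

definition tf_shift :: "'a::euclidean_space \<times> 'a \<Rightarrow> 'a L2 \<Rightarrow> 'a L2" where
  "tf_shift z f = abs_L2 (\<lambda>t. rep_L2 f (t - fst z) * wave (snd z) t)"

lemma square_integrable_tf_shift:
  "square_integrable (\<lambda>t. rep_L2 f (t - fst z) * wave (snd z) t)"
  using lborel_integrable_shift[of "\<lambda>t. sqmod (rep_L2 f t)" "fst z"] rep_L2_square_integrable[of f]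
  by (auto simp: square_integrable_def norm_mult)

lemma ip_tf_shift: "ip f (tf_shift z g) = stft g f z"
  unfolding tf_shift_def ip_abs_right[OF square_integrable_tf_shift]
  by (simp add: stft_def case_prod_unfold cis_cnj mult_ac)

lemma ip_tf_shift_same: "ip (tf_shift z f) (tf_shift z h) = ip f h"
proof -
  have "ip (tf_shift z f) (tf_shift z h) = (LINT t|lborel. rep_L2 f (t - fst z) * cnj (rep_L2 h (t - fst z)))"
    unfolding tf_shift_def ip_abs[OF square_integrable_tf_shift square_integrable_tf_shift]
    by (intro Bochner_Integration.integral_cong) (auto simp: cis_cnj cis_mult)
  also have "\<dots> = ip f h"
    unfolding ip_rep by (rule lborel_integral_shift[of "\<lambda>t. rep_L2 f t * cnj (rep_L2 h t)"]) simp
  finally show ?thesis .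
qed

lemma norm_tf_shift [simp]: "norm (tf_shift z f) = norm f"
proof -
  have "(norm (tf_shift z f))\<^sup>2 = (norm f)\<^sup>2" unfolding Re_ip_self[symmetric] ip_tf_shift_same ..
  then show ?thesis by (simp add: power2_eq_iff_nonneg)
qed

text \<open>Shifts preserve inner products, so the squared norm of the defect expands to 0 and no
  representatives have to be compared.\<close>

lemma tf_shift_add: "tf_shift z (f + h) = tf_shift z f + tf_shift z h"
proof -
  have "ip (tf_shift z (f + h) - (tf_shift z f + tf_shift z h)) (tf_shift z (f + h) - (tf_shift z f + tf_shift z h)) = 0"
    by (simp add: ip_diff_left ip_diff_right ip_add_left ip_add_right ip_tf_shift_same)
  then show ?thesis by (simp add: ip_self)
qed

lemma tf_shift_scale: "tf_shift z (scaleL2 c f) = scaleL2 c (tf_shift z f)"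
proof -
  have "ip (tf_shift z (scaleL2 c f) - scaleL2 c (tf_shift z f)) (tf_shift z (scaleL2 c f) - scaleL2 c (tf_shift z f)) = 0"
    by (simp add: ip_diff_left ip_diff_right ip_tf_shift_same algebra_simps)
  then show ?thesis by (simp add: ip_self)
qed

text \<open>Covariance: up to a unimodular phase the frame kernel depends only on
  \<open>w - z\<close>, so the transport of mass can be described by displacements.\<close>

lemma ip_tf_shift_tf_shift:
  "ip (tf_shift z g) (tf_shift w g) = wave (snd z - snd w) (fst z) * stft g g (w - z)"
proof -
  let ?h = "\<lambda>t. rep_L2 g t * cnj (rep_L2 g (t - (fst w - fst z))) * cowave (snd w - snd z) t"
  have "ip (tf_shift z g) (tf_shift w g) = (LINT t|lborel. wave (snd z - snd w) (fst z) * ?h (t - fst z))"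
    unfolding tf_shift_def ip_abs[OF square_integrable_tf_shift square_integrable_tf_shift]
  proof (intro Bochner_Integration.integral_cong refl)
    fix t
    have "t - fst z - (fst w - fst z) = t - fst w" by simp
    moreover have "wave (snd z) t * cowave (snd w) t =
       wave (snd z - snd w) (fst z) * cowave (snd w - snd z) (t - fst z)"
      unfolding cis_mult by (rule arg_cong[of _ _ cis]) (simp add: algebra_simps)
    ultimately show "rep_L2 g (t - fst z) * wave (snd z) t * cnj (rep_L2 g (t - fst w) * wave (snd w) t)
      = wave (snd z - snd w) (fst z) * ?h (t - fst z)"
      by (simp add: cis_cnj)
  qed
  also have "\<dots> = wave (snd z - snd w) (fst z) * (LINT t|lborel. ?h (t - fst z))"
    by (rule integral_mult_right_zero)
  also have "(LINT t|lborel. ?h (t - fst z)) = (LINT t|lborel. ?h t)"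
    by (rule lborel_integral_shift) measurable
  finally show ?thesis by (simp add: stft_def case_prod_unfold)
qed

section \<open>Continuity of translations\<close>

lemma square_integrable_diff:
  assumes "square_integrable h" "square_integrable k"
  shows "square_integrable (\<lambda>t. h t - k t)"
  using square_integrable_add[OF assms(1) square_integrable_cmult[OF assms(2), of "- 1"]] by simp

lemma integrable_mult_cnj_rep:
  "square_integrable h \<Longrightarrow> integrable lborel (\<lambda>t. h t * cnj (rep_L2 f t))"
  by (intro square_integrable_mult square_integrable_cnj rep_L2_square_integrable)

lemma abs_L2_diff:
  assumes "square_integrable h" "square_integrable k"
  shows "abs_L2 (\<lambda>t. h t - k t) = abs_L2 h - abs_L2 k"
proof (rule ip_eqI)
  fix f
  show "ip (abs_L2 (\<lambda>t. h t - k t)) f = ip (abs_L2 h - abs_L2 k) f"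
    using assms by (simp add: ip_diff_left ip_abs_left square_integrable_diff left_diff_distrib integrable_mult_cnj_rep)
qed

lemma abs_rep_L2: "abs_L2 (rep_L2 f) = f"
  by (rule Quotient3_abs_rep[OF Quotient3_L2])

lemma square_integrable_indicator:
  assumes "E \<in> sets borel" "emeasure lborel E < \<infinity>"
  shows "square_integrable (\<lambda>t. indicator E t :: complex)"
proof -
  have "(\<lambda>t. sqmod (indicator E t)) = indicat_real E" by (auto simp: indicator_def)
  then show ?thesis using assms by (auto simp: square_integrable_def)
qed

definition translation_continuous :: "'a::euclidean_space L2 \<Rightarrow> bool" where
  "translation_continuous f \<longleftrightarrow>
     (\<forall>u. u \<longlonglongrightarrow> 0 \<longrightarrow> (\<lambda>n. norm (tf_shift (u n, 0) f - f)) \<longlonglongrightarrow> 0)"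

lemma translation_continuous_add:
  assumes "translation_continuous f" "translation_continuous h"
  shows "translation_continuous (f + h)"
  unfolding translation_continuous_def
proof (intro allI impI)
  fix u :: "nat \<Rightarrow> 'a" assume u: "u \<longlonglongrightarrow> 0"
  show "(\<lambda>n. norm (tf_shift (u n, 0) (f + h) - (f + h))) \<longlonglongrightarrow> 0"
  proof (rule Lim_null_comparison)
    show "(\<lambda>n. norm (tf_shift (u n, 0) f - f) + norm (tf_shift (u n, 0) h - h)) \<longlonglongrightarrow> 0"
      by (intro tendsto_add_zero) (use assms u translation_continuous_def in blast)+
    have "norm (norm (tf_shift (u n, 0) (f + h) - (f + h)))
        \<le> norm (tf_shift (u n, 0) f - f) + norm (tf_shift (u n, 0) h - h)" for n
      using norm_triangle_ineq[of "tf_shift (u n, 0) f - f" "tf_shift (u n, 0) h - h"]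
      by (simp only: tf_shift_add add_diff_add real_norm_def abs_norm_cancel)
    then show "\<forall>\<^sub>F n in sequentially. norm (norm (tf_shift (u n, 0) (f + h) - (f + h)))
        \<le> norm (tf_shift (u n, 0) f - f) + norm (tf_shift (u n, 0) h - h)"
      by (rule always_eventually[OF allI])
  qed
qed

lemma translation_continuous_scale:
  assumes "translation_continuous f"
  shows "translation_continuous (scaleL2 c f)"
  unfolding translation_continuous_def
proof (intro allI impI)
  fix u :: "nat \<Rightarrow> 'a" assume u: "u \<longlonglongrightarrow> 0"
  have "(\<lambda>n. cmod c * norm (tf_shift (u n, 0) f - f)) \<longlonglongrightarrow> cmod c * 0"
    using assms u unfolding translation_continuous_def by (intro tendsto_mult tendsto_const) auto
  then show "(\<lambda>n. norm (tf_shift (u n, 0) (scaleL2 c f) - scaleL2 c f)) \<longlonglongrightarrow> 0"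
    by (simp add: tf_shift_scale flip: L2.scale_right_diff_distrib)
qed

lemma translation_continuous_sum:
  fixes F :: "'i \<Rightarrow> 'a::euclidean_space L2"
  assumes "\<And>i. i \<in> I \<Longrightarrow> translation_continuous (F i)"
  shows "translation_continuous (sum F I)"
proof -
  have "translation_continuous (0 :: 'a L2)"
    using tf_shift_scale[of _ 0 "0 :: 'a L2"] by (simp add: translation_continuous_def)
  then show ?thesis using assms
    by (induction I rule: infinite_finite_induct) (auto intro: translation_continuous_add)
qed

text \<open>Shifts are isometries, so the property passes to norm limits by splitting the error into
  three parts.\<close>

lemma translation_continuous_approx:
  assumes "\<And>e. e > 0 \<Longrightarrow> \<exists>h. translation_continuous h \<and> norm (f - h) < e"
  shows "translation_continuous f"
  unfolding translation_continuous_def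
proof (intro allI impI LIMSEQ_I)
  fix u :: "nat \<Rightarrow> 'a" and r :: real assume u: "u \<longlonglongrightarrow> 0" and "r > 0"
  then obtain h where h: "translation_continuous h" "norm (f - h) < r / 3"
    using assms[of "r / 3"] by auto
  then obtain N where N: "\<And>n. n \<ge> N \<Longrightarrow> norm (tf_shift (u n, 0) h - h) < r / 3"
    using u \<open>r > 0\<close> LIMSEQ_D[of "\<lambda>n. norm (tf_shift (u n, 0) h - h)" 0 "r / 3"]
    unfolding translation_continuous_def by auto
  have "norm (tf_shift (u n, 0) f - f) < r" if "n \<ge> N" for n
  proof -
    have "tf_shift (u n, 0) f = tf_shift (u n, 0) (f - h) + tf_shift (u n, 0) h"
      by (simp flip: tf_shift_add)
    then have "tf_shift (u n, 0) f - f = tf_shift (u n, 0) (f - h) + (tf_shift (u n, 0) h - h) + - (f - h)"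
      by simp
    also have "norm \<dots> \<le> norm (f - h) + norm (tf_shift (u n, 0) h - h) + norm (f - h)"
      using norm_triangle_ineq[of "tf_shift (u n, 0) (f - h) + (tf_shift (u n, 0) h - h)" "- (f - h)"]
        norm_triangle_ineq[of "tf_shift (u n, 0) (f - h)" "tf_shift (u n, 0) h - h"]
      unfolding norm_minus_cancel norm_tf_shift by linarith
    finally show ?thesis using N[OF that] h(2) by simp
  qed
  then show "\<exists>no. \<forall>n\<ge>no. norm (norm (tf_shift (u n, 0) f - f) - 0) < r" by auto
qed

text \<open>Only points \<open>t\<close> of \<open>U\<close> contribute to the inner product of the
  shifted and the unshifted indicator, and for these openness puts \<open>t - u n\<close> into
  \<open>U\<close> eventually. Convergence of these inner products gives convergence in norm,
  because a shift keeps the norm.\<close>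

lemma translation_continuous_open:
  fixes U :: "'a::euclidean_space set"
  assumes U: "open U" and fin: "emeasure lborel U < \<infinity>"
  shows "translation_continuous (abs_L2 (indicator U))"
  unfolding translation_continuous_def
proof (intro allI impI)
  fix u :: "nat \<Rightarrow> 'a" assume u: "u \<longlonglongrightarrow> 0"
  have [measurable]: "U \<in> sets borel" using U by simp
  have sq: "square_integrable (indicator U :: 'a \<Rightarrow> complex)"
    by (rule square_integrable_indicator) (use fin in auto)
  define f where "f = abs_L2 (indicator U :: 'a \<Rightarrow> complex)"
  have rf: "AE t in lborel. rep_L2 f t = indicator U t" unfolding f_def by (rule rep_abs_L2[OF sq])
  have ip_eq: "ip (tf_shift (u n, 0) f) f = (LINT t|lborel. indicator U (t - u n) * indicator U t)" for n
  proof -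
    have "AE t in lborel. rep_L2 f (t - u n) = indicator U (t - u n)"
    proof (rule AE_distrD[where M = lborel and M' = borel and f = "\<lambda>t. t - u n"])
      show "AE t in distr lborel borel (\<lambda>t. t - u n). rep_L2 f t = indicator U t"
        unfolding lborel_distr_shift by (rule rf)
    qed simp
    with rf have "AE t in lborel. rep_L2 f (t - u n) * cnj (rep_L2 f t) = indicator U (t - u n) * indicator U t"
      by eventually_elim (auto simp: indicator_def)
    then show ?thesis
      unfolding tf_shift_def ip_abs_left[OF square_integrable_tf_shift]
      by (intro integral_cong_AE) auto
  qed
  have "(\<lambda>n. LINT t|lborel. indicator U (t - u n) * indicator U t :: complex) \<longlonglongrightarrow> (LINT t|lborel. indicator U t)"
  proof (rule integral_dominated_convergence[where w = "indicator U"])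
    show "integrable lborel (indicat_real U)" using fin by simp
    show "AE t in lborel. (\<lambda>n. indicator U (t - u n) * indicator U t :: complex) \<longlonglongrightarrow> indicator U t"
    proof (rule AE_I2)
      fix t
      have "(\<lambda>n. t - u n) \<longlonglongrightarrow> t - 0" by (intro tendsto_intros u)
      then have "\<forall>\<^sub>F n in sequentially. t \<in> U \<longrightarrow> t - u n \<in> U"
        using topological_tendstoD[OF _ U, of "\<lambda>n. t - u n" t] by (cases "t \<in> U") auto
      then have "\<forall>\<^sub>F n in sequentially. indicator U (t - u n) * indicator U t = (indicator U t :: complex)"
        by eventually_elim (auto simp: indicator_def)
      then show "(\<lambda>n. indicator U (t - u n) * indicator U t :: complex) \<longlonglongrightarrow> indicator U t"
        by (rule tendsto_eventually)
    qed
    show "AE t in lborel. norm (indicator U (t - u n) * indicator U t :: complex) \<le> indicator U t" for n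
      by (auto simp: indicator_def)
  qed auto
  moreover have "(LINT t|lborel. indicator U t) = ip f f"
    unfolding f_def ip_abs[OF sq sq] by (intro Bochner_Integration.integral_cong) (auto simp: indicator_def)
  ultimately have "(\<lambda>n. ip (tf_shift (u n, 0) f) f) \<longlonglongrightarrow> ip f f"
    unfolding ip_eq by simp
  then have "(\<lambda>n. (norm f)\<^sup>2 - 2 * Re (ip (tf_shift (u n, 0) f) f) + (norm f)\<^sup>2) \<longlonglongrightarrow> (norm f)\<^sup>2 - 2 * Re (ip f f) + (norm f)\<^sup>2"
    by (intro tendsto_intros)
  moreover have "(norm (tf_shift (u n, 0) f - f))\<^sup>2 = (norm f)\<^sup>2 - 2 * Re (ip (tf_shift (u n, 0) f) f) + (norm f)\<^sup>2" for n
    using norm_add_sq[of "tf_shift (u n, 0) f" "- f"] by simp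
  ultimately have "(\<lambda>n. (norm (tf_shift (u n, 0) f - f))\<^sup>2) \<longlonglongrightarrow> 0"
    by (simp add: Re_ip_self)
  from tendsto_real_sqrt[OF this] show "(\<lambda>n. norm (tf_shift (u n, 0) (abs_L2 (indicator U)) - abs_L2 (indicator U))) \<longlonglongrightarrow> 0"
    by (simp add: f_def)
qed

lemma translation_continuous_indicator:
  fixes E :: "'a::euclidean_space set"
  assumes E: "E \<in> sets borel" and fin: "emeasure lborel E < \<infinity>"
  shows "translation_continuous (abs_L2 (indicator E))"
proof (rule translation_continuous_approx)
  fix e :: real assume "e > 0"
  obtain U where U: "open U" "E \<subseteq> U" "emeasure lborel (U - E) < ennreal (e\<^sup>2)"
    using outer_regular_lborel[OF E, of "e\<^sup>2"] \<open>e > 0\<close> by auto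
  have [measurable]: "U \<in> sets borel" "E \<in> sets borel" using U E by auto
  have "emeasure lborel U \<le> emeasure lborel E + emeasure lborel (U - E)"
    using emeasure_subadditive[of E lborel "U - E"] U(2) by (simp add: Un_absorb1)
  also have "\<dots> < \<infinity>" using fin order_less_trans[OF U(3) ennreal_less_top] by simp
  finally have finU: "emeasure lborel U < \<infinity>" .
  have sq: "square_integrable (indicator U :: 'a \<Rightarrow> complex)" "square_integrable (indicator E :: 'a \<Rightarrow> complex)"
    by (intro square_integrable_indicator; use finU fin in simp)+
  have "ennreal ((norm (abs_L2 (indicator E) - abs_L2 (indicator U :: 'a \<Rightarrow> complex)))\<^sup>2) = emeasure lborel (U - E)"
  proof -
    have "ennreal (sqmod (indicator E t - indicator U t)) = indicator (U - E) t" for t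
      using U(2) by (auto simp: indicator_def)
    then show ?thesis
      unfolding abs_L2_diff[OF sq(2,1), symmetric] norm_abs_L2_sq[OF square_integrable_diff[OF sq(2,1)]] by simp
  qed
  then have "ennreal ((norm (abs_L2 (indicator E) - abs_L2 (indicator U :: 'a \<Rightarrow> complex)))\<^sup>2) < ennreal (e\<^sup>2)"
    using U(3) by simp
  then have "norm (abs_L2 (indicator E) - abs_L2 (indicator U :: 'a \<Rightarrow> complex)) < e"
    using \<open>e > 0\<close> by (subst (asm) ennreal_less_iff) (auto intro: power_less_imp_less_base)
  with translation_continuous_open[OF U(1) finU]
  show "\<exists>h. translation_continuous h \<and> norm (abs_L2 (indicator E) - h) < e" by blast
qed

lemma translation_continuous_simple:
  fixes s :: "'a::euclidean_space \<Rightarrow> complex"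
  assumes s: "simple_function lborel s" and sq: "square_integrable s"
  shows "translation_continuous (abs_L2 s)"
proof -
  have fin: "finite (range s)" using simple_functionD(1)[OF s] by simp
  define Y where "Y = range s - {0}"
  have "finite Y" using fin by (simp add: Y_def)
  have E: "s -` {y} \<in> sets borel" for y using simple_functionD(2)[OF s, of "{y}"] by simp
  have finE: "emeasure lborel (s -` {y}) < \<infinity>" if "y \<in> Y" for y
  proof -
    have "y \<noteq> 0" using that by (simp add: Y_def)
    have "integrable lborel (indicat_real (s -` {y}))"
    proof (rule Bochner_Integration.integrable_bound)
      show "integrable lborel (\<lambda>x. sqmod (s x) / sqmod y)" using sq by (simp add: square_integrable_def)
      show "AE x in lborel. norm (indicat_real (s -` {y}) x) \<le> norm (sqmod (s x) / sqmod y)"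
        using \<open>y \<noteq> 0\<close> by (auto simp: indicator_def)
    qed (use E in simp)
    then show ?thesis using E by (simp add: integrable_indicator_iff)
  qed
  have sqE: "square_integrable (indicator (s -` {y}) :: 'a \<Rightarrow> complex)" if "y \<in> Y" for y
    using square_integrable_indicator[OF E finE[OF that]] .
  have s_eq: "s t = (\<Sum>y\<in>Y. y * indicator (s -` {y}) t)" for t
  proof -
    have "(\<Sum>y\<in>Y. y * indicator (s -` {y}) t) = (\<Sum>y\<in>Y. if y = s t then y else 0)"
      by (intro sum.cong) (auto simp: indicator_def)
    then show ?thesis using \<open>finite Y\<close> by (auto simp: Y_def)
  qed
  have "abs_L2 s = (\<Sum>y\<in>Y. scaleL2 y (abs_L2 (indicator (s -` {y}))))"
  proof (rule ip_eqI)
    fix f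
    have "ip (abs_L2 s) f = (LINT t|lborel. (\<Sum>y\<in>Y. y * (indicator (s -` {y}) t * cnj (rep_L2 f t))))"
      unfolding ip_abs_left[OF sq] by (intro Bochner_Integration.integral_cong refl, subst s_eq)
        (simp add: sum_distrib_right mult.assoc)
    also have "\<dots> = (\<Sum>y\<in>Y. y * (LINT t|lborel. indicator (s -` {y}) t * cnj (rep_L2 f t)))"
      using integrable_mult_cnj_rep[OF sqE]
      by (subst Bochner_Integration.integral_sum) auto
    also have "\<dots> = ip (\<Sum>y\<in>Y. scaleL2 y (abs_L2 (indicator (s -` {y})))) f"
      by (simp add: ip_sum_left ip_abs_left[OF sqE])
    finally show "ip (abs_L2 s) f = ip (\<Sum>y\<in>Y. scaleL2 y (abs_L2 (indicator (s -` {y})))) f" .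
  qed
  then show ?thesis
    using E finE by (auto intro!: translation_continuous_sum translation_continuous_scale translation_continuous_indicator)
qed

theorem translation_continuous_L2: "translation_continuous f"
proof (rule translation_continuous_approx)
  fix e :: real assume "e > 0"
  note sqf = rep_L2_square_integrable[of f]
  obtain s where s: "\<And>i. simple_function lborel (s i)" "\<And>t. (\<lambda>i. s i t) \<longlonglongrightarrow> rep_L2 f t"
    "\<And>i t. cmod (s i t) \<le> 2 * cmod (rep_L2 f t)"
    using borel_measurable_implies_sequence_metric[of "rep_L2 f" lborel 0] by (auto simp: dist_norm)
  have sm [measurable]: "s i \<in> borel_measurable borel" for i
    using borel_measurable_simple_function[OF s(1)] by simp
  have sqs: "square_integrable (s i)" for i
    unfolding square_integrable_def
  proof
    show "integrable lborel (\<lambda>x. sqmod (s i x))"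
    proof (rule Bochner_Integration.integrable_bound)
      show "integrable lborel (\<lambda>x. 4 * sqmod (rep_L2 f x))" using sqf by (simp add: square_integrable_def)
      show "AE x in lborel. norm (sqmod (s i x)) \<le> norm (4 * sqmod (rep_L2 f x))"
        using power_mono[OF s(3), of _ _ 2] by (auto simp: power_mult_distrib)
    qed simp
  qed simp
  have "(\<lambda>i. \<integral>\<^sup>+t. ennreal (sqmod (rep_L2 f t - s i t)) \<partial>lborel) \<longlonglongrightarrow> (\<integral>\<^sup>+t. 0 \<partial>(lborel :: 'a measure))"
  proof (rule nn_integral_dominated_convergence[where w = "\<lambda>t. ennreal (9 * sqmod (rep_L2 f t))"])
    show "AE t in lborel. ennreal (sqmod (rep_L2 f t - s i t)) \<le> ennreal (9 * sqmod (rep_L2 f t))" for i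
    proof (rule AE_I2)
      fix t
      have "cmod (rep_L2 f t - s i t) \<le> 3 * cmod (rep_L2 f t)"
        using norm_triangle_ineq4[of "rep_L2 f t" "s i t"] s(3)[of i t] by simp
      from power_mono[OF this, of 2] show "ennreal (sqmod (rep_L2 f t - s i t)) \<le> ennreal (9 * sqmod (rep_L2 f t))"
        by (simp add: power_mult_distrib ennreal_leI)
    qed
    show "(\<integral>\<^sup>+t. ennreal (9 * sqmod (rep_L2 f t)) \<partial>lborel) < \<infinity>"
      using sqf by (subst nn_integral_eq_integral) (auto simp: square_integrable_def)
    show "AE t in lborel. (\<lambda>i. ennreal (sqmod (rep_L2 f t - s i t))) \<longlonglongrightarrow> 0"
    proof (rule AE_I2)
      fix t
      have "(\<lambda>i. sqmod (rep_L2 f t - s i t)) \<longlonglongrightarrow> sqmod (rep_L2 f t - rep_L2 f t)"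
        by (intro tendsto_intros s(2))
      then show "(\<lambda>i. ennreal (sqmod (rep_L2 f t - s i t))) \<longlonglongrightarrow> 0"
        by (intro tendsto_ennrealI[of _ 0, simplified]) simp
    qed
  qed auto
  then have "\<forall>\<^sub>F i in sequentially. (\<integral>\<^sup>+t. ennreal (sqmod (rep_L2 f t - s i t)) \<partial>lborel) < ennreal (e\<^sup>2)"
    by (rule order_tendstoD) (use \<open>e > 0\<close> in simp)
  then obtain i where i: "(\<integral>\<^sup>+t. ennreal (sqmod (rep_L2 f t - s i t)) \<partial>lborel) < ennreal (e\<^sup>2)"
    by (auto simp: eventually_sequentially)
  have "ennreal ((norm (f - abs_L2 (s i)))\<^sup>2) < ennreal (e\<^sup>2)"
    using i norm_abs_L2_sq[OF square_integrable_diff[OF sqf sqs[of i]]]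
    by (simp add: abs_L2_diff[OF sqf sqs] abs_rep_L2)
  then have "norm (f - abs_L2 (s i)) < e"
    using \<open>e > 0\<close> by (subst (asm) ennreal_less_iff) (auto intro: power_less_imp_less_base)
  then show "\<exists>h. translation_continuous h \<and> norm (f - h) < e"
    using translation_continuous_simple[OF s(1) sqs] by blast
qed

section \<open>The Plancherel identity\<close>

lemma lborel_integral_scale:
  fixes h :: "'a::euclidean_space \<Rightarrow> complex"
  assumes [measurable]: "h \<in> borel_measurable borel" and "c > 0"
  shows "(LINT u|lborel. h u) = (LINT v|lborel. c ^ DIM('a) *\<^sub>R h (c *\<^sub>R v))"
proof -
  have "(LINT u|lborel. h u) = (LINT u|density (distr lborel borel (\<lambda>x. 0 + c *\<^sub>R x)) (\<lambda>_. ennreal (\<bar>c\<bar> ^ DIM('a))). h u)"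
    using lborel_affine[of c "0 :: 'a"] \<open>c > 0\<close> by simp
  also have "\<dots> = (LINT u|distr lborel borel (\<lambda>x. 0 + c *\<^sub>R x). \<bar>c\<bar> ^ DIM('a) *\<^sub>R h u)"
    by (subst integral_density) auto
  also have "\<dots> = (LINT v|lborel. c ^ DIM('a) *\<^sub>R h (c *\<^sub>R v))"
    using \<open>c > 0\<close> by (subst integral_distr) auto
  finally show ?thesis .
qed

definition fourier :: "('a::euclidean_space \<Rightarrow> complex) \<Rightarrow> 'a \<Rightarrow> complex" where
  "fourier F \<xi> = (LINT t|lborel. F t * cowave \<xi> t)"

lemma fourier_measurable [measurable]:
  assumes [measurable]: "F \<in> borel_measurable borel"
  shows "fourier F \<in> borel_measurable borel"
  unfolding fourier_def[abs_def]
  by (rule lborel.borel_measurable_lebesgue_integral) (simp add: borel_prod[symmetric] split_beta')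

lemma fourier_bound: "cmod (fourier F \<xi>) \<le> (LINT t|lborel. cmod (F t))"
  unfolding fourier_def by (rule order_trans[OF integral_norm_bound]) (simp add: norm_mult)

section \<open>Autocorrelation and Gaussian summation\<close>

context
  fixes f :: "'a::euclidean_space L2"
  assumes int: "integrable lborel (rep_L2 f)"
begin

text \<open>Its Fourier transform is the squared modulus of the transform of \<open>f\<close>, and
  its value at 0 is \<open>(norm f)\<^sup>2\<close>: Plancherel becomes Fourier inversion of this
  one function at the point 0.\<close>

definition autocorr :: "'a \<Rightarrow> complex" where
  "autocorr u = (LINT s|lborel. rep_L2 f (s + u) * cnj (rep_L2 f s))"

lemma autocorr_ip: "autocorr u = ip (tf_shift (- u, 0) f) f"
  unfolding tf_shift_def ip_abs_left[OF square_integrable_tf_shift] by (simp add: autocorr_def)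

lemma autocorr_bound: "cmod (autocorr u) \<le> (norm f)\<^sup>2"
  unfolding autocorr_ip using ip_cauchy_schwarz[of "tf_shift (- u, 0) f" f] by (simp add: power2_eq_square)

lemma autocorr_measurable [measurable]: "autocorr \<in> borel_measurable borel"
  unfolding autocorr_def[abs_def]
  by (rule lborel.borel_measurable_lebesgue_integral) (simp add: borel_prod[symmetric] split_beta')

lemma autocorr_tendsto:
  assumes "u \<longlonglongrightarrow> 0"
  shows "(\<lambda>n. autocorr (u n)) \<longlonglongrightarrow> (norm f)\<^sup>2"
proof -
  have "(\<lambda>n. - u n) \<longlonglongrightarrow> 0" using tendsto_minus[OF assms] by simp
  then have "(\<lambda>n. norm (tf_shift (- u n, 0) f - f)) \<longlonglongrightarrow> 0"
    using translation_continuous_L2[of f] unfolding translation_continuous_def by blast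
  then have lim: "(\<lambda>n. norm (tf_shift (- u n, 0) f - f) * norm f) \<longlonglongrightarrow> 0"
    by (rule tendsto_mult_left_zero)
  have "norm (autocorr (u n) - (norm f)\<^sup>2) \<le> norm (tf_shift (- u n, 0) f - f) * norm f" for n
    using ip_cauchy_schwarz[of "tf_shift (- u n, 0) f - f" f]
    by (simp add: autocorr_ip ip_diff_left ip_self)
  then have "(\<lambda>n. autocorr (u n) - (norm f)\<^sup>2) \<longlonglongrightarrow> 0"
    by (intro Lim_null_comparison[OF always_eventually lim] allI)
  then show ?thesis by (rule LIM_zero_cancel)
qed

lemma autocorr_kernel_integrable:
  "integrable (lborel \<Otimes>\<^sub>M lborel) (\<lambda>(s, u). rep_L2 f (s + u) * cnj (rep_L2 f s) * cowave \<xi> u)"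
  (is "integrable _ ?k")
proof (rule lborel_pair.Fubini_integrable)
  have sh: "integrable lborel (\<lambda>u. rep_L2 f (s + u))" for s
    using lborel_integrable_shift[OF int, of "- s"] by (simp add: add.commute)
  show "?k \<in> borel_measurable (lborel \<Otimes>\<^sub>M lborel)"
    by (simp add: split_beta')
  have "(LINT u|lborel. cmod (rep_L2 f (s + u))) = (LINT u|lborel. cmod (rep_L2 f u))" for s
  proof -
    have "complex_of_real (LINT u|lborel. cmod (rep_L2 f (s + u))) = complex_of_real (LINT u|lborel. cmod (rep_L2 f u))"
      using lborel_integral_shift[of "\<lambda>u. complex_of_real (cmod (rep_L2 f u))" "- s"] 
      by (simp add: add.commute)
    then show ?thesis by (simp only: of_real_eq_iff)
  qed
  then have "(LINT u|lborel. norm (rep_L2 f (s + u) * cnj (rep_L2 f s) * cowave \<xi> u))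
      = (LINT u|lborel. cmod (rep_L2 f u)) * cmod (rep_L2 f s)" for s
    by (simp add: norm_mult)
  then show "integrable lborel (\<lambda>s. LINT u|lborel. norm (?k (s, u)))"
    using int by simp
  show "AE s in lborel. integrable lborel (\<lambda>u. ?k (s, u))"
  proof (rule AE_I2)
    fix s
    have "integrable lborel (\<lambda>u. rep_L2 f (s + u) * cnj (rep_L2 f s))"
      using sh by simp
    then have "integrable lborel (\<lambda>u. rep_L2 f (s + u) * cnj (rep_L2 f s) * cowave \<xi> u)"
      by (rule Bochner_Integration.integrable_bound) (auto simp: norm_mult)
    then show "integrable lborel (\<lambda>u. ?k (s, u))"
      by simp
  qed
qed

lemma autocorr_integrable: "integrable lborel autocorr"
  using lborel_pair.integrable_snd[OF autocorr_kernel_integrable[of 0]]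
  by (simp add: autocorr_def[abs_def])

lemma fourier_autocorr: "complex_of_real (sqmod (fourier (rep_L2 f) \<xi>)) = fourier autocorr \<xi>"
proof -
  let ?F = "rep_L2 f"
  have 1: "cnj (fourier ?F \<xi>) = (LINT s|lborel. cnj (?F s) * wave \<xi> s)"
    unfolding fourier_def by (simp flip: Bochner_Integration.integral_cnj add: cis_cnj)
  have 2: "fourier ?F \<xi> = (LINT u|lborel. ?F (s + u) * cowave \<xi> (s + u))" for s
    unfolding fourier_def
    using lborel_integral_shift[of "\<lambda>t. ?F t * cowave \<xi> t" "- s"] by (simp add: add.commute)
  have "complex_of_real (sqmod (fourier ?F \<xi>)) = fourier ?F \<xi> * cnj (fourier ?F \<xi>)"
    by (rule complex_norm_square)
  also have "\<dots> = (LINT s|lborel. fourier ?F \<xi> * (cnj (?F s) * wave \<xi> s))"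
    unfolding 1 by (rule integral_mult_right_zero[symmetric])
  also have "\<dots> = (LINT s|lborel. (LINT u|lborel. ?F (s + u) * cnj (?F s) * cowave \<xi> u))"
  proof (intro Bochner_Integration.integral_cong refl)
    fix s
    have "fourier ?F \<xi> * (cnj (?F s) * wave \<xi> s) =
       (LINT u|lborel. ?F (s + u) * cowave \<xi> (s + u) * (cnj (?F s) * wave \<xi> s))"
      by (subst 2[of s], rule integral_mult_left_zero[symmetric])
    also have "\<dots> = (LINT u|lborel. ?F (s + u) * cnj (?F s) * cowave \<xi> u)"
    proof (intro Bochner_Integration.integral_cong refl)
      fix u
      have "cowave \<xi> (s + u) * wave \<xi> s = cowave \<xi> u"
        unfolding cis_mult by (rule arg_cong[of _ _ cis]) (simp add: algebra_simps)
      moreover have "a * c * (b * d) = a * b * (c * d)" for a b c d :: complex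
        by (simp only: mult_ac)
      ultimately show "?F (s + u) * cowave \<xi> (s + u) * (cnj (?F s) * wave \<xi> s)
        = ?F (s + u) * cnj (?F s) * cowave \<xi> u"
        by simp
    qed
    finally show "fourier ?F \<xi> * (cnj (?F s) * wave \<xi> s)
        = (LINT u|lborel. ?F (s + u) * cnj (?F s) * cowave \<xi> u)" .
  qed
  also have "\<dots> = (LINT u|lborel. (LINT s|lborel. ?F (s + u) * cnj (?F s) * cowave \<xi> u))"
    by (rule lborel_pair.Fubini_integral[OF autocorr_kernel_integrable, symmetric])
  also have "\<dots> = fourier autocorr \<xi>"
    unfolding fourier_def autocorr_def by simp
  finally show ?thesis .
qed

text \<open>The squared transform is not yet known to be integrable. A Gaussian weight permits the
  exchange of integrals, and the transform of the weight is an approximate identity of width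
  \<epsilon>, rescaled here to a fixed Gaussian.\<close>

lemma gaussian_mean_fourier:
  assumes "\<epsilon> > 0"
  shows "complex_of_real (LINT \<xi>|lborel. exp (- pi * \<epsilon>\<^sup>2 * (norm \<xi>)\<^sup>2) * sqmod (fourier (rep_L2 f) \<xi>))
    = (LINT v|lborel. autocorr (\<epsilon> *\<^sub>R v) * exp (- pi * (norm v)\<^sup>2))"
proof -
  let ?w = "\<lambda>\<xi>::'a. exp (- pi * \<epsilon>\<^sup>2 * (norm \<xi>)\<^sup>2)"
  let ?k = "\<lambda>(\<xi>, u). complex_of_real (?w \<xi>) * (autocorr u * cowave \<xi> u)"
  have w_int: "integrable lborel (\<lambda>\<xi>. complex_of_real (?w \<xi>))"
    using gaussian_fourier(1)[OF assms, of 0] by simp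
  have "complex_of_real (LINT \<xi>|lborel. ?w \<xi> * sqmod (fourier (rep_L2 f) \<xi>))
    = (LINT \<xi>|lborel. complex_of_real (?w \<xi> * sqmod (fourier (rep_L2 f) \<xi>)))"
    by (rule integral_complex_of_real[symmetric])
  also have "\<dots> = (LINT \<xi>|lborel. (LINT u|lborel. complex_of_real (?w \<xi>) * (autocorr u * cowave \<xi> u)))"
    unfolding of_real_mult fourier_autocorr by (simp add: fourier_def)
  also have "\<dots> = (LINT u|lborel. (LINT \<xi>|lborel. complex_of_real (?w \<xi>) * (autocorr u * cowave \<xi> u)))"
  proof (rule lborel_pair.Fubini_integral[symmetric], rule lborel_pair.Fubini_integrable)
    show "?k \<in> borel_measurable (lborel \<Otimes>\<^sub>M lborel)"
      by (simp add: split_beta')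
    have "integrable lborel (\<lambda>\<xi>. ?w \<xi> * (LINT u|lborel. cmod (autocorr u)))"
      using w_int by (simp add: complex_of_real_integrable_eq)
    then show "integrable lborel (\<lambda>\<xi>. LINT u|lborel. cmod (?k (\<xi>, u)))"
      by (simp add: norm_mult)
    show "AE \<xi> in lborel. integrable lborel (\<lambda>u. ?k (\<xi>, u))"
    proof (rule AE_I2)
      fix \<xi>
      have "integrable lborel (\<lambda>u. autocorr u * cowave \<xi> u)"
        by (rule Bochner_Integration.integrable_bound[OF autocorr_integrable]) (auto simp: norm_mult)
      then show "integrable lborel (\<lambda>u. ?k (\<xi>, u))"
        by simp
    qed
  qed
  also have "\<dots> = (LINT u|lborel. autocorr u * complex_of_real (exp (- pi * (norm u)\<^sup>2 / \<epsilon>\<^sup>2) / \<epsilon> ^ DIM('a)))"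
  proof (intro Bochner_Integration.integral_cong refl)
    fix u
    have "(LINT \<xi>|lborel. complex_of_real (?w \<xi>) * (autocorr u * cowave \<xi> u))
      = (LINT \<xi>|lborel. autocorr u * (complex_of_real (?w \<xi>) * wave \<xi> (- u)))"
      by (simp add: mult_ac)
    also have "\<dots> = autocorr u * (LINT \<xi>|lborel. complex_of_real (?w \<xi>) * wave \<xi> (- u))"
      by (rule integral_mult_right_zero)
    finally show "(LINT \<xi>|lborel. complex_of_real (?w \<xi>) * (autocorr u * cowave \<xi> u))
      = autocorr u * complex_of_real (exp (- pi * (norm u)\<^sup>2 / \<epsilon>\<^sup>2) / \<epsilon> ^ DIM('a))"
      unfolding gaussian_fourier(2)[OF assms] norm_minus_cancel .
  qed
  also have "\<dots> = (LINT v|lborel. \<epsilon> ^ DIM('a) *\<^sub>R (autocorr (\<epsilon> *\<^sub>R v) * complex_of_real (exp (- pi * (norm (\<epsilon> *\<^sub>R v))\<^sup>2 / \<epsilon>\<^sup>2) / \<epsilon> ^ DIM('a))))"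
    by (rule lborel_integral_scale[OF _ assms]) measurable
  also have "\<dots> = (LINT v|lborel. autocorr (\<epsilon> *\<^sub>R v) * exp (- pi * (norm v)\<^sup>2))"
    using assms by (intro Bochner_Integration.integral_cong refl) (simp add: scaleR_conv_of_real power_mult_distrib)
  finally show ?thesis .
qed

text \<open>As the Gaussian widens, the weighted integrals increase, so monotone convergence applies
  without integrability. By \<open>gaussian_mean_fourier\<close> they also converge to
  \<open>(norm f)\<^sup>2\<close>, by dominated convergence and the continuity of
  \<open>autocorr\<close> at 0.\<close>

lemma plancherel_L2: "(\<integral>\<^sup>+\<xi>. ennreal (sqmod (fourier (rep_L2 f) \<xi>)) \<partial>lborel) = ennreal ((norm f)\<^sup>2)"
proof (rule LIMSEQ_unique)
  define e where "e k = inverse (real (Suc k))" for k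
  have e: "e k > 0" for k by (simp add: e_def)
  have e0: "e \<longlonglongrightarrow> 0" unfolding e_def[abs_def] by (rule LIMSEQ_inverse_real_of_nat)
  have e_dec: "e (Suc k) \<le> e k" for k by (simp add: e_def field_simps)
  let ?w = "\<lambda>k \<xi>. exp (- pi * (e k)\<^sup>2 * (norm \<xi>)\<^sup>2) * sqmod (fourier (rep_L2 f) \<xi>)"
  show "(\<lambda>k. \<integral>\<^sup>+\<xi>. ennreal (?w k \<xi>) \<partial>lborel) \<longlonglongrightarrow> (\<integral>\<^sup>+\<xi>. ennreal (sqmod (fourier (rep_L2 f) \<xi>)) \<partial>lborel)"
  proof (rule nn_integral_LIMSEQ)
    show "incseq (\<lambda>k \<xi>. ennreal (?w k \<xi>))"
    proof (intro incseq_SucI le_funI ennreal_leI mult_right_mono)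
      fix k and \<xi> :: 'a
      have "(e (Suc k))\<^sup>2 * (norm \<xi>)\<^sup>2 \<le> (e k)\<^sup>2 * (norm \<xi>)\<^sup>2"
        using e_dec[of k] e[of "Suc k"] by (intro mult_right_mono power_mono) auto
      from mult_left_mono[OF this, of pi]
      show "exp (- pi * (e k)\<^sup>2 * (norm \<xi>)\<^sup>2) \<le> exp (- pi * (e (Suc k))\<^sup>2 * (norm \<xi>)\<^sup>2)"
        by (simp add: mult.assoc)
    qed auto
    show "(\<lambda>k. ennreal (?w k \<xi>)) \<longlonglongrightarrow> ennreal (sqmod (fourier (rep_L2 f) \<xi>))" for \<xi>
    proof (rule tendsto_ennrealI)
      have "(\<lambda>k. ?w k \<xi>) \<longlonglongrightarrow> exp (- pi * 0\<^sup>2 * (norm \<xi>)\<^sup>2) * sqmod (fourier (rep_L2 f) \<xi>)"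
        by (intro tendsto_intros e0)
      then show "(\<lambda>k. ?w k \<xi>) \<longlonglongrightarrow> sqmod (fourier (rep_L2 f) \<xi>)" by simp
    qed
  qed measurable
  have "(\<integral>\<^sup>+\<xi>. ennreal (?w k \<xi>) \<partial>lborel) = ennreal (LINT \<xi>|lborel. ?w k \<xi>)" for k
  proof (rule nn_integral_eq_integral)
    have "integrable lborel (\<lambda>\<xi>::'a. complex_of_real (exp (- pi * (e k)\<^sup>2 * (norm \<xi>)\<^sup>2)))"
      using gaussian_fourier(1)[OF e[of k], of 0] by simp
    then have "integrable lborel (\<lambda>\<xi>::'a. exp (- pi * (e k)\<^sup>2 * (norm \<xi>)\<^sup>2) * (LINT t|lborel. cmod (rep_L2 f t))\<^sup>2)"
      by (simp add: complex_of_real_integrable_eq)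
    then show "integrable lborel (?w k)"
      by (rule Bochner_Integration.integrable_bound)
         (auto intro!: mult_left_mono power_mono fourier_bound AE_I2)
  qed auto
  moreover have "(\<lambda>k. LINT \<xi>|lborel. ?w k \<xi>) \<longlonglongrightarrow> (norm f)\<^sup>2"
  proof -
    have "(\<lambda>k. LINT v|lborel. autocorr (e k *\<^sub>R v) * exp (- pi * (norm v)\<^sup>2)) \<longlonglongrightarrow>
        (LINT v|lborel. complex_of_real ((norm f)\<^sup>2) * complex_of_real (exp (- pi * (norm (v::'a))\<^sup>2)))"
    proof (rule integral_dominated_convergence[where w = "\<lambda>v. (norm f)\<^sup>2 * exp (- pi * (norm v)\<^sup>2)"])
      show "integrable lborel (\<lambda>v::'a. (norm f)\<^sup>2 * exp (- pi * (norm v)\<^sup>2))"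
        using gaussian_fourier(1)[of 1 "0 :: 'a"] by (simp add: complex_of_real_integrable_eq)
      show "AE v in lborel. (\<lambda>k. autocorr (e k *\<^sub>R v) * exp (- pi * (norm v)\<^sup>2)) \<longlonglongrightarrow>
          complex_of_real ((norm f)\<^sup>2) * complex_of_real (exp (- pi * (norm v)\<^sup>2))"
      proof (rule AE_I2)
        fix v :: 'a
        have "(\<lambda>k. e k *\<^sub>R v) \<longlonglongrightarrow> 0 *\<^sub>R v" by (intro tendsto_intros e0)
        then show "(\<lambda>k. autocorr (e k *\<^sub>R v) * exp (- pi * (norm v)\<^sup>2)) \<longlonglongrightarrow>
          complex_of_real ((norm f)\<^sup>2) * complex_of_real (exp (- pi * (norm v)\<^sup>2))"
          by (intro tendsto_mult tendsto_const autocorr_tendsto) simp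
      qed
      show "AE v in lborel. norm (autocorr (e k *\<^sub>R v) * exp (- pi * (norm v)\<^sup>2)) \<le> (norm f)\<^sup>2 * exp (- pi * (norm v)\<^sup>2)" for k
        using autocorr_bound by (auto simp: norm_mult intro!: mult_right_mono AE_I2)
    qed measurable
    also have "(LINT v|lborel. complex_of_real ((norm f)\<^sup>2) * complex_of_real (exp (- pi * (norm (v::'a))\<^sup>2))) = complex_of_real ((norm f)\<^sup>2)"
      using gaussian_fourier(2)[of 1 "0 :: 'a"] by simp
    finally have "(\<lambda>k. complex_of_real (LINT \<xi>|lborel. ?w k \<xi>)) \<longlonglongrightarrow> complex_of_real ((norm f)\<^sup>2)"
      unfolding gaussian_mean_fourier[OF e] .
    then show ?thesis by (simp only: tendsto_of_real_iff)
  qed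
  ultimately show "(\<lambda>k. \<integral>\<^sup>+\<xi>. ennreal (?w k \<xi>) \<partial>lborel) \<longlonglongrightarrow> ennreal ((norm f)\<^sup>2)"
    by (simp add: tendsto_ennrealI)
qed

end

lemma plancherel:
  assumes int: "integrable lborel F" and sq: "square_integrable F"
  shows "(\<integral>\<^sup>+\<xi>. ennreal (sqmod (fourier F \<xi>)) \<partial>lborel) = (\<integral>\<^sup>+t. ennreal (sqmod (F t)) \<partial>lborel)"
proof -
  note [measurable] = square_integrable_measurable[OF sq]
  note ae = rep_abs_L2[OF sq]
  have i: "integrable lborel (rep_L2 (abs_L2 F))"
    using int ae by (subst integrable_cong_AE[of _ _ F]) auto
  have "fourier (rep_L2 (abs_L2 F)) \<xi> = fourier F \<xi>" for \<xi>
    unfolding fourier_def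
  proof (rule integral_cong_AE)
    show "AE t in lborel. rep_L2 (abs_L2 F) t * cowave \<xi> t = F t * cowave \<xi> t"
      using ae by eventually_elim simp
  qed measurable
  then show ?thesis using plancherel_L2[OF i] norm_abs_L2_sq[OF sq] by simp
qed

text \<open>For fixed \<open>x\<close> the function \<open>stft g f\<close> is the Fourier transform
  of a product of two square-integrable functions. That product is always integrable but
  square-integrable only for almost every \<open>x\<close>; Tonelli yields both this and the total,
  and \<open>plancherel\<close> applies slice by slice.\<close>

theorem moyal: "(\<integral>\<^sup>+z. ennreal (sqmod (stft g f z)) \<partial>lborel) = ennreal ((norm f)\<^sup>2 * (norm g)\<^sup>2)"
  for f g :: "'a::euclidean_space L2"
proof -
  let ?F = "\<lambda>x t. rep_L2 f t * cnj (rep_L2 g (t - x))"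
  have stft_F: "stft g f (x, \<xi>) = fourier (?F x) \<xi>" for x \<xi>
    by (simp add: stft_def fourier_def)
  have g_sh: "square_integrable (\<lambda>t. cnj (rep_L2 g (t - x)))" for x
    using lborel_integrable_shift[of "\<lambda>t. sqmod (rep_L2 g t)" x] rep_L2_square_integrable[of g]
    by (intro square_integrable_cnj) (auto simp: square_integrable_def)
  have F_int: "integrable lborel (?F x)" for x
    by (rule square_integrable_mult[OF rep_L2_square_integrable g_sh])
  have Fm [measurable]: "?F x \<in> borel_measurable borel" for x by measurable
  have total: "(\<integral>\<^sup>+x. (\<integral>\<^sup>+t. ennreal (sqmod (?F x t)) \<partial>lborel) \<partial>lborel) = ennreal ((norm f)\<^sup>2 * (norm g)\<^sup>2)"
  proof -
    have "(\<integral>\<^sup>+x. (\<integral>\<^sup>+t. ennreal (sqmod (?F x t)) \<partial>lborel) \<partial>lborel) = (\<integral>\<^sup>+t. (\<integral>\<^sup>+x. ennreal (sqmod (?F x t)) \<partial>lborel) \<partial>lborel)"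
      by (rule lborel_pair.Fubini'[symmetric]) (simp add: split_beta')
    also have "\<dots> = (\<integral>\<^sup>+t. ennreal (sqmod (rep_L2 f t)) * ennreal ((norm g)\<^sup>2) \<partial>lborel)"
    proof (intro nn_integral_cong)
      fix t
      have "(\<integral>\<^sup>+x. ennreal (sqmod (?F x t)) \<partial>lborel) = (\<integral>\<^sup>+x. ennreal (sqmod (rep_L2 f t)) * ennreal (sqmod (rep_L2 g (t - x))) \<partial>lborel)"
        by (simp add: norm_mult power_mult_distrib ennreal_mult)
      also have "\<dots> = ennreal (sqmod (rep_L2 f t)) * (\<integral>\<^sup>+x. ennreal (sqmod (rep_L2 g (t - x))) \<partial>lborel)"
        by (rule nn_integral_cmult) measurable
      also have "(\<integral>\<^sup>+x. ennreal (sqmod (rep_L2 g (t - x))) \<partial>lborel) = (\<integral>\<^sup>+x. ennreal (sqmod (rep_L2 g x)) \<partial>lborel)"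
      proof -
        have "(\<integral>\<^sup>+x. ennreal (sqmod (rep_L2 g (- (x - t)))) \<partial>lborel) = (\<integral>\<^sup>+x. ennreal (sqmod (rep_L2 g (- x))) \<partial>lborel)"
          by (rule nn_integral_lborel_shift) measurable
        also have "\<dots> = (\<integral>\<^sup>+x. ennreal (sqmod (rep_L2 g x)) \<partial>distr lborel borel uminus)"
          by (subst nn_integral_distr) auto
        also have "distr lborel borel uminus = (lborel :: 'a measure)"
          using lborel_affine[of "- 1" "0 :: 'a"] by (simp add: density_1)
        finally show ?thesis by simp
      qed
      finally show "(\<integral>\<^sup>+x. ennreal (sqmod (?F x t)) \<partial>lborel) = ennreal (sqmod (rep_L2 f t)) * ennreal ((norm g)\<^sup>2)"
        by (simp only: norm_L2_sq_nn)
    qed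
    also have "\<dots> = (\<integral>\<^sup>+t. ennreal (sqmod (rep_L2 f t)) \<partial>lborel) * ennreal ((norm g)\<^sup>2)"
      by (rule nn_integral_multc) measurable
    finally show ?thesis by (simp add: norm_L2_sq_nn[symmetric] ennreal_mult)
  qed
  have m2 [measurable]: "(\<lambda>x. \<integral>\<^sup>+t. ennreal (sqmod (?F x t)) \<partial>lborel) \<in> borel_measurable (lborel :: 'a measure)"
    by (rule lborel.borel_measurable_nn_integral) (simp add: split_beta')
  have "AE x in lborel. (\<integral>\<^sup>+t. ennreal (sqmod (?F x t)) \<partial>lborel) \<noteq> \<infinity>"
    by (rule nn_integral_PInf_AE) (use m2 total in auto)
  then have "AE x in lborel. (\<integral>\<^sup>+\<xi>. ennreal (sqmod (stft g f (x, \<xi>))) \<partial>lborel) = (\<integral>\<^sup>+t. ennreal (sqmod (?F x t)) \<partial>lborel)"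
  proof eventually_elim
    case (elim x)
    then have "square_integrable (?F x)"
      by (auto simp: square_integrable_def integrable_iff_bounded less_top)
    from plancherel[OF F_int this] show ?case by (simp add: stft_F)
  qed
  moreover have "(\<integral>\<^sup>+z. ennreal (sqmod (stft g f z)) \<partial>lborel) = (\<integral>\<^sup>+x. (\<integral>\<^sup>+\<xi>. ennreal (sqmod (stft g f (x, \<xi>))) \<partial>lborel) \<partial>lborel)"
    unfolding lborel_prod[symmetric]
    by (rule lborel.nn_integral_fst[symmetric]) (simp add: lborel_prod)
  ultimately show ?thesis using total by (simp add: nn_integral_cong_AE)
qed

section \<open>Sweeping a set along a vector\<close>

text \<open>The Minkowski sum of \<open>S\<close> and the segment from \<open>- u\<close> to 0. For
  the frontier of a set it contains every point whose membership changes under the displacement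
  \<open>u\<close>.\<close>

definition sweep :: "'a::euclidean_space set \<Rightarrow> 'a \<Rightarrow> 'a set" where
  "sweep S u = {z. \<exists>t\<in>{0..1}. z + t *\<^sub>R u \<in> S}"

lemma compact_sweep:
  assumes "compact S"
  shows "compact (sweep S u)"
proof -
  have "sweep S u = (\<lambda>(x, t). x - t *\<^sub>R u) ` (S \<times> {0..1})"
  proof (intro equalityI subsetI)
    fix z assume "z \<in> sweep S u"
    then obtain t where "t \<in> {0..1}" "z + t *\<^sub>R u \<in> S" by (auto simp: sweep_def)
    then show "z \<in> (\<lambda>(x, t). x - t *\<^sub>R u) ` (S \<times> {0..1})"
      by (intro image_eqI[of _ _ "(z + t *\<^sub>R u, t)"]) auto
  next
    fix z assume "z \<in> (\<lambda>(x, t). x - t *\<^sub>R u) ` (S \<times> {0..1})"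
    then obtain x t where "x \<in> S" "t \<in> {0..1}" "z = x - t *\<^sub>R u" by auto
    then show "z \<in> sweep S u" unfolding sweep_def by (intro CollectI bexI[of _ t]) auto
  qed
  moreover have "continuous_on (S \<times> {0..1}) (\<lambda>(x, t). x - t *\<^sub>R u)"
    unfolding split_beta by (intro continuous_intros)
  ultimately show ?thesis
    using assms by (auto intro!: compact_continuous_image compact_Times)
qed

lemma sweep_mono: "S \<subseteq> T \<Longrightarrow> sweep S u \<subseteq> sweep T u"
  by (auto simp: sweep_def)

lemma sweep_UN: "sweep (\<Union>i. U i) u = (\<Union>i. sweep (U i) u)"
  by (auto simp: sweep_def)

lemma sets_sweep [measurable]: "compact S \<Longrightarrow> sweep S u \<in> sets borel"
  by (intro borel_compact compact_sweep)

text \<open>A swept ball of radius \<open>r\<close> is covered by balls of radius \<open>2 * r\<close> centred at steps of length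
  \<open>r\<close> along the segment.\<close>

lemma emeasure_sweep_cball:
  fixes x u :: "'a::euclidean_space"
  assumes r: "0 < r" "r \<le> norm u"
  shows "emeasure lborel (sweep (cball x r) u)
    \<le> ennreal (2 * 2 ^ DIM('a) * unit_ball_vol (real DIM('a)) * norm u * r ^ (DIM('a) - 1))"
proof -
  define N where "N = nat \<lfloor>norm u / r\<rfloor>"
  have u: "norm u > 0" using r by linarith
  have N: "real N \<le> norm u / r" using r u by (simp add: N_def)
  let ?B = "\<lambda>j::nat. cball (x - (j * r / norm u) *\<^sub>R u) (2 * r)"
  have "sweep (cball x r) u \<subseteq> (\<Union>j\<in>{..N}. ?B j)"
  proof
    fix z assume "z \<in> sweep (cball x r) u"
    then obtain t where t: "0 \<le> t" "t \<le> 1" "norm (z + t *\<^sub>R u - x) \<le> r"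
      by (auto simp: sweep_def dist_norm norm_minus_commute)
    define j where "j = nat \<lfloor>t * norm u / r\<rfloor>"
    have j0: "0 \<le> t * norm u / r" using t r by simp
    have j: "real j \<le> t * norm u / r" "t * norm u / r < real j + 1"
      using j0 by (auto simp: j_def)
    have "t * norm u / r \<le> norm u / r" using t r u by (simp add: divide_right_mono mult_left_le_one_le)
    then have "j \<le> N" unfolding j_def N_def by (intro nat_mono floor_mono)
    have "z - (x - (j * r / norm u) *\<^sub>R u) = (z + t *\<^sub>R u - x) - (t - j * r / norm u) *\<^sub>R u"
      by (simp add: algebra_simps)
    also have "norm \<dots> \<le> r + \<bar>t - j * r / norm u\<bar> * norm u"
      using norm_triangle_ineq4[of "z + t *\<^sub>R u - x" "(t - j * r / norm u) *\<^sub>R u"] t(3) by simp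
    also have "\<bar>t - j * r / norm u\<bar> * norm u = \<bar>t * norm u - j * r\<bar>"
    proof -
      have "\<bar>t - j * r / norm u\<bar> * norm u = \<bar>(t - j * r / norm u) * norm u\<bar>"
        by (simp only: abs_mult abs_norm_cancel)
      then show ?thesis using u by (simp add: left_diff_distrib)
    qed
    also have "\<dots> \<le> r" using j r by (simp add: field_simps)
    finally have "z \<in> ?B j" by (simp add: dist_norm norm_minus_commute)
    with \<open>j \<le> N\<close> show "z \<in> (\<Union>j\<in>{..N}. ?B j)" by blast
  qed
  then have "emeasure lborel (sweep (cball x r) u) \<le> emeasure lborel (\<Union>j\<in>{..N}. ?B j)"
    by (intro emeasure_mono) auto
  also have "\<dots> \<le> (\<Sum>j\<in>{..N}. emeasure lborel (?B j))"
    by (intro emeasure_subadditive_finite) auto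
  also have "\<dots> = (\<Sum>j\<in>{..N}. ennreal (unit_ball_vol (real DIM('a)) * (2 * r) ^ DIM('a)))"
    using r by (simp add: emeasure_cball)
  also have "\<dots> = ennreal ((real N + 1) * (unit_ball_vol (real DIM('a)) * (2 * r) ^ DIM('a)))"
    using r by (simp add: ennreal_mult' flip: ennreal_of_nat_eq_real_of_nat) (simp add: add.commute)
  also have "\<dots> \<le> ennreal ((2 * norm u / r) * (unit_ball_vol (real DIM('a)) * (2 * r) ^ DIM('a)))"
  proof (intro ennreal_leI mult_right_mono)
    have "1 \<le> norm u / r" using r by simp
    then show "real N + 1 \<le> 2 * norm u / r" using N by simp
  qed (use r in auto)
  also have "(2 * norm u / r) * (unit_ball_vol (real DIM('a)) * (2 * r) ^ DIM('a))
     = 2 * 2 ^ DIM('a) * unit_ball_vol (real DIM('a)) * norm u * r ^ (DIM('a) - 1)"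
  proof -
    have "r ^ DIM('a) = r * r ^ (DIM('a) - 1)" by (simp flip: power_Suc)
    then show ?thesis using r by (simp add: power_mult_distrib)
  qed
  finally show ?thesis .
qed

text \<open>Coverings may contain sets of diameter 0, whose enclosing ball is a point; there the
  bound is a limit of those for positive radii.\<close>

lemma emeasure_sweep_cball_0:
  fixes x u :: "'a::euclidean_space"
  assumes d: "0 \<le> d" "d \<le> norm u" and "u \<noteq> 0" "2 \<le> DIM('a)"
  shows "emeasure lborel (sweep (cball x d) u)
    \<le> ennreal (2 * 2 ^ DIM('a) * unit_ball_vol (real DIM('a)) * norm u * d ^ (DIM('a) - 1))"
proof (cases "d = 0")
  case True
  let ?K = "2 * 2 ^ DIM('a) * unit_ball_vol (real DIM('a)) * norm u"
  have "(\<lambda>m. ?K * (norm u * inverse (real (Suc m))) ^ (DIM('a) - 1)) \<longlonglongrightarrow> ?K * (norm u * 0) ^ (DIM('a) - 1)"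
    by (intro tendsto_intros LIMSEQ_inverse_real_of_nat)
  then have "(\<lambda>m. ennreal (?K * (norm u * inverse (real (Suc m))) ^ (DIM('a) - 1))) \<longlonglongrightarrow> ennreal (?K * (norm u * 0) ^ (DIM('a) - 1))"
    by (rule tendsto_ennrealI)
  moreover have "emeasure lborel (sweep (cball x d) u) \<le> ennreal (?K * (norm u * inverse (real (Suc m))) ^ (DIM('a) - 1))" for m
  proof -
    have r: "0 < norm u * inverse (real (Suc m))" "norm u * inverse (real (Suc m)) \<le> norm u"
      using \<open>u \<noteq> 0\<close> by (auto simp: field_simps)
    have "emeasure lborel (sweep (cball x d) u) \<le> emeasure lborel (sweep (cball x (norm u * inverse (real (Suc m)))) u)"
      using True r by (intro emeasure_mono sweep_mono) (auto intro!: sets_sweep)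
    also have "\<dots> \<le> ennreal (?K * (norm u * inverse (real (Suc m))) ^ (DIM('a) - 1))"
      by (rule emeasure_sweep_cball[OF r])
    finally show ?thesis .
  qed
  ultimately have "emeasure lborel (sweep (cball x d) u) \<le> ennreal (?K * (norm u * 0) ^ (DIM('a) - 1))"
    by (intro LIMSEQ_le_const[where X = "\<lambda>m. ennreal (?K * (norm u * inverse (real (Suc m))) ^ (DIM('a) - 1))"]) blast+
  then show ?thesis using True by simp
next
  case False
  then show ?thesis using d by (intro emeasure_sweep_cball) auto
qed

text \<open>The bound for balls of radius \<open>diameter U\<close>, expressed in units of the
  Hausdorff summand: halving the diameter costs \<open>2 ^ (DIM('a) - 1)\<close>, and 2 times the
  two powers of 2 is \<open>4 ^ DIM('a)\<close>. The remaining factor 2 is slack.\<close>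

definition sweep_const :: "'a::euclidean_space itself \<Rightarrow> real" where
  "sweep_const _ = 2 * 4 ^ DIM('a) * unit_ball_vol (real DIM('a)) / unit_ball_vol (real (DIM('a) - 1))"

lemma sweep_const_pos: "sweep_const TYPE('a::euclidean_space) > 0"
  by (simp add: sweep_const_def)

text \<open>Covering sets are arbitrary and their sweeps need not be measurable, hence a Borel
  superset: the sweep of the ball of radius \<open>diameter U\<close> about a point of
  \<open>U\<close>.\<close>

lemma ex_sweep_cover:
  fixes U :: "'a::euclidean_space set"
  assumes U: "bounded U" "diameter U \<le> norm u" and "u \<noteq> 0" "2 \<le> DIM('a)"
  shows "\<exists>V\<in>sets borel. sweep U u \<subseteq> V \<and> emeasure lborel V \<le> ennreal (sweep_const TYPE('a) * norm u) *
    (if U = {} then 0 else ennreal (unit_ball_vol (real (DIM('a) - 1)) * (diameter U / 2) ^ (DIM('a) - 1)))"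
proof (cases "U = {}")
  case True
  then show ?thesis by (intro bexI[of _ "{}"]) (auto simp: sweep_def)
next
  case False
  then obtain x where "x \<in> U" by blast
  have d0: "0 \<le> diameter U" by (rule diameter_ge_0[OF U(1)])
  have "U \<subseteq> cball x (diameter U)"
    using diameter_bounded_bound[OF U(1) \<open>x \<in> U\<close>] by auto
  then have "sweep U u \<subseteq> sweep (cball x (diameter U)) u" by (rule sweep_mono)
  moreover have "emeasure lborel (sweep (cball x (diameter U)) u) \<le> ennreal (sweep_const TYPE('a) * norm u) *
    ennreal (unit_ball_vol (real (DIM('a) - 1)) * (diameter U / 2) ^ (DIM('a) - 1))"
  proof -
    have p: "(4::real) ^ DIM('a) = 2 ^ DIM('a) * (2 * 2 ^ (DIM('a) - 1))"
      unfolding power_Suc[symmetric] by (simp flip: power_mult_distrib)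
    have v: "unit_ball_vol (real (DIM('a) - 1)) > 0" by (intro unit_ball_vol_pos) simp
    have "2 * 2 ^ DIM('a) * unit_ball_vol (real DIM('a)) * norm u * diameter U ^ (DIM('a) - 1)
       \<le> sweep_const TYPE('a) * norm u * (unit_ball_vol (real (DIM('a) - 1)) * (diameter U / 2) ^ (DIM('a) - 1))"
      using v[THEN less_imp_neq] d0 unfolding sweep_const_def p by (simp add: power_divide del: of_nat_diff)
    then show ?thesis
      using emeasure_sweep_cball_0[OF d0 U(2) assms(3,4), of x] sweep_const_pos[where 'a = 'a] d0 v
      by (subst ennreal_mult[symmetric]) (auto intro: order_trans ennreal_leI)
  qed
  ultimately show ?thesis using False
    by (intro bexI[of _ "sweep (cball x (diameter U)) u"]) auto
qed

lemma hausdorff_content_le_hausdorff: "0 < \<delta> \<Longrightarrow> hausdorff_content m \<delta> A \<le> hausdorff m A"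
  unfolding hausdorff_def by (intro SUP_upper) auto

text \<open>A covering of \<open>S\<close> by sets no wider than \<open>norm u\<close> induces one
  of the sweep, so the content at the single scale \<open>norm u\<close> suffices, and it is below
  the Hausdorff measure.\<close>

theorem emeasure_sweep_le:
  fixes S :: "'a::euclidean_space set"
  assumes "u \<noteq> 0" "2 \<le> DIM('a)" and S: "sweep S u \<in> sets borel"
  shows "emeasure lborel (sweep S u) \<le> ennreal (sweep_const TYPE('a) * norm u) * hausdorff (DIM('a) - 1) S"
proof -
  let ?c = "ennreal (sweep_const TYPE('a) * norm u)"
  have c: "0 < ?c" using sweep_const_pos[where 'a = 'a] \<open>u \<noteq> 0\<close> by simp
  have "emeasure lborel (sweep S u) / ?c \<le> hausdorff_content (DIM('a) - 1) (norm u) S"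
    unfolding hausdorff_content_def
  proof (rule INF_greatest)
    fix U :: "nat \<Rightarrow> 'a set"
    assume "U \<in> {U. S \<subseteq> (\<Union>i. U i) \<and> (\<forall>i. bounded (U i) \<and> diameter (U i) \<le> norm u)}"
    then have U: "S \<subseteq> (\<Union>i. U i)" "\<And>i. bounded (U i)" "\<And>i. diameter (U i) \<le> norm u" by auto
    let ?t = "\<lambda>i. if U i = {} then 0 else ennreal (unit_ball_vol (real (DIM('a) - 1)) * (diameter (U i) / 2) ^ (DIM('a) - 1))"
    have "\<forall>i. \<exists>V\<in>sets borel. sweep (U i) u \<subseteq> V \<and> emeasure lborel V \<le> ?c * ?t i"
      using ex_sweep_cover[OF U(2,3) assms(1,2)] by blast
    then obtain V where V: "\<And>i. V i \<in> sets borel" "\<And>i. sweep (U i) u \<subseteq> V i" "\<And>i. emeasure lborel (V i) \<le> ?c * ?t i"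
      by metis
    have "sweep S u \<subseteq> (\<Union>i. V i)"
      using sweep_mono[OF U(1), of u] V(2) unfolding sweep_UN by blast
    then have "emeasure lborel (sweep S u) \<le> emeasure lborel (\<Union>i. V i)"
      using V(1) by (intro emeasure_mono) auto
    also have "\<dots> \<le> (\<Sum>i. emeasure lborel (V i))"
      using V(1) by (intro emeasure_subadditive_countably) auto
    also have "\<dots> \<le> (\<Sum>i. ?c * ?t i)"
      by (intro suminf_le V(3)) auto
    also have "\<dots> = (\<Sum>i. ?t i) * ?c" by (simp only: ennreal_suminf_cmult mult.commute)
    finally show "emeasure lborel (sweep S u) / ?c \<le> (\<Sum>i. ?t i)"
      using c by (intro divide_le_posI_ennreal) (simp_all only: mult.commute)
  qed
  also have "\<dots> \<le> hausdorff (DIM('a) - 1) S"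
    using \<open>u \<noteq> 0\<close> by (intro hausdorff_content_le_hausdorff) simp
  finally have "?c * (emeasure lborel (sweep S u) / ?c) \<le> ?c * hausdorff (DIM('a) - 1) S"
    by (rule mult_left_mono) simp
  moreover have "?c * (emeasure lborel (sweep S u) / ?c) = emeasure lborel (sweep S u)"
  proof -
    have "?c \<noteq> 0" "?c \<noteq> top" using c by auto
    then show ?thesis
      unfolding ennreal_times_divide mult.commute[of ?c] by (rule mult_divide_eq_ennreal)
  qed
  ultimately show ?thesis by simp
qed

section \<open>Volumes of neighbourhoods\<close>

lemma hausdorff_content_mono:
  assumes "A \<subseteq> B"
  shows "hausdorff_content m \<delta> A \<le> hausdorff_content m \<delta> B"
  unfolding hausdorff_content_def using assms by (intro INF_superset_mono) auto

lemma hausdorff_mono: "A \<subseteq> B \<Longrightarrow> hausdorff m A \<le> hausdorff m B"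
  unfolding hausdorff_def by (intro SUP_mono' hausdorff_content_mono)

lemma hausdorff_content_antimono:
  assumes "\<delta> \<le> \<delta>'"
  shows "hausdorff_content m \<delta>' A \<le> hausdorff_content m \<delta> A"
  unfolding hausdorff_content_def using assms by (intro INF_superset_mono) (auto intro: order_trans)

text \<open>A set of diameter at most \<eta> cannot meet the \<eta>-balls about two centres at
  distance 3 \<eta>, so every covering set is charged to at most one centre.\<close>

lemma sum_hausdorff_content_le:
  fixes X :: "'a::metric_space set"
  assumes "finite P" and sep: "\<And>y z. y \<in> P \<Longrightarrow> z \<in> P \<Longrightarrow> y \<noteq> z \<Longrightarrow> 3 * \<eta> \<le> dist y z"
    and \<delta>: "0 \<le> \<delta>" "\<delta> \<le> \<eta>"
  shows "(\<Sum>z\<in>P. hausdorff_content m \<delta> (X \<inter> ball z \<eta>)) \<le> hausdorff_content m \<delta> X"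
  unfolding hausdorff_content_def[of m \<delta> X]
proof (rule INF_greatest)
  fix U :: "nat \<Rightarrow> 'a set"
  assume "U \<in> {U. X \<subseteq> (\<Union>i. U i) \<and> (\<forall>i. bounded (U i) \<and> diameter (U i) \<le> \<delta>)}"
  then have U: "X \<subseteq> (\<Union>i. U i)" "\<And>i. bounded (U i)" "\<And>i. diameter (U i) \<le> \<delta>" by auto
  let ?t = "\<lambda>U :: 'a set. if U = {} then 0 else ennreal (unit_ball_vol (real m) * (diameter U / 2) ^ m)"
  \<comment> \<open>Sets that miss the ball are replaced by the empty set, which costs
    nothing.\<close>
  define W where "W z i = (if U i \<inter> ball z \<eta> = {} then {} else U i)" for z i
  have "(\<Sum>z\<in>P. hausdorff_content m \<delta> (X \<inter> ball z \<eta>)) \<le> (\<Sum>z\<in>P. \<Sum>i. ?t (W z i))"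
  proof (rule sum_mono)
    fix z
    have "X \<inter> ball z \<eta> \<subseteq> (\<Union>i. W z i)" using U(1) by (fastforce simp: W_def)
    moreover have "bounded (W z i) \<and> diameter (W z i) \<le> \<delta>" for i
      using U(2,3)[of i] \<delta> by (auto simp: W_def)
    ultimately show "hausdorff_content m \<delta> (X \<inter> ball z \<eta>) \<le> (\<Sum>i. ?t (W z i))"
      unfolding hausdorff_content_def by (intro INF_lower) auto
  qed
  also have "\<dots> = (\<Sum>i. \<Sum>z\<in>P. ?t (W z i))"
    by (rule suminf_sum[symmetric]) simp
  also have "\<dots> \<le> (\<Sum>i. ?t (U i))"
  proof (rule suminf_le)
    fix i
    show "(\<Sum>z\<in>P. ?t (W z i)) \<le> ?t (U i)"
    proof (cases "\<exists>z\<in>P. U i \<inter> ball z \<eta> \<noteq> {}")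
      case True
      then obtain z where z: "z \<in> P" "U i \<inter> ball z \<eta> \<noteq> {}" by blast
      have "W y i = {}" if y: "y \<in> P" "y \<noteq> z" for y
      proof (rule ccontr)
        assume "W y i \<noteq> {}"
        then obtain p q where p: "p \<in> U i" "dist y p < \<eta>" and q: "q \<in> U i" "dist z q < \<eta>"
          using z(2) by (auto simp: W_def split: if_splits)
        have "dist p q \<le> \<delta>" using diameter_bounded_bound[OF U(2) p(1) q(1)] U(3)[of i] by simp
        then have "dist y z < 3 * \<eta>"
          using p q \<delta> dist_triangle[of y z p] dist_triangle[of p z q] by (simp add: dist_commute)
        then show False using sep[OF y(1) z(1) y(2)] by simp
      qed
      then have "(\<Sum>y\<in>P. ?t (W y i)) = (\<Sum>y\<in>P. if y = z then ?t (W z i) else 0)"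
        by (intro sum.cong) auto
      also have "\<dots> = ?t (U i)" using z \<open>finite P\<close> by (simp add: W_def)
      finally show ?thesis by simp
    next
      case False
      then show ?thesis by (simp add: W_def)
    qed
  qed auto
  finally show "(\<Sum>z\<in>P. hausdorff_content m \<delta> (X \<inter> ball z \<eta>)) \<le> (\<Sum>i. ?t (U i))" .
qed

text \<open>Hausdorff measure is a supremum of contents: a loss factor \<open>s < 1\<close> makes
  each lower bound valid at some positive scale, and since \<open>P\<close> is finite one scale
  \<open>e\<close> serves all centres, where \<open>sum_hausdorff_content_le\<close>
  applies.\<close>

lemma card_separated_le:
  fixes X :: "'a::metric_space set"
  assumes P: "finite P" "P \<subseteq> X" and sep: "\<And>y z. y \<in> P \<Longrightarrow> z \<in> P \<Longrightarrow> y \<noteq> z \<Longrightarrow> 3 * \<eta> \<le> dist y z"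
    and "0 < \<eta>" and low: "\<And>z. z \<in> X \<Longrightarrow> ennreal c \<le> hausdorff m (X \<inter> ball z \<eta>)" and "0 < c"
    and H: "hausdorff m X \<le> ennreal h" "0 \<le> h"
  shows "real (card P) * c \<le> h"
proof (rule field_le_mult_one_interval)
  fix s :: real assume s: "0 < s" "s < 1"
  have "\<exists>\<delta>>0. ennreal (s * c) \<le> hausdorff_content m \<delta> (X \<inter> ball z \<eta>)" if "z \<in> P" for z
  proof -
    have "s * c < c" using s \<open>0 < c\<close> by simp
    then have "ennreal (s * c) < ennreal c" using s \<open>0 < c\<close> by (intro ennreal_lessI) auto
    also have "\<dots> \<le> hausdorff m (X \<inter> ball z \<eta>)" using low that P by auto
    finally show ?thesis unfolding hausdorff_def less_SUP_iff by (auto intro: less_imp_le)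
  qed
  then obtain \<delta> where \<delta>: "\<And>z. z \<in> P \<Longrightarrow> 0 < \<delta> z" "\<And>z. z \<in> P \<Longrightarrow> ennreal (s * c) \<le> hausdorff_content m (\<delta> z) (X \<inter> ball z \<eta>)"
    by metis
  define e where "e = Min (insert \<eta> (\<delta> ` P))"
  have e: "0 < e" "e \<le> \<eta>" "\<And>z. z \<in> P \<Longrightarrow> e \<le> \<delta> z"
    using P(1) \<delta>(1) \<open>0 < \<eta>\<close> by (auto simp: e_def)
  have "ennreal (real (card P) * (s * c)) = (\<Sum>z\<in>P. ennreal (s * c))"
    using s \<open>0 < c\<close> by (simp add: ennreal_mult ennreal_of_nat_eq_real_of_nat)
  also have "\<dots> \<le> (\<Sum>z\<in>P. hausdorff_content m e (X \<inter> ball z \<eta>))"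
    using \<delta>(2) e(3) by (intro sum_mono) (blast intro: order_trans hausdorff_content_antimono)
  also have "\<dots> \<le> hausdorff_content m e X"
    using e by (intro sum_hausdorff_content_le P sep) auto
  also have "\<dots> \<le> ennreal h"
    using hausdorff_content_le_hausdorff[OF e(1)] H order_trans by blast
  finally show "s * (real (card P) * c) \<le> h" using H(2) by (simp add: mult_ac)
qed

text \<open>The centres form a 3 \<eta>-separated subset of \<open>X\<close> of maximal cardinality.
  \<open>card_separated_le\<close> caps the cardinality; maximality makes the balls of radius 3
  \<eta> cover \<open>X\<close>, and since \<eta> \<le> R those of radius 4 R cover the
  neighbourhood.\<close>

theorem measure_neighbourhood_le:
  fixes X :: "'a::euclidean_space set"
  assumes X: "closed X" "X \<noteq> {}" and \<eta>: "0 < \<eta>" "\<eta> \<le> R"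
    and low: "\<And>z. z \<in> X \<Longrightarrow> ennreal c \<le> hausdorff m (X \<inter> ball z \<eta>)" and "0 < c"
    and H: "hausdorff m X \<le> ennreal h" "0 \<le> h"
  shows "emeasure lborel {z. infdist z X \<le> R} \<le> ennreal (4 ^ DIM('a) * unit_ball_vol (real DIM('a)) * R ^ DIM('a) * h / c)"
proof -
  define sepd where "sepd P \<longleftrightarrow> finite P \<and> P \<subseteq> X \<and> (\<forall>y\<in>P. \<forall>z\<in>P. y \<noteq> z \<longrightarrow> 3 * \<eta> \<le> dist y z)" for P
  have card_le: "real (card P) * c \<le> h" if "sepd P" for P
    using that \<open>0 < \<eta>\<close> low \<open>0 < c\<close> H unfolding sepd_def by (intro card_separated_le[of P X \<eta>]) auto
  have "\<exists>P. sepd P \<and> (\<forall>Q. sepd Q \<longrightarrow> card Q \<le> card P)"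
  proof (rule ex_has_greatest_nat)
    show "sepd {}" by (simp add: sepd_def)
    show "\<forall>Q. sepd Q \<longrightarrow> card Q < Suc (nat \<lceil>h / c\<rceil>)"
    proof (intro allI impI)
      fix Q assume "sepd Q"
      then have "real (card Q) \<le> h / c" using card_le \<open>0 < c\<close> by (simp add: field_simps)
      then show "card Q < Suc (nat \<lceil>h / c\<rceil>)" by linarith
    qed
  qed
  then obtain P where P: "sepd P" "\<And>Q. sepd Q \<Longrightarrow> card Q \<le> card P" by blast
  have fin: "finite P" using P(1) by (simp add: sepd_def)
  have cover: "\<exists>z\<in>P. dist x z < 3 * \<eta>" if "x \<in> X" for x
  proof (rule ccontr)
    assume *: "\<not> ?thesis"
    then have "x \<notin> P" using \<open>0 < \<eta>\<close> by force
    moreover have "sepd (insert x P)"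
      using P(1) that * by (auto simp: sepd_def dist_commute not_less)
    ultimately show False using P(2)[of "insert x P"] fin by simp
  qed
  have "{z. infdist z X \<le> R} \<subseteq> (\<Union>p\<in>P. cball p (4 * R))"
  proof
    fix z assume "z \<in> {z. infdist z X \<le> R}"
    moreover obtain x where "x \<in> X" "infdist z X = dist z x" using infdist_attains_inf[OF X] by blast
    moreover obtain p where "p \<in> P" "dist x p < 3 * \<eta>" using cover calculation by blast
    ultimately show "z \<in> (\<Union>p\<in>P. cball p (4 * R))"
      using \<eta> dist_triangle[of z p x] by (force simp: dist_commute)
  qed
  then have "emeasure lborel {z. infdist z X \<le> R} \<le> emeasure lborel (\<Union>p\<in>P. cball p (4 * R))"
    using fin by (intro emeasure_mono) auto
  also have "\<dots> \<le> (\<Sum>p\<in>P. emeasure lborel (cball p (4 * R)))"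
    using fin by (intro emeasure_subadditive_finite) auto
  also have "\<dots> = ennreal (real (card P) * (unit_ball_vol (real DIM('a)) * (4 * R) ^ DIM('a)))"
    using \<eta> by (simp add: emeasure_cball ennreal_mult' flip: ennreal_of_nat_eq_real_of_nat)
  also have "\<dots> \<le> ennreal ((h / c) * (unit_ball_vol (real DIM('a)) * (4 * R) ^ DIM('a)))"
    using card_le[OF P(1)] \<open>0 < c\<close> \<eta> by (intro ennreal_leI mult_right_mono) (auto simp: field_simps)
  finally show ?thesis by (simp add: power_mult_distrib mult_ac)
qed

text \<open>\<open>enn2real\<close> sends infinity to 0, so positivity requires a finite infimum; a
  nonempty frontier of finite measure provides it.\<close>

lemma boundary_const_bounds:
  fixes \<Omega> :: "'a::euclidean_space set"
  assumes reg: "regular_boundary \<Omega> \<eta>" and "0 < \<eta>" and fin: "hausdorff (DIM('a) - 1) (frontier \<Omega>) < \<infinity>"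
    and ne: "frontier \<Omega> \<noteq> {}"
  shows "0 < boundary_const \<Omega> \<eta>"
    and "z \<in> frontier \<Omega> \<Longrightarrow> ennreal (boundary_const \<Omega> \<eta> * \<eta> ^ (DIM('a) - 1)) \<le> hausdorff (DIM('a) - 1) (frontier \<Omega> \<inter> ball z \<eta>)"
proof -
  let ?H = "\<lambda>z r. hausdorff (DIM('a) - 1) (frontier \<Omega> \<inter> ball z r)"
  let ?p = "\<lambda>r. ennreal (r ^ (DIM('a) - 1))"
  define I where "I = (INF r\<in>{0<..\<eta>}. INF z\<in>frontier \<Omega>. ?H z r / ?p r)"
  obtain \<kappa> where \<kappa>: "\<kappa> > 0" "\<And>r z. 0 < r \<Longrightarrow> r \<le> \<eta> \<Longrightarrow> z \<in> frontier \<Omega> \<Longrightarrow> ennreal (\<kappa> * r ^ (DIM('a) - 1)) \<le> ?H z r"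
    using reg by (auto simp: regular_boundary_def)
  have "ennreal \<kappa> \<le> I"
    unfolding I_def
  proof (intro INF_greatest)
    fix r z assume r: "r \<in> {0<..\<eta>}" and z: "z \<in> frontier \<Omega>"
    have "ennreal \<kappa> = ennreal (\<kappa> * r ^ (DIM('a) - 1)) / ?p r"
      using r \<kappa>(1) by (simp add: divide_ennreal)
    also have "\<dots> \<le> ?H z r / ?p r" using r z by (intro divide_right_mono_ennreal \<kappa>(2)) auto
    finally show "ennreal \<kappa> \<le> ?H z r / ?p r" .
  qed
  have upper: "I \<le> ?H z \<eta> / ?p \<eta>" if "z \<in> frontier \<Omega>" for z
  proof -
    have "I \<le> (INF z\<in>frontier \<Omega>. ?H z \<eta> / ?p \<eta>)" unfolding I_def by (intro INF_lower) (use \<open>0 < \<eta>\<close> in simp)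
    also have "\<dots> \<le> ?H z \<eta> / ?p \<eta>" by (intro INF_lower that)
    finally show ?thesis .
  qed
  obtain z0 where "z0 \<in> frontier \<Omega>" using ne by blast
  have "?H z0 \<eta> \<le> hausdorff (DIM('a) - 1) (frontier \<Omega>)" by (rule hausdorff_mono) simp
  then have "?H z0 \<eta> < \<infinity>" using fin by simp
  then have "?H z0 \<eta> / ?p \<eta> < \<infinity>" using \<open>0 < \<eta>\<close>
    by (simp add: ennreal_divide_eq_top_iff flip: less_top)
  then have "I < \<infinity>" using upper[OF \<open>z0 \<in> frontier \<Omega>\<close>] by simp
  then have I: "I = ennreal (boundary_const \<Omega> \<eta>)"
    unfolding boundary_const_def I_def[symmetric] by simp
  show "0 < boundary_const \<Omega> \<eta>"
  proof (rule ccontr)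
    assume "\<not> ?thesis"
    then have "I = 0" unfolding I by (simp add: ennreal_neg)
    then show False using \<open>ennreal \<kappa> \<le> I\<close> \<kappa>(1) by simp
  qed
  then show "ennreal (boundary_const \<Omega> \<eta> * \<eta> ^ (DIM('a) - 1)) \<le> ?H z \<eta>" if "z \<in> frontier \<Omega>"
  proof -
    have "I * ?p \<eta> \<le> ?H z \<eta> / ?p \<eta> * ?p \<eta>" by (intro mult_right_mono upper that) simp
    also have "\<dots> = ?H z \<eta>"
      using \<open>0 < \<eta>\<close> by (simp add: ennreal_divide_times)
    finally show ?thesis using \<open>0 < boundary_const \<Omega> \<eta>\<close> \<open>0 < \<eta>\<close> by (simp add: I ennreal_mult')
  qed
qed

section \<open>Mass crossing the boundary\<close>

text \<open>A segment joining \<Omega> to its complement is connected and therefore meets the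
  frontier.\<close>

lemma mem_sweep_frontier:
  assumes "(z \<in> \<Omega>) \<noteq> (z + u \<in> \<Omega>)"
  shows "z \<in> sweep (frontier \<Omega>) u"
proof -
  have "closed_segment z (z + u) \<inter> frontier \<Omega> \<noteq> {}"
    using assms by (intro connected_Int_frontier) (auto simp: disjoint_iff)
  then obtain t where "0 \<le> t" "t \<le> 1" "(1 - t) *\<^sub>R z + t *\<^sub>R (z + u) \<in> frontier \<Omega>"
    by (auto simp: closed_segment_def)
  moreover have "(1 - t) *\<^sub>R z + t *\<^sub>R (z + u) = z + t *\<^sub>R u" by (simp add: algebra_simps)
  ultimately show ?thesis by (auto simp: sweep_def)
qed

lemma infdist_le_sweep:
  assumes "z \<in> sweep S u"
  shows "infdist z S \<le> norm u"
proof -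
  obtain t where t: "0 \<le> t" "t \<le> 1" "z + t *\<^sub>R u \<in> S" using assms by (auto simp: sweep_def)
  have "infdist z S \<le> dist z (z + t *\<^sub>R u)" by (rule infdist_le[OF t(3)])
  also have "\<dots> = t * norm u" using t by (simp add: dist_norm)
  also have "\<dots> \<le> norm u" using t by (simp add: mult_left_le_one_le)
  finally show ?thesis .
qed

abbreviation crossing :: "'a::euclidean_space set \<Rightarrow> 'a \<Rightarrow> 'a set" where
  "crossing \<Omega> z \<equiv> {u. (z \<in> \<Omega>) \<noteq> (z + u \<in> \<Omega>)}"

text \<open>Mass can only cross the boundary from \<open>z\<close> along vectors longer than the distance of \<open>z\<close> to the
  boundary; the moment of the density thus trades decay in that distance.\<close>

theorem crossing_mass_le:
  fixes \<Omega> :: "'a::euclidean_space set" and \<phi> :: "'a \<Rightarrow> real"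
  assumes \<Omega>: "compact \<Omega>" and dim: "2 \<le> DIM('a)" and \<phi> [measurable]: "\<phi> \<in> borel_measurable borel" and "\<And>u. 0 \<le> \<phi> u"
    and S [measurable]: "S \<in> sets borel" and W: "0 \<le> W" "0 \<le> \<beta>"
      "\<And>z. z \<in> S \<Longrightarrow> 1 \<le> W * (1 + infdist z (frontier \<Omega>)) powr \<beta>"
  shows "(\<integral>\<^sup>+z. indicator S z * (\<integral>\<^sup>+u. ennreal (\<phi> u) * indicator (crossing \<Omega> z) u \<partial>lborel) \<partial>lborel)
    \<le> ennreal (sweep_const TYPE('a) * W) * hausdorff (DIM('a) - 1) (frontier \<Omega>) *
       (\<integral>\<^sup>+u. ennreal ((1 + norm u) powr (\<beta> + 1) * \<phi> u) \<partial>lborel)"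
proof -
  let ?H = "hausdorff (DIM('a) - 1) (frontier \<Omega>)"
  have [measurable]: "\<Omega> \<in> sets borel" using \<Omega> by (rule borel_compact)
  have cF: "compact (frontier \<Omega>)" by (rule compact_frontier[OF \<Omega>])
  have m: "(\<lambda>(z, u). indicator S z * (ennreal (\<phi> u) * indicator (crossing \<Omega> z) u)) \<in> borel_measurable (borel \<Otimes>\<^sub>M borel)"
    unfolding split_beta' indicator_def by measurable
  have "(\<integral>\<^sup>+z. indicator S z * (\<integral>\<^sup>+u. ennreal (\<phi> u) * indicator (crossing \<Omega> z) u \<partial>lborel) \<partial>lborel)
    = (\<integral>\<^sup>+z. (\<integral>\<^sup>+u. indicator S z * (ennreal (\<phi> u) * indicator (crossing \<Omega> z) u) \<partial>lborel) \<partial>lborel)"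
    by (subst nn_integral_cmult) auto
  \<comment> \<open>With \<open>u\<close> held fixed, the points \<open>z\<close> whose membership
    it changes all lie in one sweep of the frontier.\<close>
  also have "\<dots> = (\<integral>\<^sup>+u. (\<integral>\<^sup>+z. indicator S z * (ennreal (\<phi> u) * indicator (crossing \<Omega> z) u) \<partial>lborel) \<partial>lborel)"
    by (rule lborel_pair.Fubini'[symmetric]) (use m in simp)
  also have "\<dots> \<le> (\<integral>\<^sup>+u. ennreal (sweep_const TYPE('a) * W) * ?H * ennreal ((1 + norm u) powr (\<beta> + 1) * \<phi> u) \<partial>lborel)"
  proof (rule nn_integral_mono)
    fix u :: 'a
    show "(\<integral>\<^sup>+z. indicator S z * (ennreal (\<phi> u) * indicator (crossing \<Omega> z) u) \<partial>lborel)
      \<le> ennreal (sweep_const TYPE('a) * W) * ?H * ennreal ((1 + norm u) powr (\<beta> + 1) * \<phi> u)"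
    proof (cases "u = 0")
      case False
      have "(\<integral>\<^sup>+z. indicator S z * (ennreal (\<phi> u) * indicator (crossing \<Omega> z) u) \<partial>lborel)
        \<le> (\<integral>\<^sup>+z. ennreal (W * (1 + norm u) powr \<beta> * \<phi> u) * indicator (sweep (frontier \<Omega>) u) z \<partial>lborel)"
      proof (rule nn_integral_mono)
        fix z
        show "indicator S z * (ennreal (\<phi> u) * indicator (crossing \<Omega> z) u)
          \<le> ennreal (W * (1 + norm u) powr \<beta> * \<phi> u) * indicator (sweep (frontier \<Omega>) u) z"
        proof (cases "z \<in> S \<and> (z \<in> \<Omega>) \<noteq> (z + u \<in> \<Omega>)")
          case True
          then have sw: "z \<in> sweep (frontier \<Omega>) u" by (intro mem_sweep_frontier) simp
          \<comment> \<open>A point of the sweep is within \<open>norm u\<close> of the frontier, so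
            its weight is dominated by a weight in \<open>u\<close> alone.\<close>
          have "1 \<le> W * (1 + infdist z (frontier \<Omega>)) powr \<beta>" using W(3) True by blast
          also have "\<dots> \<le> W * (1 + norm u) powr \<beta>"
            using W infdist_le_sweep[OF sw] infdist_nonneg[of z "frontier \<Omega>"] by (intro mult_left_mono powr_mono2) auto
          finally have "1 * \<phi> u \<le> W * (1 + norm u) powr \<beta> * \<phi> u" by (intro mult_right_mono assms(4))
          then show ?thesis using True sw by (simp add: ennreal_leI)
        qed auto
      qed
      also have "\<dots> = ennreal (W * (1 + norm u) powr \<beta> * \<phi> u) * emeasure lborel (sweep (frontier \<Omega>) u)"
        using cF by (intro nn_integral_cmult_indicator) auto
      also have "\<dots> \<le> ennreal (W * (1 + norm u) powr \<beta> * \<phi> u) * (ennreal (sweep_const TYPE('a) * norm u) * ?H)"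
        using cF by (intro mult_left_mono emeasure_sweep_le False dim) auto
      also have "\<dots> = ennreal (W * (1 + norm u) powr \<beta> * \<phi> u * (sweep_const TYPE('a) * norm u)) * ?H"
        using W assms(4) sweep_const_pos[where 'a = 'a] by (simp add: ennreal_mult mult_ac)
      also have "\<dots> \<le> ennreal (sweep_const TYPE('a) * W * ((1 + norm u) powr (\<beta> + 1) * \<phi> u)) * ?H"
      proof (intro mult_right_mono ennreal_leI)
        \<comment> \<open>The length of the sweep contributes the additional power that raises
          \<beta> to \<beta> + 1.\<close>
        have "norm u \<le> 1 + norm u" by simp
        then have "(1 + norm u) powr \<beta> * norm u \<le> (1 + norm u) powr \<beta> * (1 + norm u) powr 1"
          by (intro mult_left_mono) auto
        then have "(1 + norm u) powr \<beta> * norm u \<le> (1 + norm u) powr (\<beta> + 1)" by (simp only: powr_add)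
        then have "(W * \<phi> u * sweep_const TYPE('a)) * ((1 + norm u) powr \<beta> * norm u) \<le> (W * \<phi> u * sweep_const TYPE('a)) * (1 + norm u) powr (\<beta> + 1)"
          using W assms(4) sweep_const_pos[where 'a = 'a] by (intro mult_left_mono) auto
        then show "W * (1 + norm u) powr \<beta> * \<phi> u * (sweep_const TYPE('a) * norm u) \<le> sweep_const TYPE('a) * W * ((1 + norm u) powr (\<beta> + 1) * \<phi> u)"
          by (simp only: mult_ac)
      qed auto
      also have "\<dots> = ennreal (sweep_const TYPE('a) * W) * ?H * ennreal ((1 + norm u) powr (\<beta> + 1) * \<phi> u)"
        using W assms(4) sweep_const_pos[where 'a = 'a] by (simp add: ennreal_mult mult_ac)
      finally show ?thesis .
    qed simp
  qed
  also have "\<dots> = ennreal (sweep_const TYPE('a) * W) * ?H * (\<integral>\<^sup>+u. ennreal ((1 + norm u) powr (\<beta> + 1) * \<phi> u) \<partial>lborel)"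
    by (rule nn_integral_cmult) measurable
  finally show ?thesis .
qed

section \<open>Counting eigenvalues in the plunge region\<close>

text \<open>With \<open>x = \<tau> / 2\<close> the hypotheses give
  \<open>2 * h * x powr q \<le> 1\<close>. Since q \<le> 1, this 2 yields a factor at most 1/2 in
  the bound for \<open>x\<close>, which undoes the halving of \<tau>.\<close>

lemma plunge_exponent:
  fixes h q B N \<tau> :: real
  assumes "1 \<le> h" "0 < q" "q \<le> 1" "0 < B" "0 < \<tau>" and N: "2 * B * h \<le> N"
    and le: "N * (\<tau> / 2) \<le> B * (\<tau> / 2) powr (1 - q)"
  shows "\<tau> \<le> h powr (- (1 / q))"
proof -
  define x where "x = \<tau> / 2"
  have x: "0 < x" using assms by (simp add: x_def)
  have "2 * B * h * x \<le> B * x powr (1 - q)"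
    using order_trans[OF mult_right_mono[OF N, of x] le[folded x_def]] x by simp
  then have "2 * h * x \<le> x powr (1 - q)" using \<open>0 < B\<close> by simp
  then have "2 * h * x * x powr (q - 1) \<le> x powr (1 - q) * x powr (q - 1)"
    by (intro mult_right_mono) auto
  also have "\<dots> = 1" using x by (simp flip: powr_add)
  also have "2 * h * x * x powr (q - 1) = 2 * h * x powr q"
    using x powr_add[of x 1 "q - 1"] by (simp add: mult.assoc)
  finally have "x powr q \<le> 1 / (2 * h)" using \<open>1 \<le> h\<close> by (simp add: field_simps)
  then have "(x powr q) powr (1 / q) \<le> (1 / (2 * h)) powr (1 / q)"
    using assms by (intro powr_mono2) auto
  moreover have "(x powr q) powr (1 / q) = x" using x assms by (simp add: powr_powr)
  moreover have "(1 / (2 * h)) powr (1 / q) = (1 / 2) powr (1 / q) * (1 / h) powr (1 / q)"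
    using assms powr_mult[of "1 / 2" "1 / h" "1 / q"] by simp
  ultimately have "x \<le> (1 / 2) powr (1 / q) * (1 / h) powr (1 / q)" by simp
  also have "(1 / 2 :: real) powr (1 / q) \<le> (1 / 2) powr 1"
    using assms by (intro powr_mono') (auto simp: field_simps)
  finally have "x \<le> 1 / 2 * (1 / h) powr (1 / q)" by (simp add: mult_right_mono)
  moreover have "(1 / h) powr (1 / q) = h powr (- (1 / q))"
    using assms by (simp add: powr_minus_divide powr_divide)
  ultimately show ?thesis by (simp add: x_def)
qed

text \<open>The input of the counting argument: \<open>V\<close> is the volume of \<Omega>,
  \<open>B\<close> the boundary term, and \<open>a j\<close> the eigenvalue with number j + 1.
  \<open>sum_min\<close> bounds how many values are intermediate at level \<delta>;
  \<open>deficit\<close> fixes their position.\<close>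

locale plunge_counting =
  fixes a :: "nat \<Rightarrow> real" and V B q :: real
  assumes a01: "0 \<le> a j" "a j \<le> 1" and dec: "i \<le> j \<Longrightarrow> a j \<le> a i"
    and B: "0 < B" and q: "0 < q" "q \<le> 1"
    and sum_le: "(\<Sum>j<n. a j) \<le> V"
    and sum_min: "0 < \<delta> \<Longrightarrow> \<delta> \<le> 1 \<Longrightarrow> (\<Sum>j<n. min (a j * (1 - a j)) \<delta>) \<le> B * \<delta> powr (1 - q)"
    and deficit: "(\<Sum>j<n. a j * (1 - a j)) + (1 - a n) * (V - (\<Sum>j<n. a j)) \<le> B"
begin

text \<open>Values above 1/2 satisfy 1 - a \<le> 2 a (1 - a), so their number exceeds their sum,
  hence \<open>V\<close>, by at most 2 B. Conversely \<open>deficit\<close> at \<open>M\<close>,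
  where \<open>1 - a M\<close> is at least 1/2, leaves at most 2 B of \<open>V\<close>
  uncovered.\<close>

lemma ex_half_index: "\<exists>M. (\<forall>j<M. 1 / 2 < a j) \<and> (\<forall>j\<ge>M. a j \<le> 1 / 2) \<and> \<bar>real M - V\<bar> \<le> 2 * B"
proof -
  have "\<exists>n. a n \<le> 1 / 2"
  proof (rule ccontr)
    assume "\<not> ?thesis"
    then have "(\<Sum>j<nat \<lceil>2 * V\<rceil> + 1. 1 / 2) \<le> (\<Sum>j<nat \<lceil>2 * V\<rceil> + 1. a j)"
      by (intro sum_mono) (auto simp: not_le intro: less_imp_le)
    also have "\<dots> \<le> V" by (rule sum_le)
    finally show False by simp linarith
  qed
  define M where "M = (LEAST n. a n \<le> 1 / 2)"
  have M: "a M \<le> 1 / 2" unfolding M_def using \<open>\<exists>n. _\<close> by (rule LeastI_ex)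
  have lt: "1 / 2 < a j" if "j < M" for j using not_less_Least[of j] that by (force simp: M_def)
  have ge: "a j \<le> 1 / 2" if "M \<le> j" for j using dec[OF that] M by simp
  have V: "0 \<le> V - (\<Sum>j<M. a j)" using sum_le[of M] by simp
  have "(\<Sum>j<M. 1 - a j) \<le> (\<Sum>j<M. 2 * (a j * (1 - a j)))"
  proof (rule sum_mono)
    fix j assume "j \<in> {..<M}"
    then have "1 * (1 - a j) \<le> 2 * a j * (1 - a j)" using lt[of j] a01[of j] by (intro mult_right_mono) auto
    then show "1 - a j \<le> 2 * (a j * (1 - a j))" by simp
  qed
  also have "\<dots> \<le> 2 * B"
  proof -
    have "0 \<le> (1 - a M) * (V - (\<Sum>j<M. a j))" using V a01(2)[of M] by simp
    then show ?thesis using deficit[of M] by (simp flip: sum_distrib_left)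
  qed
  finally have 1: "real M - V \<le> 2 * B" using sum_le[of M] by (simp add: sum_subtractf)
  have "1 / 2 * (V - (\<Sum>j<M. a j)) \<le> (1 - a M) * (V - (\<Sum>j<M. a j))"
    using M V by (intro mult_right_mono) auto
  also have "\<dots> \<le> B"
  proof -
    have "0 \<le> (\<Sum>j<M. a j * (1 - a j))" using a01 by (intro sum_nonneg) auto
    then show ?thesis using deficit[of M] by linarith
  qed
  finally have "V - (\<Sum>j<M. a j) \<le> 2 * B" by simp
  moreover have "(\<Sum>j<M. a j) \<le> (\<Sum>j<M. 1)" using a01 by (intro sum_mono)
  ultimately have "V - real M \<le> 2 * B" by simp
  with 1 lt ge show ?thesis by (intro exI[of _ M]) auto
qed

lemma count_le:
  assumes "0 < \<delta>" "\<delta> \<le> 1" and "\<And>j. j \<in> {l..<m} \<Longrightarrow> \<delta> \<le> a j * (1 - a j)" "l \<le> m"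
  shows "(real m - real l) * \<delta> \<le> B * \<delta> powr (1 - q)"
proof -
  have "(real m - real l) * \<delta> = (\<Sum>j\<in>{l..<m}. \<delta>)" using assms(4) by (simp add: of_nat_diff)
  also have "\<dots> \<le> (\<Sum>j\<in>{l..<m}. min (a j * (1 - a j)) \<delta>)" using assms(3) by (intro sum_mono) auto
  also have "\<dots> \<le> (\<Sum>j<m. min (a j * (1 - a j)) \<delta>)"
    using a01 assms(1) by (intro sum_mono2) auto
  also have "\<dots> \<le> B * \<delta> powr (1 - q)" by (rule sum_min[OF assms(1,2)])
  finally show ?thesis .
qed

text \<open>Half of the margin 4 B h pays for the distance of \<open>M\<close> from
  \<open>V\<close>, as h \<ge> 1; the other half remains as the number of indices from
  \<open>M\<close> to \<open>k\<close>. At all of these \<open>a j * (1 - a j)\<close> is at least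
  \<open>a k / 2\<close>, so \<open>count_le\<close> is used with \<delta> taken from the value to
  be estimated.\<close>

lemma upper_plunge:
  assumes h: "1 \<le> h" and k: "real (Suc k) = real_of_int \<lceil>V\<rceil> + 4 * B * h"
  shows "a k \<le> h powr (- (1 / q))"
proof -
  obtain M where M: "\<And>j. j \<ge> M \<Longrightarrow> a j \<le> 1 / 2" "\<bar>real M - V\<bar> \<le> 2 * B"
    using ex_half_index by blast
  have Bh: "B \<le> B * h" using h B by simp
  have kM: "2 * B * h \<le> real (Suc k) - real M" "M < Suc k"
  proof -
    show *: "2 * B * h \<le> real (Suc k) - real M" using k M(2) Bh by linarith
    have "real M < real (Suc k)" using * Bh B by linarith
    then show "M < Suc k" by (simp only: of_nat_less_iff)
  qed
  show ?thesis
  proof (cases "a k = 0")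
    case False
    then have pos: "0 < a k" using a01(1)[of k] by simp
    show ?thesis
    proof (rule plunge_exponent[OF h q B pos kM(1)])
      show "(real (Suc k) - real M) * (a k / 2) \<le> B * (a k / 2) powr (1 - q)"
      proof (rule count_le)
        fix j assume j: "j \<in> {M..<Suc k}"
        have "a k * (1 / 2) \<le> a j * (1 - a j)"
          using M(1)[of j] dec[of j k] j a01[of j] by (intro mult_mono) auto
        then show "a k / 2 \<le> a j * (1 - a j)" by simp
      qed (use pos a01(2)[of k] kM in auto)
    qed
  qed simp
qed

lemma lower_plunge:
  assumes h: "1 \<le> h" and k: "real (Suc k) = real_of_int \<lceil>V\<rceil> - 4 * B * h"
  shows "1 - h powr (- (1 / q)) \<le> a k"
proof -
  obtain M where M: "\<And>j. j < M \<Longrightarrow> 1 / 2 < a j" "\<bar>real M - V\<bar> \<le> 2 * B"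
    using ex_half_index by blast
  have Bh: "B \<le> B * h" using h B by simp
  have kM: "2 * B * h \<le> real M - real k" "k < M"
  proof -
    \<comment> \<open>Rounding \<open>V\<close> up costs less than 1, and the shift from
      \<open>Suc k\<close> to \<open>k\<close> makes this good.\<close>
    have "real_of_int \<lceil>V\<rceil> < V + 1" by linarith
    then show *: "2 * B * h \<le> real M - real k" using k M(2) Bh by simp
    have "real k < real M" using * Bh B by linarith
    then show "k < M" by simp
  qed
  show ?thesis
  proof (cases "a k = 1")
    case False
    then have pos: "0 < 1 - a k" using a01(2)[of k] by simp
    have "1 - a k \<le> h powr (- (1 / q))"
    proof (rule plunge_exponent[OF h q B pos kM(1)])
      show "(real M - real k) * ((1 - a k) / 2) \<le> B * ((1 - a k) / 2) powr (1 - q)"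
      proof (rule count_le)
        fix j assume j: "j \<in> {k..<M}"
        have "1 / 2 * (1 - a k) \<le> a j * (1 - a j)"
          using M(1)[of j] dec[of k j] j a01[of j] a01[of k] by (intro mult_mono) auto
        then show "(1 - a k) / 2 \<le> a j * (1 - a j)" by simp
      qed (use pos a01(1)[of k] kM in auto)
    qed
    then show ?thesis by simp
  qed simp
qed

end

section \<open>Concentration operators as localization operators\<close>

text \<open>Fubini is justified by the boundedness of \<open>stft\<close>, the finite measure of
  \<Omega> and a bound for the inner integral that is uniform in \<open>z\<close>.\<close>

lemma ip_conc_op:
  fixes g f h :: "'a::euclidean_space L2"
  assumes \<Omega>: "compact \<Omega>"
  shows "ip (conc_op g \<Omega> f) h = (LINT z|lborel. indicator \<Omega> z * (ip f (tf_shift z g) * ip (tf_shift z g) h))"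
proof -
  let ?K = "\<lambda>z t. indicator \<Omega> z * (stft g f z * (rep_L2 g (t - fst z) * wave (snd z) t * cnj (rep_L2 h t)))"
  let ?k = "\<lambda>(z, t). ?K z t"
  have [measurable]: "\<Omega> \<in> sets borel" and fin: "emeasure lborel \<Omega> < \<infinity>"
    using borel_compact[OF \<Omega>] emeasure_bounded_finite[OF compact_imp_bounded[OF \<Omega>]] by simp_all
  have [measurable]: "\<Omega> \<in> sets (borel \<Otimes>\<^sub>M borel)" "stft g f \<in> borel_measurable (borel \<Otimes>\<^sub>M borel)"
    unfolding borel_prod by measurable
  obtain C where C: "\<And>z. cmod (stft g f z) \<le> C" using stft_bounded[of g f] by blast
  have C0: "0 \<le> C" using C[of undefined] norm_ge_zero order_trans by blast
  have K_meas: "(\<lambda>(z, t). ?K z t) \<in> borel_measurable ((lborel :: ('a \<times> 'a) measure) \<Otimes>\<^sub>M (lborel :: 'a measure))"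
    unfolding lborel_prod[symmetric, where 'a = 'a and 'b = 'a] by measurable
  have gh: "integrable lborel (\<lambda>t. rep_L2 g (t - fst z) * wave (snd z) t * cnj (rep_L2 h t))" for z
    by (rule integrable_mult_cnj_rep[OF square_integrable_tf_shift])
  have gh_bound: "(LINT t|lborel. cmod (rep_L2 g (t - fst z) * wave (snd z) t * cnj (rep_L2 h t))) \<le> (norm g)\<^sup>2 + (norm h)\<^sup>2" for z
  proof -
    have i: "integrable lborel (\<lambda>t. sqmod (rep_L2 g (t - fst z)))" "integrable lborel (\<lambda>t. sqmod (rep_L2 h t))"
      using lborel_integrable_shift[of "\<lambda>t. sqmod (rep_L2 g t)"] rep_L2_square_integrable[of g] rep_L2_square_integrable[of h]
      by (auto simp: square_integrable_def)
    have "(LINT t|lborel. cmod (rep_L2 g (t - fst z) * wave (snd z) t * cnj (rep_L2 h t)))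
      \<le> (LINT t|lborel. sqmod (rep_L2 g (t - fst z)) + sqmod (rep_L2 h t))"
    proof (intro integral_mono Bochner_Integration.integrable_add i integrable_norm gh)
      have "a * b \<le> a\<^sup>2 + b\<^sup>2" if "0 \<le> a" "0 \<le> b" for a b :: real
        using sum_squares_bound[of a b] that mult_nonneg_nonneg[of a b] by linarith
      then show "cmod (rep_L2 g (t - fst z) * wave (snd z) t * cnj (rep_L2 h t)) \<le> sqmod (rep_L2 g (t - fst z)) + sqmod (rep_L2 h t)" for t
        by (simp add: norm_mult)
    qed
    also have "\<dots> = (norm g)\<^sup>2 + (norm h)\<^sup>2"
    proof -
      have "complex_of_real (LINT t|lborel. sqmod (rep_L2 g (t - fst z))) = complex_of_real (LINT t|lborel. sqmod (rep_L2 g t))"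
        using lborel_integral_shift[of "\<lambda>t. complex_of_real (sqmod (rep_L2 g t))" "fst z"]
        unfolding integral_complex_of_real by simp
      then show ?thesis unfolding norm_L2_sq by (simp only: of_real_eq_iff Bochner_Integration.integral_add[OF i])
    qed
    finally show ?thesis .
  qed
  have K_int: "integrable (lborel \<Otimes>\<^sub>M lborel) (\<lambda>(z, t). ?K z t)"
  proof (rule lborel_pair.Fubini_integrable[OF K_meas])
    have "integrable lborel (\<lambda>z. indicat_real \<Omega> z * (C * ((norm g)\<^sup>2 + (norm h)\<^sup>2)))"
      using fin by simp
    then show "integrable lborel (\<lambda>z. LINT t|lborel. norm (?k (z, t)))"
    proof (rule Bochner_Integration.integrable_bound)
      show "(\<lambda>z. LINT t|lborel. norm (?k (z, t))) \<in> borel_measurable lborel"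
        by (rule lborel.borel_measurable_lebesgue_integral) (use K_meas in \<open>simp add: split_beta'\<close>)
      show "AE z in lborel. norm (LINT t|lborel. norm (?k (z, t))) \<le> norm (indicat_real \<Omega> z * (C * ((norm g)\<^sup>2 + (norm h)\<^sup>2)))"
      proof (rule AE_I2)
        fix z
        have "(LINT t|lborel. norm (?K z t)) = indicator \<Omega> z * (cmod (stft g f z) * (LINT t|lborel. cmod (rep_L2 g (t - fst z) * wave (snd z) t * cnj (rep_L2 h t))))"
          unfolding norm_mult[of "indicator \<Omega> z"] norm_mult[of "stft g f z"] integral_mult_right_zero
          by (simp add: indicator_def)
        also have "\<dots> \<le> indicator \<Omega> z * (C * ((norm g)\<^sup>2 + (norm h)\<^sup>2))"
          by (intro mult_left_mono mult_mono C C0 gh_bound integral_nonneg_AE AE_I2) auto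
        finally have "(LINT t|lborel. norm (?K z t)) \<le> indicator \<Omega> z * (C * ((norm g)\<^sup>2 + (norm h)\<^sup>2))" .
        moreover have "0 \<le> (LINT t|lborel. norm (?K z t))" by (intro integral_nonneg_AE AE_I2) auto
        ultimately show "norm (LINT t|lborel. norm (?k (z, t))) \<le> norm (indicat_real \<Omega> z * (C * ((norm g)\<^sup>2 + (norm h)\<^sup>2)))"
          unfolding prod.case real_norm_def by linarith
      qed
    qed
    show "AE z in lborel. integrable lborel (\<lambda>t. ?k (z, t))"
      using gh by (auto intro!: AE_I2)
  qed
  have "ip (conc_op g \<Omega> f) h = (LINT t|lborel. conc_fun g \<Omega> f t * cnj (rep_L2 h t))"
    unfolding conc_op_def by (rule ip_abs_left[OF square_integrable_conc_fun[OF \<Omega>]])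
  also have "\<dots> = (LINT t|lborel. (LINT z|lborel. ?K z t))"
  proof (intro Bochner_Integration.integral_cong refl)
    fix t
    have "conc_fun g \<Omega> f t * cnj (rep_L2 h t) = (LINT z|lborel. indicator \<Omega> z *\<^sub>R (stft g f z * rep_L2 g (t - fst z) * wave (snd z) t) * cnj (rep_L2 h t))"
      unfolding conc_fun_def set_lebesgue_integral_def by (rule integral_mult_left_zero[symmetric])
    also have "\<dots> = (LINT z|lborel. ?K z t)"
      by (intro Bochner_Integration.integral_cong refl) (simp add: indicator_def mult.assoc)
    finally show "conc_fun g \<Omega> f t * cnj (rep_L2 h t) = (LINT z|lborel. ?K z t)" .
  qed
  also have "\<dots> = (LINT z|lborel. (LINT t|lborel. ?K z t))"
    by (rule lborel_pair.Fubini_integral[OF K_int])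
  also have "\<dots> = (LINT z|lborel. indicator \<Omega> z * (ip f (tf_shift z g) * ip (tf_shift z g) h))"
  proof -
    have "(LINT t|lborel. rep_L2 g (t - fst z) * wave (snd z) t * cnj (rep_L2 h t)) = ip (tf_shift z g) h" for z
      unfolding tf_shift_def by (rule ip_abs_left[OF square_integrable_tf_shift, symmetric])
    then show ?thesis unfolding integral_mult_right_zero ip_tf_shift by simp
  qed
  finally show ?thesis .
qed

lemma localization_conc_op:
  fixes g :: "'a::euclidean_space L2"
  assumes \<Omega>: "compact \<Omega>" and g: "norm g = 1"
  shows "localization lborel (\<lambda>z. tf_shift z g) \<Omega> (conc_op g \<Omega>)"
proof
  show "norm (tf_shift z g) = 1" for z by (simp add: g)
  show "(\<lambda>z. ip f (tf_shift z g)) \<in> borel_measurable lborel" for f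
    by (simp add: ip_tf_shift)
  have [measurable]: "(\<lambda>x :: ('a \<times> 'a) \<times> 'a \<times> 'a. 2 * pi * ((snd (fst x) - snd (snd x)) \<bullet> fst (fst x))) \<in> borel_measurable borel"
    "(\<lambda>x :: ('a \<times> 'a) \<times> 'a \<times> 'a. snd x - fst x) \<in> borel_measurable borel"
    by (intro borel_measurable_continuous_onI continuous_intros)+
  show "(\<lambda>(z, w). ip (tf_shift z g) (tf_shift w g)) \<in> borel_measurable (lborel \<Otimes>\<^sub>M lborel)"
    unfolding ip_tf_shift_tf_shift split_beta' lborel_prod by measurable
  show "(\<integral>\<^sup>+z. ennreal (sqmod (ip f (tf_shift z g))) \<partial>lborel) = ennreal ((norm f)\<^sup>2)" for f
    unfolding ip_tf_shift moyal by (simp add: g)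
  show "emeasure lborel (space (lborel :: ('a \<times> 'a) measure)) = \<infinity>" by simp
  show "\<Omega> \<in> sets lborel" using borel_compact[OF \<Omega>] by simp
  show "emeasure lborel \<Omega> < \<infinity>" using emeasure_bounded_finite[OF compact_imp_bounded[OF \<Omega>]] by simp
  show "ip (conc_op g \<Omega> f) h = (LINT z|lborel. indicator \<Omega> z * (ip f (tf_shift z g) * ip (tf_shift z g) h))" for f h
    by (rule ip_conc_op[OF \<Omega>])
qed

context
  fixes g :: "'a::euclidean_space L2" and \<Omega> :: "('a \<times> 'a) set"
  assumes cpt: "compact \<Omega>" and g: "norm g = 1"
begin

interpretation localization lborel "\<lambda>z. tf_shift z g" \<Omega> "conc_op g \<Omega>"
  by (rule localization_conc_op[OF cpt g])

lemma approx_number_eq: "approx_number k = conc_eigenvalue g \<Omega> k"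
  unfolding approx_number_def conc_eigenvalue_def ..

text \<open>Of the two factors of \<open>leakage z\<close>, both in [0, 1], the one kept is the mass
  on the side of the boundary opposite to \<open>z\<close>: \<open>1 - local_mass z\<close> inside
  \<Omega>, \<open>local_mass z\<close> outside. Covariance rewrites it as an integral over
  displacements.\<close>

lemma leakage_le_crossing:
  "ennreal (leakage z) \<le> (\<integral>\<^sup>+u. ennreal (sqmod (stft g g u)) * indicator (crossing \<Omega> z) u \<partial>lborel)"
proof -
  have [measurable]: "\<Omega> \<in> sets borel" using cpt by (rule borel_compact)
  have crossing: "(\<integral>\<^sup>+w. ennreal (indicator {w. (z \<in> \<Omega>) \<noteq> (w \<in> \<Omega>)} w * sqmod (ip (tf_shift z g) (tf_shift w g))) \<partial>lborel)
    = (\<integral>\<^sup>+u. ennreal (sqmod (stft g g u)) * indicator (crossing \<Omega> z) u \<partial>lborel)"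
  proof -
    have "(\<integral>\<^sup>+w. ennreal (indicator {w. (z \<in> \<Omega>) \<noteq> (w \<in> \<Omega>)} w * sqmod (ip (tf_shift z g) (tf_shift w g))) \<partial>lborel)
      = (\<integral>\<^sup>+w. (\<lambda>u. ennreal (sqmod (stft g g u)) * indicator (crossing \<Omega> z) u) (w - z) \<partial>lborel)"
      by (intro nn_integral_cong) (auto simp: ip_tf_shift_tf_shift norm_mult indicator_def)
    also have "\<dots> = (\<integral>\<^sup>+u. ennreal (sqmod (stft g g u)) * indicator (crossing \<Omega> z) u \<partial>lborel)"
      by (rule nn_integral_lborel_shift) measurable
    finally show ?thesis .
  qed
  let ?c = "\<lambda>w. sqmod (ip (tf_shift z g) (tf_shift w g))"
  have i: "integrable lborel (\<lambda>w. indicat_real A w * ?c w)" if "A \<in> sets borel" for A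
    using that by (intro integrable_indicator_times coeff_integrable(1)) auto
  have lm: "local_mass z = (LINT w|lborel. indicator \<Omega> w * ?c w)"
    unfolding local_mass_def by (rule form_eq)
  have "(LINT w|lborel. indicator \<Omega> w * ?c w) + (LINT w|lborel. indicator (- \<Omega>) w * ?c w) = (LINT w|lborel. indicator \<Omega> w * ?c w + indicator (- \<Omega>) w * ?c w)"
    by (intro Bochner_Integration.integral_add[symmetric] i) auto
  also have "\<dots> = (LINT w|lborel. ?c w)"
    by (intro Bochner_Integration.integral_cong) (auto simp: indicator_def)
  also have "\<dots> = 1" by (simp only: coeff_integral(1) norm_k one_power2)
  finally have lm': "1 - local_mass z = (LINT w|lborel. indicator (- \<Omega>) w * ?c w)" unfolding lm by simp
  have "leakage z \<le> 1 - local_mass z" "leakage z \<le> local_mass z"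
    using local_mass_bounds[of z] by (auto simp: leakage_def mult_left_le_one_le mult_left_le)
  then have "leakage z \<le> (LINT w|lborel. indicator {w. (z \<in> \<Omega>) \<noteq> (w \<in> \<Omega>)} w * ?c w)"
    by (cases "z \<in> \<Omega>") (simp_all add: lm' lm[symmetric] Compl_eq[symmetric])
  also have "ennreal \<dots> = (\<integral>\<^sup>+w. ennreal (indicator {w. (z \<in> \<Omega>) \<noteq> (w \<in> \<Omega>)} w * ?c w) \<partial>lborel)"
    by (intro nn_integral_eq_integral[symmetric] i) auto
  finally show ?thesis unfolding crossing using ennreal_leI by simp
qed

end

section \<open>The window around the boundary and the final constants\<close>

lemma window_const_ge_1:
  fixes g :: "'a::euclidean_space L2"
  assumes g: "norm g = 1" and s: "0 \<le> s" and w: "weighted_integrable g s"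
  shows "1 \<le> window_const g s"
proof -
  have hb: "has_bochner_integral lborel (\<lambda>z. sqmod (stft g g z)) 1"
    by (rule has_bochner_integral_nn_integral) (simp_all add: moyal g)
  have "1 = (LINT z|lborel. sqmod (stft g g z))"
    using has_bochner_integral_integral_eq[OF hb] by simp
  also have "\<dots> \<le> window_const g s"
    unfolding window_const_def
  proof (rule integral_mono)
    show "integrable lborel (\<lambda>z. sqmod (stft g g z))" using hb by (rule integrable.intros)
    show "integrable lborel (\<lambda>z. (1 + norm z) powr s * sqmod (stft g g z))"
      using w by (simp add: weighted_integrable_def)
    show "sqmod (stft g g z) \<le> (1 + norm z) powr s * sqmod (stft g g z)" for z
      using mult_right_mono[OF ge_one_powr_ge_zero[of "1 + norm z" s], of "sqmod (stft g g z)"] s by simp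
  qed
  finally show ?thesis .
qed

lemma hausdorff_empty: "hausdorff m ({} :: 'a::metric_space set) = 0"
proof -
  have "hausdorff_content m \<delta> ({} :: 'a set) \<le> 0" if "\<delta> > 0" for \<delta>
    unfolding hausdorff_content_def
    by (rule INF_lower2[of "\<lambda>_. {}"]) (use that in auto)
  then have "hausdorff m ({} :: 'a set) \<le> 0" unfolding hausdorff_def by (intro SUP_least) auto
  then show ?thesis by simp
qed

text \<open>The radius, the inner \<open>powr\<close>, equates the volume cost \<delta> R^n / kt
  with the tail Cg R^(-\<beta>); this evaluates their common value.\<close>

lemma plunge_window_powr:
  fixes Cg kt \<delta> n \<beta> :: real
  assumes "0 < Cg" "0 < kt" "0 < \<delta>" "0 < n" "0 \<le> \<beta>"
  shows "Cg * ((Cg * kt / \<delta>) powr (1 / (n + \<beta>))) powr (- \<beta>)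
    = Cg powr (n / (n + \<beta>)) * kt powr (- (\<beta> / (n + \<beta>))) * \<delta> powr (1 - n / (n + \<beta>))"
proof -
  define e where "e = \<beta> / (n + \<beta>)"
  have e: "n / (n + \<beta>) = 1 - e" using assms by (simp add: e_def field_simps)
  have "((Cg * kt / \<delta>) powr (1 / (n + \<beta>))) powr (- \<beta>) = (Cg * kt / \<delta>) powr (- e)"
    by (simp add: powr_powr e_def)
  also have "\<dots> = Cg powr (- e) * kt powr (- e) * \<delta> powr e"
    using assms by (simp add: powr_divide powr_mult powr_minus field_simps)
  finally have "Cg * ((Cg * kt / \<delta>) powr (1 / (n + \<beta>))) powr (- \<beta>) = Cg * Cg powr (- e) * kt powr (- e) * \<delta> powr e"
    by simp
  also have "Cg * Cg powr (- e) = Cg powr (1 - e)" using powr_add[of Cg 1 "- e"] \<open>0 < Cg\<close> by simp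
  finally show ?thesis unfolding e e_def[symmetric] by simp
qed

text \<open>The first summand pays for the leakage outside the window, the second for the volume of
  the window.\<close>

definition plunge_const :: "'a::euclidean_space itself \<Rightarrow> real" where
  "plunge_const _ = sweep_const TYPE('a \<times> 'a) + 4 ^ (2 * DIM('a)) * unit_ball_vol (real (2 * DIM('a)))"

lemma plunge_const_pos: "0 < plunge_const TYPE('a::euclidean_space)"
  unfolding plunge_const_def using sweep_const_pos[where 'a = "'a \<times> 'a"]
  by (intro add_pos_nonneg) auto

definition boundary_area :: "('a::euclidean_space \<times> 'a) set \<Rightarrow> real" where
  "boundary_area \<Omega> = enn2real (hausdorff (2 * DIM('a) - 1) (frontier \<Omega>))"

definition boundary_density :: "('a::euclidean_space \<times> 'a) set \<Rightarrow> real \<Rightarrow> real" where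
  "boundary_density \<Omega> \<eta> = boundary_const \<Omega> \<eta> * \<eta> ^ (2 * DIM('a) - 1)"

context
  fixes g :: "'a::euclidean_space L2" and \<Omega> :: "('a \<times> 'a) set" and \<eta> s :: real
  assumes cpt: "compact \<Omega>" and g: "norm g = 1"
    and H: "0 < hausdorff (2 * DIM('a) - 1) (frontier \<Omega>)" "hausdorff (2 * DIM('a) - 1) (frontier \<Omega>) < \<infinity>"
    and \<eta>: "0 < \<eta>" "\<eta> \<le> 1" and reg: "regular_boundary \<Omega> \<eta>"
    and s: "1 \<le> s" and w: "weighted_integrable g s"
begin

interpretation localization lborel "\<lambda>z. tf_shift z g" \<Omega> "conc_op g \<Omega>"
  by (rule localization_conc_op[OF cpt g])

lemma DIM_phase_space: "DIM('a \<times> 'a) = 2 * DIM('a)"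
  by simp

lemma boundary_area: "hausdorff (2 * DIM('a) - 1) (frontier \<Omega>) = ennreal (boundary_area \<Omega>)" "0 < boundary_area \<Omega>"
  using H by (auto simp: boundary_area_def enn2real_positive_iff)

lemma frontier_nonempty: "frontier \<Omega> \<noteq> {}"
  using H(1) by (metis hausdorff_empty less_irrefl)

lemma boundary_fin: "hausdorff (DIM('a \<times> 'a) - 1) (frontier \<Omega>) < \<infinity>"
  using H(2) unfolding DIM_phase_space .

lemma boundary_density_pos: "0 < boundary_density \<Omega> \<eta>"
  unfolding boundary_density_def using \<eta>(1)
  by (intro mult_pos_pos boundary_const_bounds(1)[OF reg \<eta>(1) boundary_fin frontier_nonempty]) auto

lemma leakage_on_le:
  assumes S: "S \<in> sets borel" and W: "0 \<le> W"
      "\<And>z. z \<in> S \<Longrightarrow> 1 \<le> W * (1 + infdist z (frontier \<Omega>)) powr (s - 1)"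
  shows "(LINT z|lborel. indicator S z * leakage z) \<le> sweep_const TYPE('a \<times> 'a) * W * boundary_area \<Omega> * window_const g s"
proof -
  let ?K = "sweep_const TYPE('a \<times> 'a)"
  have K: "0 < ?K" by (rule sweep_const_pos)
  have wc: "0 \<le> window_const g s" using window_const_ge_1[OF g _ w] s by simp
  have "ennreal (LINT z|lborel. indicator S z * leakage z) = (\<integral>\<^sup>+z. ennreal (indicator S z * leakage z) \<partial>lborel)"
    by (intro nn_integral_eq_integral[symmetric] integrable_indicator_times leakage_integrable) (use S leakage_nonneg in auto)
  also have "\<dots> \<le> (\<integral>\<^sup>+z. indicator S z * (\<integral>\<^sup>+u. ennreal (sqmod (stft g g u)) * indicator (crossing \<Omega> z) u \<partial>lborel) \<partial>lborel)"
  proof (rule nn_integral_mono)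
    show "ennreal (indicator S z * leakage z) \<le> indicator S z * (\<integral>\<^sup>+u. ennreal (sqmod (stft g g u)) * indicator (crossing \<Omega> z) u \<partial>lborel)" for z
      using leakage_le_crossing[OF cpt g, of z] by (cases "z \<in> S") simp_all
  qed
  also have "\<dots> \<le> ennreal (?K * W) * hausdorff (DIM('a \<times> 'a) - 1) (frontier \<Omega>) *
       (\<integral>\<^sup>+u. ennreal ((1 + norm u) powr ((s - 1) + 1) * sqmod (stft g g u)) \<partial>lborel)"
    using s DIM_positive[where 'a = 'a] by (intro crossing_mass_le cpt S W) (auto simp del: DIM_positive)
  also have "(\<integral>\<^sup>+u. ennreal ((1 + norm u) powr ((s - 1) + 1) * sqmod (stft g g u)) \<partial>lborel) = ennreal (window_const g s)"
    using w unfolding window_const_def weighted_integrable_def by (simp add: nn_integral_eq_integral)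
  also have "ennreal (?K * W) * hausdorff (DIM('a \<times> 'a) - 1) (frontier \<Omega>) * ennreal (window_const g s)
    = ennreal (?K * W * boundary_area \<Omega> * window_const g s)"
    unfolding DIM_phase_space boundary_area(1) using K W boundary_area(2) wc by (simp add: ennreal_mult)
  finally show ?thesis using K W boundary_area(2) wc by (subst (asm) ennreal_le_iff) auto
qed

text \<open>The window is the neighbourhood of the frontier with the balancing radius
  \<open>R\<close>. Its volume bound requires \<eta> \<le> R, which holds if 1 \<le> R. For R < 1
  the empty window works: then \<open>W\<close> is at least 1, and the bound for the total leakage
  is already small enough.\<close>

lemma ex_window:
  assumes \<delta>: "0 < \<delta>"
  shows "\<exists>G\<in>sets borel. emeasure lborel G < \<infinity> \<and> \<delta> * measure lborel G + (LINT z|lborel. indicator (- G) z * leakage z)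
    \<le> plunge_const TYPE('a) * (window_const g s powr (2 * real DIM('a) / (2 * real DIM('a) + s - 1)) *
        boundary_density \<Omega> \<eta> powr (- ((s - 1) / (2 * real DIM('a) + s - 1))) * boundary_area \<Omega>) * \<delta> powr (1 - 2 * real DIM('a) / (2 * real DIM('a) + s - 1))"
proof -
  define n where "n = 2 * DIM('a)"
  define \<beta> where "\<beta> = s - 1"
  define Cg where "Cg = window_const g s"
  let ?K1 = "sweep_const TYPE('a \<times> 'a)" and ?K2 = "4 ^ n * unit_ball_vol (real n)"
  have n: "0 < real n" "0 < n" by (simp_all add: n_def)
  have \<beta>: "0 \<le> \<beta>" "\<beta> + 1 = s" using s by (simp_all add: \<beta>_def)
  have Cg: "1 \<le> Cg" unfolding Cg_def using window_const_ge_1[OF g _ w] s by simp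
  have K1: "0 < ?K1" by (rule sweep_const_pos)
  have K2: "0 \<le> ?K2" by simp
  define R where "R = (Cg * boundary_density \<Omega> \<eta> / \<delta>) powr (1 / (n + \<beta>))"
  have R0: "0 < R" using Cg boundary_density_pos \<delta> by (simp add: R_def)
  define W where "W = R powr (- \<beta>)"
  have W0: "0 < W" using R0 by (simp add: W_def)
  have eq: "plunge_const TYPE('a) * boundary_area \<Omega> * (Cg * W)
     = plunge_const TYPE('a) * (Cg powr (n / (n + \<beta>)) * boundary_density \<Omega> \<eta> powr (- (\<beta> / (n + \<beta>))) * boundary_area \<Omega>) * \<delta> powr (1 - n / (n + \<beta>))"
    unfolding W_def R_def using plunge_window_powr[of Cg "boundary_density \<Omega> \<eta>" \<delta> "real n" \<beta>] Cg boundary_density_pos \<delta> n \<beta> by simp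
  have goal: "\<exists>G\<in>sets borel. emeasure lborel G < \<infinity> \<and> \<delta> * measure lborel G + (LINT z|lborel. indicator (- G) z * leakage z)
    \<le> plunge_const TYPE('a) * boundary_area \<Omega> * (Cg * W)"
  proof (cases "1 \<le> R")
    case True
    define G where "G = {z. infdist z (frontier \<Omega>) \<le> R}"
    have Gb [measurable]: "G \<in> sets borel"
      unfolding G_def by (intro borel_closed closed_Collect_le continuous_intros)
    have em: "emeasure lborel G \<le> ennreal (4 ^ DIM('a \<times> 'a) * unit_ball_vol (real DIM('a \<times> 'a)) * R ^ DIM('a \<times> 'a) * boundary_area \<Omega> / boundary_density \<Omega> \<eta>)"
      unfolding G_def
    proof (rule measure_neighbourhood_le[where \<eta> = \<eta> and m = "2 * DIM('a) - 1"])
      show "closed (frontier \<Omega>)" by simp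
      show "\<eta> \<le> R" using True \<eta> by simp
      show "ennreal (boundary_density \<Omega> \<eta>) \<le> hausdorff (2 * DIM('a) - 1) (frontier \<Omega> \<inter> ball z \<eta>)" if "z \<in> frontier \<Omega>" for z
        using boundary_const_bounds(2)[OF reg \<eta>(1) boundary_fin frontier_nonempty that]
        unfolding boundary_density_def DIM_phase_space .
    qed (use frontier_nonempty \<eta> boundary_density_pos boundary_area in auto)
    have fin: "emeasure lborel G < \<infinity>" using em by (rule order_le_less_trans) simp
    have "measure lborel G \<le> ?K2 * R ^ n * boundary_area \<Omega> / boundary_density \<Omega> \<eta>"
      unfolding measure_def using em K2 R0 boundary_area(2) boundary_density_pos
      by (intro enn2real_leI) (auto simp: n_def DIM_phase_space simp del: DIM_prod)
    then have "\<delta> * measure lborel G \<le> \<delta> * (?K2 * R ^ n * boundary_area \<Omega> / boundary_density \<Omega> \<eta>)" using \<delta> by (intro mult_left_mono) auto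
    also have "\<dots> = ?K2 * boundary_area \<Omega> * (\<delta> / boundary_density \<Omega> \<eta> * R powr n)"
      using R0 by (simp add: powr_realpow)
    also have "\<delta> / boundary_density \<Omega> \<eta> * R powr n = Cg * W"
    proof -
      have "R powr (n + \<beta>) = Cg * boundary_density \<Omega> \<eta> / \<delta>"
        unfolding R_def powr_powr using n \<beta> Cg boundary_density_pos \<delta> by simp
      then have "R powr n * R powr \<beta> = Cg * boundary_density \<Omega> \<eta> / \<delta>" by (simp add: powr_add)
      moreover have "R powr n = R powr n * R powr \<beta> * W"
        using R0 by (simp add: W_def mult.assoc flip: powr_add)
      ultimately have "R powr n = Cg * boundary_density \<Omega> \<eta> / \<delta> * W" by simp
      then show ?thesis using \<delta> boundary_density_pos by simp
    qed
    finally have 1: "\<delta> * measure lborel G \<le> ?K2 * boundary_area \<Omega> * (Cg * W)" .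
    have "(LINT z|lborel. indicator (- G) z * leakage z) \<le> ?K1 * W * boundary_area \<Omega> * window_const g s"
    proof (rule leakage_on_le)
      show "- G \<in> sets borel" by measurable
      show "0 \<le> W" using W0 by simp
      fix z assume "z \<in> - G"
      then have "R \<le> 1 + infdist z (frontier \<Omega>)" by (simp add: G_def)
      then have "W * R powr \<beta> \<le> W * (1 + infdist z (frontier \<Omega>)) powr \<beta>"
        using R0 W0 \<beta> by (intro mult_left_mono powr_mono2) auto
      moreover have "W * R powr \<beta> = 1" using R0 by (simp add: W_def flip: powr_add)
      ultimately show "1 \<le> W * (1 + infdist z (frontier \<Omega>)) powr (s - 1)" by (simp add: \<beta>_def)
    qed
    then have 2: "(LINT z|lborel. indicator (- G) z * leakage z) \<le> ?K1 * boundary_area \<Omega> * (Cg * W)"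
      by (simp add: Cg_def mult_ac)
    have "\<delta> * measure lborel G + (LINT z|lborel. indicator (- G) z * leakage z) \<le> plunge_const TYPE('a) * boundary_area \<Omega> * (Cg * W)"
      using add_mono[OF 1 2] by (simp add: plunge_const_def n_def distrib_right)
    then show ?thesis using Gb fin by blast
  next
    case False
    have W1: "1 \<le> W"
      using powr_mono2'[of "\<beta>" R 1] False R0 \<beta> powr_le1[of \<beta> R]
      by (simp add: W_def powr_minus one_le_inverse_iff)
    have "(LINT z|lborel. indicator (- {}) z * leakage z) \<le> ?K1 * 1 * boundary_area \<Omega> * window_const g s"
      using \<beta>(1) infdist_nonneg by (intro leakage_on_le) (auto simp: \<beta>_def intro!: ge_one_powr_ge_zero)
    also have "\<dots> \<le> plunge_const TYPE('a) * boundary_area \<Omega> * (Cg * 1)"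
      using boundary_area(2) Cg K2 by (simp add: Cg_def plunge_const_def n_def mult_right_mono distrib_right)
    also have "\<dots> \<le> plunge_const TYPE('a) * boundary_area \<Omega> * (Cg * W)"
      using boundary_area(2) Cg W1 plunge_const_pos[where 'a = 'a] by (intro mult_left_mono) auto
    finally show ?thesis by (intro bexI[of _ "{}"]) auto
  qed
  have e: "2 * real DIM('a) = real n" "real n + s - 1 = real n + \<beta>" "s - 1 = \<beta>"
    by (simp_all add: n_def \<beta>_def)
  show ?thesis using goal unfolding eq Cg_def[symmetric] e .
qed

lemma plunge_counting_conc:
  defines "q \<equiv> 2 * real DIM('a) / (2 * real DIM('a) + s - 1)"
  shows "plunge_counting (\<lambda>j. conc_eigenvalue g \<Omega> (Suc j)) (measure lborel \<Omega>)
    (plunge_const TYPE('a) * (window_const g s powr q * boundary_density \<Omega> \<eta> powr (- ((s - 1) / (2 * real DIM('a) + s - 1))) * boundary_area \<Omega>)) q"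
    (is "plunge_counting _ _ ?B q")
proof
  note eq = approx_number_eq[OF cpt g, symmetric]
  show "0 \<le> conc_eigenvalue g \<Omega> (Suc j)" "conc_eigenvalue g \<Omega> (Suc j) \<le> 1" for j
    unfolding eq by (rule approx_number_bounds01)+
  show "conc_eigenvalue g \<Omega> (Suc j) \<le> conc_eigenvalue g \<Omega> (Suc i)" if "i \<le> j" for i j
    unfolding eq by (rule approx_number_antimono[OF that])
  have "0 < window_const g s" using window_const_ge_1[OF g _ w] s by simp
  then show "0 < ?B" using plunge_const_pos[where 'a = 'a] boundary_density_pos boundary_area(2) by simp
  have "0 < real DIM('a)" by simp
  then show "0 < q" "q \<le> 1" using s by (auto simp: q_def simp del: DIM_positive)
  show "(\<Sum>j<n. conc_eigenvalue g \<Omega> (Suc j)) \<le> measure lborel \<Omega>" for n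
    unfolding eq by (rule sum_approx_number_le)
  show "(\<Sum>j<n. min (conc_eigenvalue g \<Omega> (Suc j) * (1 - conc_eigenvalue g \<Omega> (Suc j))) \<delta>) \<le> ?B * \<delta> powr (1 - q)"
    if \<delta>: "0 < \<delta>" for \<delta> n
  proof -
    obtain G where G: "G \<in> sets borel" "emeasure lborel G < \<infinity>"
      "\<delta> * measure lborel G + (LINT z|lborel. indicator (- G) z * leakage z) \<le> ?B * \<delta> powr (1 - q)"
      using ex_window[OF \<delta>] unfolding q_def by blast
    have "(\<Sum>j<n. min (approx_number (Suc j) * (1 - approx_number (Suc j))) \<delta>)
      \<le> \<delta> * measure lborel G + (LINT z|lborel. indicator (space lborel - G) z * leakage z)"
      using G \<delta> by (intro sum_min_le) auto
    then show ?thesis using G(3) unfolding eq by (simp add: Compl_eq_Diff_UNIV)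
  qed
  show "(\<Sum>j<n. conc_eigenvalue g \<Omega> (Suc j) * (1 - conc_eigenvalue g \<Omega> (Suc j)))
      + (1 - conc_eigenvalue g \<Omega> (Suc n)) * (measure lborel \<Omega> - (\<Sum>j<n. conc_eigenvalue g \<Omega> (Suc j))) \<le> ?B" for n
  proof -
    \<comment> \<open>At \<delta> = 1 the window controls the total leakage, because the leakage is
      at most 1 on the window.\<close>
    obtain G where G: "G \<in> sets borel" "emeasure lborel G < \<infinity>"
      "1 * measure lborel G + (LINT z|lborel. indicator (- G) z * leakage z) \<le> ?B * 1 powr (1 - q)"
      using ex_window[of 1] unfolding q_def by auto
    have "leakage z \<le> 1" for z using leakage_le[of z] local_mass_bounds(2)[of z] by linarith
    have i: "integrable lborel (indicat_real G)" "integrable lborel (\<lambda>z. indicator (- G) z * leakage z)"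
      using G by (simp, intro integrable_indicator_times leakage_integrable) simp
    have "(LINT z|lborel. leakage z) \<le> (LINT z|lborel. indicator G z + indicator (- G) z * leakage z)"
    proof (intro integral_mono leakage_integrable Bochner_Integration.integrable_add i)
      show "leakage z \<le> indicator G z + indicator (- G) z * leakage z" for z
        using \<open>\<And>z. leakage z \<le> 1\<close>[of z] by (cases "z \<in> G") auto
    qed
    also have "\<dots> = measure lborel G + (LINT z|lborel. indicator (- G) z * leakage z)"
      unfolding Bochner_Integration.integral_add[OF i] using G by simp
    also have "\<dots> \<le> ?B" using G(3) by simp
    finally show ?thesis unfolding eq using trace_deficit_le[of n] by linarith
  qed
qed

text \<open>By \<open>window_const_ge_1\<close> and 1 \<le> h the logarithm is nonnegative, so both
  additional factors of the stated error are at least 1.\<close>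

lemma plunge_error_ge:
  assumes "1 \<le> h" "1 \<le> p"
  shows "h powr (- p) \<le> exp (p\<^sup>2) * h powr (- p) * (1 + ln (window_const g s * h)) powr (p - 1)"
proof -
  have "1 * 1 \<le> window_const g s * h"
    using window_const_ge_1[OF g _ w] s assms by (intro mult_mono) auto
  then have "1 \<le> (1 + ln (window_const g s * h)) powr (p - 1)"
    using assms by (intro ge_one_powr_ge_zero) auto
  then have "1 * 1 \<le> exp (p\<^sup>2) * (1 + ln (window_const g s * h)) powr (p - 1)"
    by (intro mult_mono) auto
  from mult_left_mono[OF this, of "h powr (- p)"] show ?thesis by (simp add: mult_ac)
qed

end

theorem corollary1p8:
  shows "\<exists>C>0. \<forall>(\<Omega> :: ((real^'n) \<times> (real^'n)) set) (\<eta>::real) (g :: (real^'n) L2) (s::real).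
    compact \<Omega> \<and>
    0 < hausdorff (2 * CARD('n) - 1) (frontier \<Omega>) \<and>
    hausdorff (2 * CARD('n) - 1) (frontier \<Omega>) < \<infinity> \<and>
    0 < \<eta> \<and> \<eta> \<le> 1 \<and> regular_boundary \<Omega> \<eta> \<and>
    norm g = 1 \<and> 1 \<le> s \<and> weighted_integrable g s \<longrightarrow>
    (let d = real CARD('n);
         Cg = window_const g s;
         \<gamma> = C * Cg powr (2 * d / (2 * d + s - 1))
               * (boundary_const \<Omega> \<eta> * \<eta> ^ (2 * CARD('n) - 1)) powr (- ((s - 1) / (2 * d + s - 1)))
               * enn2real (hausdorff (2 * CARD('n) - 1) (frontier \<Omega>));
         A = real_of_int \<lceil>measure lborel \<Omega>\<rceil>;
         err = (\<lambda>h. exp (((2 * d + s - 1) / (2 * d))\<^sup>2)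
                 * h powr (- ((2 * d + s - 1) / (2 * d)))
                 * (1 + ln (Cg * h)) powr ((s - 1) / (2 * d)))
     in (\<forall>(k::nat) (h::real). 1 \<le> k \<and> 1 \<le> h \<and> real k = A + \<gamma> * h \<longrightarrow>
           conc_eigenvalue g \<Omega> k \<le> err h) \<and>
        (\<forall>(k::nat) (h::real). 1 \<le> k \<and> 1 \<le> h \<and> real k = A - \<gamma> * h \<longrightarrow>
           1 - err h \<le> conc_eigenvalue g \<Omega> k))"
proof (intro exI[of _ "4 * plunge_const TYPE(real^'n)"] conjI allI impI)
  \<comment> \<open>The factor 4 is the margin in \<open>upper_plunge\<close> and
    \<open>lower_plunge\<close>; it makes \<gamma> equal to \<open>4 * B\<close>.\<close>
  show "0 < 4 * plunge_const TYPE(real^'n)" using plunge_const_pos by simp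
next
  fix \<Omega> :: "((real^'n) \<times> (real^'n)) set" and \<eta> s :: real and g :: "(real^'n) L2"
  assume asm: "compact \<Omega> \<and>
    0 < hausdorff (2 * CARD('n) - 1) (frontier \<Omega>) \<and>
    hausdorff (2 * CARD('n) - 1) (frontier \<Omega>) < \<infinity> \<and>
    0 < \<eta> \<and> \<eta> \<le> 1 \<and> regular_boundary \<Omega> \<eta> \<and>
    norm g = 1 \<and> 1 \<le> s \<and> weighted_integrable g s"
  have D: "DIM(real^'n) = CARD('n)" by simp
  define d where "d = real CARD('n)"
  have d: "0 < d" by (simp add: d_def)
  have s: "1 \<le> s" using asm by blast
  define q where "q = 2 * d / (2 * d + s - 1)"
  define B where "B = plunge_const TYPE(real^'n) * (window_const g s powr q *
    (boundary_const \<Omega> \<eta> * \<eta> ^ (2 * CARD('n) - 1)) powr (- ((s - 1) / (2 * d + s - 1))) *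
    enn2real (hausdorff (2 * CARD('n) - 1) (frontier \<Omega>)))"
  interpret plunge_counting "\<lambda>j. conc_eigenvalue g \<Omega> (Suc j)" "measure lborel \<Omega>" B q
    using plunge_counting_conc[of \<Omega> g \<eta> s] asm unfolding boundary_area_def boundary_density_def D B_def q_def d_def by simp
  define p where "p = (2 * d + s - 1) / (2 * d)"
  have p: "1 \<le> p" "1 / q = p" "(s - 1) / (2 * d) = p - 1"
    using d s by (auto simp: p_def q_def field_simps)
  have err: "h powr (- (1 / q)) \<le> exp (p\<^sup>2) * h powr (- p) * (1 + ln (window_const g s * h)) powr (p - 1)"
    if "1 \<le> h" for h :: real
    unfolding p(2) using plunge_error_ge[of \<Omega> g \<eta> s h p] asm that p(1) D by simp
  have up: "conc_eigenvalue g \<Omega> k \<le> exp (p\<^sup>2) * h powr (- p) * (1 + ln (window_const g s * h)) powr (p - 1)"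
    if k: "1 \<le> k" "1 \<le> h" "real k = real_of_int \<lceil>measure lborel \<Omega>\<rceil> + 4 * B * h" for k :: nat and h :: real
  proof -
    obtain j where "k = Suc j" using k by (cases k) auto
    then show ?thesis using upper_plunge[of h j] k err[of h] by force
  qed
  have low: "1 - exp (p\<^sup>2) * h powr (- p) * (1 + ln (window_const g s * h)) powr (p - 1) \<le> conc_eigenvalue g \<Omega> k"
    if k: "1 \<le> k" "1 \<le> h" "real k = real_of_int \<lceil>measure lborel \<Omega>\<rceil> - 4 * B * h" for k :: nat and h :: real
  proof -
    obtain j where "k = Suc j" using k by (cases k) auto
    then show ?thesis using lower_plunge[of h j] k err[of h] by force
  qed
  have \<gamma>: "4 * plunge_const TYPE(real^'n) * window_const g s powr q *
    (boundary_const \<Omega> \<eta> * \<eta> ^ (2 * CARD('n) - 1)) powr (- ((s - 1) / (2 * d + s - 1))) *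
    enn2real (hausdorff (2 * CARD('n) - 1) (frontier \<Omega>)) = 4 * B"
    by (simp add: B_def)
  show "let d = real CARD('n);
         Cg = window_const g s;
         \<gamma> = 4 * plunge_const TYPE(real^'n) * Cg powr (2 * d / (2 * d + s - 1))
               * (boundary_const \<Omega> \<eta> * \<eta> ^ (2 * CARD('n) - 1)) powr (- ((s - 1) / (2 * d + s - 1)))
               * enn2real (hausdorff (2 * CARD('n) - 1) (frontier \<Omega>));
         A = real_of_int \<lceil>measure lborel \<Omega>\<rceil>;
         err = (\<lambda>h. exp (((2 * d + s - 1) / (2 * d))\<^sup>2)
                 * h powr (- ((2 * d + s - 1) / (2 * d)))
                 * (1 + ln (Cg * h)) powr ((s - 1) / (2 * d)))
     in (\<forall>(k::nat) (h::real). 1 \<le> k \<and> 1 \<le> h \<and> real k = A + \<gamma> * h \<longrightarrow>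
           conc_eigenvalue g \<Omega> k \<le> err h) \<and>
        (\<forall>(k::nat) (h::real). 1 \<le> k \<and> 1 \<le> h \<and> real k = A - \<gamma> * h \<longrightarrow>
           1 - err h \<le> conc_eigenvalue g \<Omega> k)"
    unfolding Let_def d_def[symmetric] p_def[symmetric] q_def[symmetric] p(3) \<gamma> using up low by blast
qed

end
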